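(* Let $\mathcal A\subset\mathbb N^4$ be a Firla–Ziegler configuration, and let $\mathcal A^d\subset\mathbb Z^d$ ($d\ge 5$), with the cones $K_1,K_2$ and the triangulation $\Delta^d$ of $cone(\mathcal A^d)$ with maximal cells $K_1,K_2$, be constructed recursively from $\mathcal A^4:=\mathcal A$ as described in the context. Then for each $d\ge 5$ the configuration $\mathcal A^d$ has the following properties: (1) $\mathbb Z(\mathcal A^d\cap K_1)=\mathbb Z(\mathcal A^d\cap K_2)=\mathbb Z^d$; (2) $\mathcal A^d$ is non-simplicial; (3) $\mathcal A^d$ is $\Delta^d$-normal; and (4) $\mathcal A^d$ admits no unimodular triangulations.
   Context: General notions. Let $\mathbb K$ be a field, $\mathbb N=\{0,1,2,\dots\}$, and let $\mathcal B=\{\mathbf b_1,\dots,\mathbf b_n\}\subset\mathbb Z^d$ be a finite vector configuration. $cone(\mathcal B)$, $\mathbb Z\mathcal B$, $\mathbb N\mathcal B$ are the sets of $\mathbb R_{\ge0}$-, $\mathbb Z$-, $\mathbb N$-linear combinations of $\mathcal B$; the rank of $\mathbb Z\mathcal B$ is assumed to be $d$. $\mathcal B$ is normal if $\mathbb N\mathcal B=cone(\mathcal B)\cap\mathbb Z\mathcal B$. $\mathcal B$ is simplicial if $cone(\mathcal B)$ is simplicial, i.e. generated by $d$ linearly independent vectors; otherwise it is non-simplicial. A finite set $H$ is a Hilbert basis of a semigroup $S$ if $\mathbb N H=S$. For $\tau\subseteq[n]=\{1,\dots,n\}$ put $\mathcal B_\tau=\{\mathbf b_i:i\in\tau\}$.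 A pure $(d-1)$-dimensional simplicial complex $\Delta$ on $[n]$ (not every element of $[n]$ need be used), with set of facets $\max\Delta$, is a triangulation of $\mathcal B$ if $cone(\mathcal B)=\bigcup_{\sigma\in\max\Delta}cone(\mathcal B_\sigma)$ and $cone(\mathcal B_\sigma)\cap cone(\mathcal B_{\sigma'})=cone(\mathcal B_{\sigma\cap\sigma'})$ for all $\sigma,\sigma'\in\max\Delta$. It is unimodular if $\mathbb Z\mathcal B_\sigma=\mathbb Z\mathcal B$ for every $\sigma\in\max\Delta$. The toric ideal of $\mathcal B$ is $I_{\mathcal B}=\langle\mathbf x^{\mathbf u}-\mathbf x^{\mathbf v}:\mathbf u,\mathbf v\in\mathbb N^n,\ \sum_i u_i\mathbf b_i=\sum_i v_i\mathbf b_i\rangle\subseteq\mathbb K[x_1,\dots,x_n]$. The radical of any monomial initial ideal of $I_{\mathcal B}$ is the Stanley–Reisner ideal $\langle\prod_{i\in\tau}x_i:\tau\notin\Delta\rangle$ of a triangulation $\Delta$ of $\mathcal B$; triangulations arising in this way are called regular. $\mathcal B$ is $\Delta$-normal if $\Delta$ is a regular triangulation of $\mathcal B$ such that for each $\sigma\in\max\Delta$ the set $\mathcal B\cap cone(\mathcal B_\sigma)$ is a Hilbert basis of $cone(\mathcal B_\sigma)\cap\mathbb Z\mathcal B$. Firla–Ziegler configurations. These are normal simplicial configurations $\mathcal A\subset\mathbb N^4$ that have no unimodular triangulations and are of the following form: $\mathcal A$ is the unique minimal generating set (minimal Hilbert basis) of the semigroup $cone(\mathcal A_{ext})\cap\mathbb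 Z^4$, where $\mathcal A_{ext}=\{\mathbf e_1,\mathbf e_2,\mathbf e_3,\mathbf v\}$, $\mathbf e_i$ denotes the $i$-th unit vector, and $\mathbf v=(v_1,v_2,v_3,v_4)\in\mathbb N^4$ with $0<v_1<v_2<v_3<v_4$. (Such configurations exist; the first found has $\mathbf v=(1,2,3,5)$.) Construction. Put $\mathcal A^4:=\mathcal A$ and $\mathcal A^4_{ext}:=\mathcal A_{ext}$; for $d\ge5$, $\mathcal A^d_{ext}$ denotes the set of generators in $\mathcal A^d$ of the extreme rays of $cone(\mathcal A^d)$. For each $d\ge5$ let $\mathbf p_d=\mathbf e_1+\mathbf e_2+\mathbf e_3+\mathbf e_4\in\mathbb Z^d$, $\mathbf p_d^+=\mathbf p_d+\mathbf e_d$, $\mathbf p_d^-=\mathbf p_d-\mathbf e_d$, and recursively define $(\mathcal A^{d-1})'=\{(\mathbf a,0):\mathbf a\in\mathcal A^{d-1}\}$, $(\mathcal A^{d-1}_{ext})'=\{(\mathbf a,0):\mathbf a\in\mathcal A^{d-1}_{ext}\}$, and $\mathcal A^d=\{\mathbf p_d^+,\mathbf p_d^-\}\cup(\mathcal A^{d-1})'$, where $\mathbf p_d^+$ and $\mathbf p_d^-$ are taken to be the first and second elements of $\mathcal A^d$. Let $\sigma$ be the index set of $(\mathcal A^{d-1}_{ext})'$ in $\mathcal A^d$, $\sigma_1=\{1\}\cup\sigma$, $\sigma_2=\{2\}\cup\sigma$, and $K_1=cone(\mathcal A^d_{\sigma_1})$, $K_2=cone(\mathcal A^d_{\sigma_2})$.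 $\Delta^d$ is the triangulation of $cone(\mathcal A^d)$ consisting of the maximal subcones $K_1$ and $K_2$ (i.e. with maximal faces $\sigma_1,\sigma_2$), so for $\Delta^d$ the Hilbert basis condition in the definition of $\Delta^d$-normality says that $\mathcal A^d\cap K_i$ is a Hilbert basis of $K_i\cap\mathbb Z\mathcal A^d$ for $i=1,2$.
   Formalization: Property (3) as worded fails for d ≥ 6, since K_1, K_2 are then not simplicial (cone(A^5) has 6 extreme rays); there Δ^d-normal is read as: K_1, K_2 form a regular polyhedral subdivision with the Hilbert basis condition. For d = 5 it is as stated. *)

theory Defs
  imports
    "Jordan_Normal_Form.VS_Connect"
    "HOL-Library.Poly_Mapping"
    "HOL-Algebra.Ideal"
begin

section \<open>Vector configurations\<close>

text \<open>
  A configuration in \<open>\<int>\<^sup>d\<close> is a list \<open>B\<close> of integer vectors of dimension \<open>d\<close>. Its index set is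
  \<open>{..<length B}\<close>, so indices are shifted by one against the usual \<open>{1..n}\<close>. All spans below are
  only used for finite sets \<open>S \<subseteq> carrier_vec d\<close>.
\<close>

definition cone :: "nat \<Rightarrow> real vec set \<Rightarrow> real vec set" where
  "cone d S = {vec d (\<lambda>k. \<Sum>s\<in>S. c s * s $ k) | c :: real vec \<Rightarrow> real. \<forall>s\<in>S. 0 \<le> c s}"

definition Z_span :: "nat \<Rightarrow> int vec set \<Rightarrow> int vec set" where
  "Z_span d S = {vec d (\<lambda>k. \<Sum>s\<in>S. c s * s $ k) | c :: int vec \<Rightarrow> int. True}"

definition N_span :: "nat \<Rightarrow> int vec set \<Rightarrow> int vec set" where
  "N_span d S = {vec d (\<lambda>k. \<Sum>s\<in>S. int (c s) * s $ k) | c :: int vec \<Rightarrow> nat. True}"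

abbreviation rvec :: "int vec \<Rightarrow> real vec" where
  "rvec \<equiv> map_vec real_of_int"

abbreviation icone :: "nat \<Rightarrow> int vec set \<Rightarrow> real vec set" where
  "icone d S \<equiv> cone d (rvec ` S)"

definition sub :: "int vec list \<Rightarrow> nat set \<Rightarrow> int vec set" where
  "sub B \<tau> = (\<lambda>i. B ! i) ` \<tau>"

definition normal_config :: "nat \<Rightarrow> int vec list \<Rightarrow> bool" where
  "normal_config d B \<longleftrightarrow>
     N_span d (set B) = {x \<in> Z_span d (set B). rvec x \<in> icone d (set B)}"

definition simplicial_config :: "nat \<Rightarrow> int vec list \<Rightarrow> bool" where
  "simplicial_config d B \<longleftrightarrow>
     (\<exists>G. G \<subseteq> carrier_vec d \<and> finite G \<and> card G = d \<and>
          \<not> LinearCombinations.module.lin_dep class_ring (module_vec TYPE(real) d) G \<and>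
          cone d G = icone d (set B))"

definition hilbert_basis :: "nat \<Rightarrow> int vec set \<Rightarrow> int vec set \<Rightarrow> bool" where
  "hilbert_basis d H S \<longleftrightarrow> finite H \<and> H \<subseteq> carrier_vec d \<and> N_span d H = S"

definition minimal_hilbert_basis :: "nat \<Rightarrow> int vec set \<Rightarrow> int vec set \<Rightarrow> bool" where
  "minimal_hilbert_basis d H S \<longleftrightarrow>
     hilbert_basis d H S \<and> (\<forall>H'. H' \<subset> H \<longrightarrow> \<not> hilbert_basis d H' S)"

section \<open>Triangulations\<close>

definition simplicial_complex :: "nat \<Rightarrow> nat set set \<Rightarrow> bool" where
  "simplicial_complex n \<Delta> \<longleftrightarrow>
     \<Delta> \<subseteq> Pow {..<n} \<and> (\<forall>\<sigma>\<in>\<Delta>. \<forall>\<tau>. \<tau> \<subseteq> \<sigma> \<longrightarrow> \<tau> \<in> \<Delta>)"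

definition max_sets :: "nat set set \<Rightarrow> nat set set" where
  "max_sets \<Delta> = {\<sigma> \<in> \<Delta>. \<forall>\<tau>\<in>\<Delta>. \<sigma> \<subseteq> \<tau> \<longrightarrow> \<tau> = \<sigma>}"

definition subdivides :: "nat \<Rightarrow> int vec list \<Rightarrow> nat set set \<Rightarrow> bool" where
  "subdivides d B M \<longleftrightarrow>
     icone d (set B) = (\<Union>\<sigma>\<in>M. icone d (sub B \<sigma>)) \<and>
     (\<forall>\<sigma>\<in>M. \<forall>\<sigma>'\<in>M.
        icone d (sub B \<sigma>) \<inter> icone d (sub B \<sigma>') = icone d (sub B (\<sigma> \<inter> \<sigma>')))"

definition triangulation :: "nat \<Rightarrow> int vec list \<Rightarrow> nat set set \<Rightarrow> bool" where
  "triangulation d B \<Delta> \<longleftrightarrow>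
     simplicial_complex (length B) \<Delta> \<and> (\<forall>\<sigma>\<in>max_sets \<Delta>. card \<sigma> = d) \<and>
     subdivides d B (max_sets \<Delta>)"

definition unimodular_triangulation :: "nat \<Rightarrow> int vec list \<Rightarrow> nat set set \<Rightarrow> bool" where
  "unimodular_triangulation d B \<Delta> \<longleftrightarrow>
     triangulation d B \<Delta> \<and>
     (\<forall>\<sigma>\<in>max_sets \<Delta>. Z_span d (sub B \<sigma>) = Z_span d (set B))"

section \<open>Toric ideals, initial ideals and regular triangulations\<close>

text \<open>
  \<open>\<bbbK>[x\<^sub>0, \<dots>, x\<^sub>n\<^sub>-\<^sub>1]\<close> is the subring of \<open>(nat \<Rightarrow>\<^sub>0 nat) \<Rightarrow>\<^sub>0 'k\<close> of those finitely supported coefficient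
  functions whose exponents involve only variables with index below \<open>n\<close>.
\<close>

type_synonym 'k mpol = "(nat \<Rightarrow>\<^sub>0 nat) \<Rightarrow>\<^sub>0 'k"

definition monomials :: "nat \<Rightarrow> (nat \<Rightarrow>\<^sub>0 nat) set" where
  "monomials n = {u. Poly_Mapping.keys u \<subseteq> {..<n}}"

definition poly_ring :: "nat \<Rightarrow> 'k::field mpol ring" where
  "poly_ring n = \<lparr>carrier = {f. Poly_Mapping.keys f \<subseteq> monomials n},
                  mult = (*), one = 1, zero = 0, add = (+)\<rparr>"

definition xpow :: "(nat \<Rightarrow>\<^sub>0 nat) \<Rightarrow> 'k::field mpol" where
  "xpow u = Poly_Mapping.single u 1"

definition toric_ideal :: "nat \<Rightarrow> int vec list \<Rightarrow> 'k::field mpol set" where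
  "toric_ideal d B = genideal (poly_ring (length B))
     {xpow u - xpow v | u v. u \<in> monomials (length B) \<and> v \<in> monomials (length B) \<and>
        (\<forall>k<d. (\<Sum>i<length B. int (Poly_Mapping.lookup u i) * (B ! i) $ k) =
               (\<Sum>i<length B. int (Poly_Mapping.lookup v i) * (B ! i) $ k))}"

text \<open>\<open>(u, v) \<in> r\<close> means that \<open>u\<close> is less than or equal to \<open>v\<close> in the term order \<open>r\<close>.\<close>

definition term_order :: "nat \<Rightarrow> (nat \<Rightarrow>\<^sub>0 nat) rel \<Rightarrow> bool" where
  "term_order n r \<longleftrightarrow>
     linear_order_on (monomials n) r \<and>
     (\<forall>u\<in>monomials n. (0, u) \<in> r) \<and>
     (\<forall>u v. \<forall>w\<in>monomials n. (u, v) \<in> r \<longrightarrow> (u + w, v + w) \<in> r)"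

definition initial_ideal ::
  "nat \<Rightarrow> (nat \<Rightarrow>\<^sub>0 nat) rel \<Rightarrow> 'k::field mpol set \<Rightarrow> 'k mpol set" where
  "initial_ideal n r I = genideal (poly_ring n)
     {xpow u | u. \<exists>f\<in>I. u \<in> Poly_Mapping.keys f \<and> (\<forall>v\<in>Poly_Mapping.keys f. (v, u) \<in> r)}"

definition radical :: "nat \<Rightarrow> 'k::field mpol set \<Rightarrow> 'k mpol set" where
  "radical n I = {f \<in> carrier (poly_ring n). \<exists>k>0. f ^ k \<in> I}"

definition stanley_reisner_ideal :: "nat \<Rightarrow> nat set set \<Rightarrow> 'k::field mpol set" where
  "stanley_reisner_ideal n \<Delta> = genideal (poly_ring n)
     {(\<Prod>i\<in>\<tau>. xpow (Poly_Mapping.single i 1)) | \<tau>. \<tau> \<subseteq> {..<n} \<and> \<tau> \<notin> \<Delta>}"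

text \<open>The type argument carries the ground field.\<close>

definition regular_triangulation ::
  "'k::field itself \<Rightarrow> nat \<Rightarrow> int vec list \<Rightarrow> nat set set \<Rightarrow> bool" where
  "regular_triangulation K d B \<Delta> \<longleftrightarrow>
     triangulation d B \<Delta> \<and>
     (\<exists>r. term_order (length B) r \<and>
          radical (length B) (initial_ideal (length B) r (toric_ideal d B :: 'k mpol set)) =
            stanley_reisner_ideal (length B) \<Delta>)"

definition hilbert_cells :: "nat \<Rightarrow> int vec list \<Rightarrow> nat set set \<Rightarrow> bool" where
  "hilbert_cells d B M \<longleftrightarrow>
     (\<forall>\<sigma>\<in>M. hilbert_basis d {b \<in> set B. rvec b \<in> icone d (sub B \<sigma>)}
                {x \<in> Z_span d (set B). rvec x \<in> icone d (sub B \<sigma>)})"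

definition delta_normal ::
  "'k::field itself \<Rightarrow> nat \<Rightarrow> int vec list \<Rightarrow> nat set set \<Rightarrow> bool" where
  "delta_normal K d B \<Delta> \<longleftrightarrow>
     regular_triangulation K d B \<Delta> \<and> hilbert_cells d B (max_sets \<Delta>)"

section \<open>Regular subdivisions\<close>

text \<open>
  The polyhedral counterpart of \<open>delta_normal\<close>, for cells that need not be simplices. A family of
  index sets is a regular subdivision if it consists of the maximal cells induced by some weight
  \<open>\<omega>\<close>, that is, of the maximal sets of indices at which a linear functional bounded above by \<open>\<omega>\<close>
  on the configuration attains equality.
\<close>

definition weight_cells :: "nat \<Rightarrow> int vec list \<Rightarrow> (nat \<Rightarrow> real) \<Rightarrow> nat set set" where
  "weight_cells d B \<omega> =
     {{i. i < length B \<and> c \<bullet> rvec (B ! i) = \<omega> i} | c.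
        c \<in> carrier_vec d \<and> (\<forall>i<length B. c \<bullet> rvec (B ! i) \<le> \<omega> i)}"

definition subdivision_normal :: "nat \<Rightarrow> int vec list \<Rightarrow> nat set set \<Rightarrow> bool" where
  "subdivision_normal d B M \<longleftrightarrow>
     subdivides d B M \<and> (\<exists>\<omega>. M = max_sets (weight_cells d B \<omega>)) \<and> hilbert_cells d B M"

section \<open>Firla--Ziegler configurations and the recursive construction\<close>

definition A_ext :: "int vec \<Rightarrow> int vec set" where
  "A_ext v = {unit_vec 4 0, unit_vec 4 1, unit_vec 4 2, v}"

text \<open>
  The clause \<open>A_ext v \<subseteq> set A\<close> says that \<open>v\<close> is the primitive generator of its ray. This loses no
  configuration, since dividing \<open>v\<close> by the gcd of its entries changes neither the cone nor the
  conditions on \<open>v\<close>, and it is needed for the elements of \<open>A_ext v\<close> to have indices in \<open>A\<close>.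
\<close>

definition firla_ziegler :: "int vec list \<Rightarrow> int vec \<Rightarrow> bool" where
  "firla_ziegler A v \<longleftrightarrow>
     distinct A \<and> set A \<subseteq> carrier_vec 4 \<and> (\<forall>a\<in>set A. \<forall>k<4. 0 \<le> a $ k) \<and>
     v \<in> carrier_vec 4 \<and> 0 < v $ 0 \<and> v $ 0 < v $ 1 \<and> v $ 1 < v $ 2 \<and> v $ 2 < v $ 3 \<and>
     A_ext v \<subseteq> set A \<and>
     minimal_hilbert_basis 4 (set A) {x \<in> carrier_vec 4. rvec x \<in> icone 4 (A_ext v)} \<and>
     normal_config 4 A \<and> simplicial_config 4 A \<and>
     \<not> (\<exists>\<Delta>. unimodular_triangulation 4 A \<Delta>)"

definition p_mid :: "nat \<Rightarrow> int vec" where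
  "p_mid d = unit_vec d 0 + unit_vec d 1 + unit_vec d 2 + unit_vec d 3"

definition p_plus :: "nat \<Rightarrow> int vec" where
  "p_plus d = p_mid d + unit_vec d (d - 1)"

definition p_minus :: "nat \<Rightarrow> int vec" where
  "p_minus d = p_mid d - unit_vec d (d - 1)"

definition lift :: "int vec \<Rightarrow> int vec" where
  "lift a = a @\<^sub>v 0\<^sub>v 1"

text \<open>\<open>conf A d\<close> is \<open>A\<^sup>d\<close> for \<open>d \<ge> 4\<close>; for \<open>d < 4\<close> it takes the irrelevant value \<open>A\<close>.\<close>

primrec conf :: "int vec list \<Rightarrow> nat \<Rightarrow> int vec list" where
  "conf A 0 = A"
| "conf A (Suc d) =
     (if d < 4 then A else p_plus (Suc d) # p_minus (Suc d) # map lift (conf A d))"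

definition extreme_generators :: "nat \<Rightarrow> int vec list \<Rightarrow> int vec set" where
  "extreme_generators d B =
     {b \<in> set B. b \<noteq> 0\<^sub>v d \<and>
        (\<forall>x\<in>icone d (set B). \<forall>y\<in>icone d (set B).
           x + y = rvec b \<longrightarrow> x \<in> icone d {b} \<and> y \<in> icone d {b})}"

definition conf_ext :: "int vec list \<Rightarrow> int vec \<Rightarrow> nat \<Rightarrow> int vec set" where
  "conf_ext A v d = (if d \<le> 4 then A_ext v else extreme_generators d (conf A d))"

definition base_cell :: "int vec list \<Rightarrow> int vec \<Rightarrow> nat \<Rightarrow> nat set" where
  "base_cell A v d =
     {i. i < length (conf A d) \<and> conf A d ! i \<in> lift ` conf_ext A v (d - 1)}"

definition cell1 :: "int vec list \<Rightarrow> int vec \<Rightarrow> nat \<Rightarrow> nat set" where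
  "cell1 A v d = insert 0 (base_cell A v d)"

definition cell2 :: "int vec list \<Rightarrow> int vec \<Rightarrow> nat \<Rightarrow> nat set" where
  "cell2 A v d = insert 1 (base_cell A v d)"

definition K1 :: "int vec list \<Rightarrow> int vec \<Rightarrow> nat \<Rightarrow> real vec set" where
  "K1 A v d = icone d (sub (conf A d) (cell1 A v d))"

definition K2 :: "int vec list \<Rightarrow> int vec \<Rightarrow> nat \<Rightarrow> real vec set" where
  "K2 A v d = icone d (sub (conf A d) (cell2 A v d))"

definition Delta :: "int vec list \<Rightarrow> int vec \<Rightarrow> nat \<Rightarrow> nat set set" where
  "Delta A v d = {\<tau>. \<tau> \<subseteq> cell1 A v d \<or> \<tau> \<subseteq> cell2 A v d}"

text \<open>
  For \<open>d = 5\<close> the cells of \<open>Delta A v d\<close> have \<open>d\<close> elements and it is a triangulation. For \<open>d \<ge> 6\<close>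
  the cone over \<open>conf A (d - 1)\<close> has more than \<open>d - 1\<close> extreme rays, so the two maximal cells are
  not simplices and \<open>Delta A v d\<close> is only a polyhedral subdivision with maximal cells \<open>K1\<close> and
  \<open>K2\<close>. Normality with respect to it is therefore \<open>subdivision_normal\<close> in every dimension and, in
  the simplicial case, in addition \<open>delta_normal\<close>.
\<close>

definition Delta_d_normal :: "'k::field itself \<Rightarrow> int vec list \<Rightarrow> int vec \<Rightarrow> nat \<Rightarrow> bool" where
  "Delta_d_normal K A v d \<longleftrightarrow>
     subdivision_normal d (conf A d) (max_sets (Delta A v d)) \<and>
     (d = 5 \<longrightarrow> delta_normal K d (conf A d) (Delta A v d))"

end

theory Submission
  imports Defs
begin

text \<open>
  The cone over \<open>\<A>\<^sup>d\<close> is a bipyramid over the cone over \<open>\<A>\<^sup>d\<^sup>-\<^sup>1\<close>: the midpoint \<open>p\<close> of the two apexes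
  \<open>p \<plusminus> e\<^sub>d\<close> is a lattice point of the base. Subtracting the last coordinate times an apex projects
  each half of the bipyramid onto the base, so that normality, lattice generation and the
  subdivision into two halves pass from the base to the bipyramid by induction on \<open>d\<close>. Two apexes
  cannot be vertices of one unimodular simplex, since their midpoint is a lattice point; hence every
  cell of a unimodular triangulation has exactly one apex, and removing it gives a unimodular
  triangulation of the base. In a simplicial cone the segment between the apexes would lie on a face
  of dimension two, but \<open>p\<close> is interior to the base. For \<open>d = 5\<close> the regular triangulation comes
  from the term order that first compares the degree in the variables outside the four
  extreme generators of the base.
\<close>

section \<open>Spans with restricted coefficients\<close>

text \<open>The obstacle is that from dimension 6 on the cells are built over the extreme generators
  of a cone that is not simplicial. The induction therefore carries, besides saturation and lattice
  generation, a spanning set of extreme generators whose rays avoid \<open>p\<close>: these stay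
  extreme in the bipyramid, and the two apexes join them. One invariant serves every step because
  \<open>p_mid\<close> keeps its four leading ones when a coordinate is appended, so the same point
  is the midpoint of every new pair of apexes. At the start, the strict inequalities between the
  entries of \<open>v\<close> put \<open>p\<close> inside the cone and off the ray of
  \<open>v\<close>. For regularity no Groebner basis is computed: in an element of the toric ideal
  no monomial is alone in its degree, so the unique lightest monomial of a degree never leads. The
  weight is 0 on the base generators and 1 on all other vectors. The binomials for the non-faces
  come from the factor \<open>v $ 3\<close>, the index of the lattice spanned by
  \<open>A_ext v\<close>, which carries every lattice point of the cone into the semigroup of
  \<open>A_ext v\<close>.\<close>

locale coefficients =
  fixes P :: "'a::comm_ring_1 set"
  assumes zero_P [simp]: "0 \<in> P" and one_P [simp]: "1 \<in> P"
    and add_P [simp]: "a \<in> P \<Longrightarrow> b \<in> P \<Longrightarrow> a + b \<in> P"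
    and mult_P [simp]: "a \<in> P \<Longrightarrow> b \<in> P \<Longrightarrow> a * b \<in> P"

text \<open>\<open>P\<close> is the set of admissible coefficients: the nonnegative reals give
  \<open>cone\<close>, all integers \<open>Z_span\<close>, the nonnegative integers
  \<open>N_span\<close>. The last choice keeps the coefficients in the ring of the vectors, so that
  the projection along an apex is proved once for all three spans.\<close>

definition gspan :: "'a::comm_ring_1 set \<Rightarrow> nat \<Rightarrow> 'a vec set \<Rightarrow> 'a vec set" where
  "gspan P d S = {vec d (\<lambda>k. \<Sum>s\<in>S. c s * s $ k) | c. \<forall>s\<in>S. c s \<in> P}"

lemma cone_eq_gspan: "cone d S = gspan {0..} d S"
  by (auto simp: cone_def gspan_def)

lemma Z_span_eq_gspan: "Z_span d S = gspan UNIV d S"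
  by (auto simp: Z_span_def gspan_def)

lemma N_span_eq_gspan: "N_span d S = gspan {0..} d S"
proof (intro equalityI subsetI)
  fix x assume "x \<in> N_span d S"
  then show "x \<in> gspan {0..} d S"
    by (force simp: N_span_def gspan_def)
next
  fix x assume "x \<in> gspan {0..} d S"
  then obtain c where x: "x = vec d (\<lambda>k. \<Sum>s\<in>S. c s * s $ k)" and c: "\<forall>s\<in>S. 0 \<le> c s"
    by (auto simp: gspan_def)
  have "(\<Sum>s\<in>S. c s * s $ k) = (\<Sum>s\<in>S. int (nat (c s)) * s $ k)" for k
    by (rule sum.cong) (use c in auto)
  then show "x \<in> N_span d S"
    unfolding N_span_def x by (intro CollectI exI[of _ "\<lambda>s. nat (c s)"]) auto
qed

interpretation real_nonneg: coefficients "{0..} :: real set"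
  by standard auto

interpretation int_nonneg: coefficients "{0..} :: int set"
  by standard auto

interpretation int_all: coefficients "UNIV :: int set"
  by standard auto

lemma gspan_carrier: "x \<in> gspan P d S \<Longrightarrow> x \<in> carrier_vec d"
  by (auto simp: gspan_def)

lemma gspan_empty [simp]: "gspan P d {} = {0\<^sub>v d}"
  by (auto simp: gspan_def)

context coefficients
begin

lemma gspan_add:
  assumes "x \<in> gspan P d S" "y \<in> gspan P d S"
  shows "x + y \<in> gspan P d S"
proof -
  obtain c c' where "x = vec d (\<lambda>k. \<Sum>s\<in>S. c s * s $ k)" "\<forall>s\<in>S. c s \<in> P"
    "y = vec d (\<lambda>k. \<Sum>s\<in>S. c' s * s $ k)" "\<forall>s\<in>S. c' s \<in> P"
    using assms by (auto simp: gspan_def)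
  then show ?thesis
    unfolding gspan_def
    by (intro CollectI exI[of _ "\<lambda>s. c s + c' s"])
       (auto simp: sum.distrib algebra_simps intro!: eq_vecI)
qed

lemma gspan_smult:
  assumes "x \<in> gspan P d S" "t \<in> P"
  shows "t \<cdot>\<^sub>v x \<in> gspan P d S"
proof -
  obtain c where "x = vec d (\<lambda>k. \<Sum>s\<in>S. c s * s $ k)" "\<forall>s\<in>S. c s \<in> P"
    using assms by (auto simp: gspan_def)
  then show ?thesis
    unfolding gspan_def using assms(2)
    by (intro CollectI exI[of _ "\<lambda>s. t * c s"])
       (auto simp: sum_distrib_left mult.assoc intro!: eq_vecI)
qed

lemma gspan_zero: "0\<^sub>v d \<in> gspan P d S"
  unfolding gspan_def by (intro CollectI exI[of _ "\<lambda>s. 0"]) (auto intro!: eq_vecI)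

lemma gspan_superset:
  assumes "finite S" "S \<subseteq> carrier_vec d"
  shows "S \<subseteq> gspan P d S"
proof
  fix a assume a: "a \<in> S"
  have "(\<Sum>s\<in>S. (if s = a then 1 else 0) * s $ k) = a $ k" for k
    using assms a by (simp add: if_distrib [of "\<lambda>x. x * _"] cong: if_cong)
  then show "a \<in> gspan P d S"
    unfolding gspan_def using assms a
    by (intro CollectI exI[of _ "\<lambda>s. if s = a then 1 else 0"]) (auto intro!: eq_vecI)
qed

lemma gspan_mono:
  assumes "S \<subseteq> T" "finite T"
  shows "gspan P d S \<subseteq> gspan P d T"
proof
  fix x assume "x \<in> gspan P d S"
  then obtain c where x: "x = vec d (\<lambda>k. \<Sum>s\<in>S. c s * s $ k)" and c: "\<forall>s\<in>S. c s \<in> P"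
    by (auto simp: gspan_def)
  have "(\<Sum>s\<in>S. c s * s $ k) = (\<Sum>s\<in>T. (if s \<in> S then c s else 0) * s $ k)" for k
    by (rule sum.mono_neutral_cong_left) (use assms in auto)
  then show "x \<in> gspan P d T"
    unfolding gspan_def x using c
    by (intro CollectI exI[of _ "\<lambda>s. if s \<in> S then c s else 0"]) auto
qed

text \<open>Peeling off one generator is the step of the inductions on \<open>S\<close> below. An
  \<open>a\<close> that is already in \<open>S\<close> is covered: the span sums over a set, and
  \<open>t\<close> is 0 then.\<close>

lemma gspan_insert:
  assumes "finite S" "S \<subseteq> carrier_vec d" "a \<in> carrier_vec d"
  shows "x \<in> gspan P d (insert a S) \<longleftrightarrow> (\<exists>t\<in>P. \<exists>y\<in>gspan P d S. x = t \<cdot>\<^sub>v a + y)"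
proof
  assume "x \<in> gspan P d (insert a S)"
  then obtain c where x: "x = vec d (\<lambda>k. \<Sum>s\<in>insert a S. c s * s $ k)"
    and c: "\<forall>s\<in>insert a S. c s \<in> P"
    by (auto simp: gspan_def)
  show "\<exists>t\<in>P. \<exists>y\<in>gspan P d S. x = t \<cdot>\<^sub>v a + y"
  proof (cases "a \<in> S")
    case True
    then show ?thesis
      using assms x c
      by (intro bexI[of _ 0] bexI[of _ x]) (auto simp: gspan_def insert_absorb intro!: eq_vecI)
  next
    case False
    then show ?thesis
      using assms x c
      by (intro bexI[of _ "c a"] bexI[of _ "vec d (\<lambda>k. \<Sum>s\<in>S. c s * s $ k)"])
         (auto simp: gspan_def intro!: eq_vecI)
  qed
next
  assume "\<exists>t\<in>P. \<exists>y\<in>gspan P d S. x = t \<cdot>\<^sub>v a + y"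
  then obtain t y where ty: "t \<in> P" "y \<in> gspan P d S" "x = t \<cdot>\<^sub>v a + y"
    by blast
  have "a \<in> gspan P d (insert a S)"
    using gspan_superset[of "insert a S" d] assms by auto
  moreover have "y \<in> gspan P d (insert a S)"
    using ty(2) gspan_mono[of S "insert a S" d] assms by auto
  ultimately show "x \<in> gspan P d (insert a S)"
    using ty by (simp add: gspan_add gspan_smult)
qed

lemma gspan_least:
  assumes "finite S" "S \<subseteq> gspan P d T"
  shows "gspan P d S \<subseteq> gspan P d T"
  using assms
proof (induction S rule: finite_induct)
  case empty
  then show ?case by (simp add: gspan_zero)
next
  case (insert a S)
  have car: "S \<subseteq> carrier_vec d" "a \<in> carrier_vec d"
    using insert.prems gspan_carrier by blast+
  show ?case
  proof
    fix x assume "x \<in> gspan P d (insert a S)"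
    then obtain t y where "t \<in> P" "y \<in> gspan P d S" "x = t \<cdot>\<^sub>v a + y"
      unfolding gspan_insert[OF insert.hyps(1) car] by blast
    then show "x \<in> gspan P d T"
      using insert by (auto intro!: gspan_add gspan_smult)
  qed
qed

lemma gspan_singleton:
  assumes "a \<in> carrier_vec d"
  shows "x \<in> gspan P d {a} \<longleftrightarrow> (\<exists>t\<in>P. x = t \<cdot>\<^sub>v a)"
  using assms gspan_insert[of "{}" d a x] by auto

end

text \<open>The image may be smaller than \<open>S\<close>, since \<open>map_vec h\<close> may
  identify vectors. Sums over \<open>S\<close> and over the image then do not match termwise,
  whereas peeling off one generator at a time copes with collisions.\<close>

lemma gspan_map_hom:
  fixes h :: "'a::comm_ring_1 \<Rightarrow> 'b::comm_ring_1"
  assumes h: "\<And>a b. h (a + b) = h a + h b" "\<And>a b. h (a * b) = h a * h b"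
    "h 0 = 0" "h 1 = 1" "h ` P \<subseteq> Q"
    and "coefficients P" "coefficients Q" "finite S" "S \<subseteq> carrier_vec d" "x \<in> gspan P d S"
  shows "map_vec h x \<in> gspan Q d (map_vec h ` S)"
proof -
  interpret P: coefficients P by fact
  interpret Q: coefficients Q by fact
  show ?thesis
    using assms(8,9,10)
  proof (induction S arbitrary: x rule: finite_induct)
    case empty
    then show ?case using h(3) by (auto intro!: eq_vecI)
  next
    case (insert a S)
    then obtain t y where ty: "t \<in> P" "y \<in> gspan P d S" "x = t \<cdot>\<^sub>v a + y"
      using P.gspan_insert[of S d a x] by auto
    have "map_vec h x = h t \<cdot>\<^sub>v map_vec h a + map_vec h y"
      using ty insert.prems gspan_carrier[OF ty(2)] h by (auto intro!: eq_vecI)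
    moreover have "map_vec h y \<in> gspan Q d (map_vec h ` S)" "h t \<in> Q"
      using insert ty(1,2) h(5) by auto
    moreover have "finite (map_vec h ` S)" "map_vec h ` S \<subseteq> carrier_vec d" "map_vec h a \<in> carrier_vec d"
      using insert by auto
    ultimately show ?case
      unfolding image_insert using Q.gspan_insert by blast
  qed
qed

lemma rvec_N_span:
  assumes "finite S" "S \<subseteq> carrier_vec d" "x \<in> N_span d S"
  shows "rvec x \<in> icone d S"
  using assms unfolding N_span_eq_gspan cone_eq_gspan
  by (intro gspan_map_hom[of real_of_int "{0..}"])
     (auto intro: int_nonneg.coefficients_axioms real_nonneg.coefficients_axioms)

lemma icone_superset: "finite S \<Longrightarrow> S \<subseteq> carrier_vec d \<Longrightarrow> a \<in> S \<Longrightarrow> rvec a \<in> icone d S"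
  unfolding cone_eq_gspan
  by (rule subsetD[OF real_nonneg.gspan_superset]) auto

lemma icone_mono: "S \<subseteq> T \<Longrightarrow> finite T \<Longrightarrow> icone d S \<subseteq> icone d T"
  unfolding cone_eq_gspan by (intro real_nonneg.gspan_mono) auto

lemma icone_least:
  assumes "finite S" "\<And>a. a \<in> S \<Longrightarrow> rvec a \<in> icone d T"
  shows "icone d S \<subseteq> icone d T"
  using assms unfolding cone_eq_gspan by (intro real_nonneg.gspan_least) auto

section \<open>Appending a coordinate\<close>

text \<open>A vector of the base together with its height. \<open>lift\<close> is the case of height
  0, and the apexes are \<open>p\<close> at the heights 1 and -1.\<close>

definition app1 :: "'a::comm_ring_1 vec \<Rightarrow> 'a \<Rightarrow> 'a vec" where
  "app1 y t = y @\<^sub>v vec 1 (\<lambda>_. t)"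

lemma app1_carrier [simp]: "app1 y t \<in> carrier_vec (Suc d) \<longleftrightarrow> y \<in> carrier_vec d"
  unfolding app1_def carrier_vec_def by simp

lemma dim_app1 [simp]: "dim_vec (app1 y t) = Suc (dim_vec y)"
  by (simp add: app1_def)

lemma index_app1:
  "y \<in> carrier_vec d \<Longrightarrow> k < Suc d \<Longrightarrow> app1 y t $ k = (if k < d then y $ k else t)"
  by (auto simp: app1_def)

lemma index_app1_less [simp]: "y \<in> carrier_vec d \<Longrightarrow> k < d \<Longrightarrow> app1 y t $ k = y $ k"
  by (simp add: index_app1)

lemma index_app1_last [simp]: "y \<in> carrier_vec d \<Longrightarrow> app1 y t $ d = t"
  by (simp add: index_app1)

lemma app1_cases:
  assumes "x \<in> carrier_vec (Suc d)"
  obtains y t where "y \<in> carrier_vec d" "x = app1 y t"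
proof
  show "vec d (\<lambda>k. x $ k) \<in> carrier_vec d" by simp
  show "x = app1 (vec d (\<lambda>k. x $ k)) (x $ d)"
    using assms by (intro eq_vecI) (auto simp: index_app1[of _ d] less_Suc_eq)
qed

lemma app1_inject [simp]: "app1 y s = app1 z t \<longleftrightarrow> y = z \<and> s = t"
proof
  assume *: "app1 y s = app1 z t"
  then have d: "dim_vec z = dim_vec y" by (metis dim_app1 nat.inject)
  show "y = z \<and> s = t"
  proof
    show "y = z"
    proof (rule eq_vecI)
      fix k assume "k < dim_vec z"
      then show "y $ k = z $ k"
        using arg_cong[OF *, of "\<lambda>x. x $ k"] d by (simp add: app1_def)
    qed (use d in simp)
    show "s = t"
      using arg_cong[OF *, of "\<lambda>x. x $ dim_vec y"] d by (simp add: app1_def)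
  qed
qed auto

lemma app1_add:
  "y \<in> carrier_vec d \<Longrightarrow> z \<in> carrier_vec d \<Longrightarrow> app1 y s + app1 z t = app1 (y + z) (s + t)"
  by (intro eq_vecI) (auto simp: index_app1[of _ d])

lemma app1_minus:
  "y \<in> carrier_vec d \<Longrightarrow> z \<in> carrier_vec d \<Longrightarrow> app1 y s - app1 z t = app1 (y - z) (s - t)"
  by (intro eq_vecI) (auto simp: index_app1[of _ d])

lemma app1_smult: "c \<cdot>\<^sub>v app1 y t = app1 (c \<cdot>\<^sub>v y) (c * t)"
  by (intro eq_vecI) (auto simp: app1_def)

lemma app1_zero: "0\<^sub>v (Suc d) = app1 (0\<^sub>v d) 0"
  by (intro eq_vecI) (auto simp: index_app1[of _ d])

lemma rvec_app1: "rvec (app1 y t) = app1 (rvec y) (real_of_int t)"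
  by (intro eq_vecI) (auto simp: app1_def)

lemma lift_eq_app1: "lift a = app1 a 0"
  by (auto simp: lift_def app1_def intro!: arg_cong[of _ _ "\<lambda>x. a @\<^sub>v x"] eq_vecI)

lemma p_mid_carrier [simp]: "p_mid d \<in> carrier_vec d"
  by (simp add: p_mid_def)

lemma dim_p_mid [simp]: "dim_vec (p_mid d) = d"
  by (rule carrier_vecD[OF p_mid_carrier])

lemma p_mid_index: "k < d \<Longrightarrow> 4 \<le> d \<Longrightarrow> p_mid d $ k = (if k < 4 then 1 else 0)"
  unfolding p_mid_def by auto

text \<open>The four ones stay in front and a zero is appended, so the midpoint of the new apexes is
  the flat copy of the point used one dimension lower.\<close>

lemma p_mid_Suc: "4 \<le> d \<Longrightarrow> p_mid (Suc d) = app1 (p_mid d) 0"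
  using p_mid_carrier[of "Suc d"] p_mid_carrier[of d]
  by (intro eq_vecI) (auto simp: index_app1[of _ d] p_mid_index simp del: p_mid_carrier)

lemma p_plus_eq: "4 \<le> d \<Longrightarrow> p_plus (Suc d) = app1 (p_mid d) 1"
  unfolding p_plus_def p_mid_Suc
  by (intro eq_vecI) (auto simp: index_app1[of _ d] carrier_vecD[OF p_mid_carrier])

lemma p_minus_eq: "4 \<le> d \<Longrightarrow> p_minus (Suc d) = app1 (p_mid d) (-1)"
  unfolding p_minus_def p_mid_Suc
  by (intro eq_vecI) (auto simp: index_app1[of _ d] carrier_vecD[OF p_mid_carrier])

lemma conf_Suc:
  "4 \<le> d \<Longrightarrow> conf A (Suc d) =
     app1 (p_mid d) 1 # app1 (p_mid d) (-1) # map (\<lambda>a. app1 a 0) (conf A d)"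
  by (simp add: p_plus_eq p_minus_eq lift_eq_app1 [abs_def])

context coefficients
begin

lemma gspan_app1_zero:
  assumes "finite S" "S \<subseteq> carrier_vec d"
  shows "gspan P (Suc d) ((\<lambda>a. app1 a 0) ` S) = (\<lambda>a. app1 a 0) ` gspan P d S"
  using assms
proof (induction S rule: finite_induct)
  case empty
  then show ?case by (simp add: app1_zero)
next
  case (insert a S)
  have *: "app1 (t \<cdot>\<^sub>v a + y) 0 = t \<cdot>\<^sub>v app1 a 0 + app1 y 0" if "y \<in> gspan P d S" for t y
    using that insert.prems gspan_carrier[OF that] by (simp add: app1_add[of _ d] app1_smult)
  have car: "finite ((\<lambda>a. app1 a 0) ` S)" "(\<lambda>a. app1 a 0) ` S \<subseteq> carrier_vec (Suc d)"
      "app1 a 0 \<in> carrier_vec (Suc d)" "S \<subseteq> carrier_vec d" "a \<in> carrier_vec d"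
    using insert by (auto simp: image_subset_iff)
  note ins = gspan_insert[OF car(1-3)] gspan_insert[OF insert.hyps(1) car(4,5)] insert.IH[OF car(4)]
  show ?case
    unfolding image_insert
  proof (intro equalityI subsetI)
    fix x assume "x \<in> gspan P (Suc d) (insert (app1 a 0) ((\<lambda>a. app1 a 0) ` S))"
    then obtain t y where ty: "t \<in> P" "y \<in> gspan P d S" "x = t \<cdot>\<^sub>v app1 a 0 + app1 y 0"
      unfolding ins by blast
    then have "x = app1 (t \<cdot>\<^sub>v a + y) 0" by (simp add: *)
    moreover have "t \<cdot>\<^sub>v a + y \<in> gspan P d (insert a S)"
      unfolding ins using ty by blast
    ultimately show "x \<in> (\<lambda>a. app1 a 0) ` gspan P d (insert a S)" by blast
  next
    fix x assume "x \<in> (\<lambda>a. app1 a 0) ` gspan P d (insert a S)"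
    then obtain t y where ty: "t \<in> P" "y \<in> gspan P d S" "x = app1 (t \<cdot>\<^sub>v a + y) 0"
      by (auto simp: ins)
    then have "x = t \<cdot>\<^sub>v app1 a 0 + app1 y 0" by (simp add: *)
    then show "x \<in> gspan P (Suc d) (insert (app1 a 0) ((\<lambda>a. app1 a 0) ` S))"
      unfolding ins using ty by blast
  qed
qed

text \<open>Flat vectors have height 0, so the height \<open>t\<close> is due to the apex alone and
  is tied to its coefficient \<open>s\<close>.\<close>

lemma gspan_app1:
  assumes "finite S" "S \<subseteq> carrier_vec d" "p \<in> carrier_vec d" "y \<in> carrier_vec d"
  shows "app1 y t \<in> gspan P (Suc d) (insert (app1 p e) ((\<lambda>a. app1 a 0) ` S)) \<longleftrightarrow>
    (\<exists>s\<in>P. t = s * e \<and> y - s \<cdot>\<^sub>v p \<in> gspan P d S)"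
proof -
  have car: "finite ((\<lambda>a. app1 a 0) ` S)" "(\<lambda>a. app1 a 0) ` S \<subseteq> carrier_vec (Suc d)"
      "app1 p e \<in> carrier_vec (Suc d)"
    using assms by (auto simp: image_subset_iff)
  have "app1 y t \<in> gspan P (Suc d) (insert (app1 p e) ((\<lambda>a. app1 a 0) ` S)) \<longleftrightarrow>
    (\<exists>s\<in>P. \<exists>z\<in>gspan P d S. app1 y t = s \<cdot>\<^sub>v app1 p e + app1 z 0)"
    unfolding gspan_insert[OF car] gspan_app1_zero[OF assms(1,2)] by simp
  also have "\<dots> \<longleftrightarrow> (\<exists>s\<in>P. \<exists>z\<in>gspan P d S. y = s \<cdot>\<^sub>v p + z \<and> t = s * e)"
    using assms(3)
    by (intro bex_cong refl) (auto simp: app1_add[of _ d] app1_smult dest!: gspan_carrier)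
  also have "\<dots> \<longleftrightarrow> (\<exists>s\<in>P. t = s * e \<and> y - s \<cdot>\<^sub>v p \<in> gspan P d S)"
  proof -
    have "(\<exists>z\<in>gspan P d S. y = s \<cdot>\<^sub>v p + z) \<longleftrightarrow> y - s \<cdot>\<^sub>v p \<in> gspan P d S" for s
    proof
      assume "\<exists>z\<in>gspan P d S. y = s \<cdot>\<^sub>v p + z"
      then obtain z where z: "z \<in> gspan P d S" "y = s \<cdot>\<^sub>v p + z" by blast
      have "y - s \<cdot>\<^sub>v p = z"
        using assms z(2) gspan_carrier[OF z(1)] by (auto intro!: eq_vecI)
      then show "y - s \<cdot>\<^sub>v p \<in> gspan P d S" using z by simp
    next
      assume *: "y - s \<cdot>\<^sub>v p \<in> gspan P d S"
      have "y = s \<cdot>\<^sub>v p + (y - s \<cdot>\<^sub>v p)" using assms by (auto intro!: eq_vecI)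
      then show "\<exists>z\<in>gspan P d S. y = s \<cdot>\<^sub>v p + z" using * by blast
    qed
    then show ?thesis by blast
  qed
  finally show ?thesis .
qed

end

section \<open>Bipyramids\<close>

abbreviation flat :: "'a::comm_ring_1 vec \<Rightarrow> 'a vec" where
  "flat a \<equiv> app1 a 0"

text \<open>As \<open>e\<close> is its own inverse, the coefficient of the apex is
  \<open>e * t\<close>, and what is left after subtracting that multiple must be a combination of
  base vectors. Both apexes, with \<open>e\<close> equal to 1 or -1, are of this form.\<close>

lemma (in coefficients) gspan_apex:
  assumes "finite S" "S \<subseteq> carrier_vec d" "p \<in> carrier_vec d" "y \<in> carrier_vec d" "e * e = 1"
  shows "app1 y t \<in> gspan P (Suc d) (insert (app1 p e) (flat ` S)) \<longleftrightarrow>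
    e * t \<in> P \<and> y - (e * t) \<cdot>\<^sub>v p \<in> gspan P d S"
proof -
  have "t = s * e \<longleftrightarrow> s = e * t" for s
    using assms(5) by (metis mult.commute mult.left_commute mult.right_neutral)
  then show ?thesis
    unfolding gspan_app1[OF assms(1-4)] by auto
qed

lemma rvec_minus_smult:
  "y \<in> carrier_vec d \<Longrightarrow> p \<in> carrier_vec d \<Longrightarrow>
    rvec (y - s \<cdot>\<^sub>v p) = rvec y - real_of_int s \<cdot>\<^sub>v rvec p"
  by (intro eq_vecI) auto

lemma rvec_image_apex:
  "rvec ` insert (app1 p e) (flat ` S) = insert (app1 (rvec p) (real_of_int e)) (flat ` rvec ` S)"
  by (auto simp: rvec_app1 image_image)

lemma rvec_image_carrier: "S \<subseteq> carrier_vec d \<Longrightarrow> rvec ` S \<subseteq> carrier_vec d"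
  by auto

lemma icone_apex:
  assumes "finite S" "S \<subseteq> carrier_vec d" "p \<in> carrier_vec d" "y \<in> carrier_vec d" "e * e = 1"
  shows "app1 y t \<in> icone (Suc d) (insert (app1 p e) (flat ` S)) \<longleftrightarrow>
    0 \<le> real_of_int e * t \<and> y - (real_of_int e * t) \<cdot>\<^sub>v rvec p \<in> icone d S"
proof -
  have "real_of_int e * real_of_int e = 1"
    using assms(5) by (metis of_int_1 of_int_mult)
  then show ?thesis
    unfolding cone_eq_gspan rvec_image_apex
    using real_nonneg.gspan_apex[of "rvec ` S" d "rvec p" y "real_of_int e" t] assms
      rvec_image_carrier[OF assms(2)] by simp
qed

lemma icone_flat:
  assumes "finite S" "S \<subseteq> carrier_vec d"
  shows "icone (Suc d) (flat ` S) = flat ` icone d S"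
proof -
  have "rvec ` flat ` S = flat ` rvec ` S"
    by (auto simp: rvec_app1 image_image)
  then show ?thesis
    using real_nonneg.gspan_app1_zero[of "rvec ` S" d] assms rvec_image_carrier[OF assms(2)]
    by (simp add: cone_eq_gspan)
qed

lemma N_span_apex:
  assumes "finite S" "S \<subseteq> carrier_vec d" "p \<in> carrier_vec d" "y \<in> carrier_vec d" "e * e = 1"
  shows "app1 y t \<in> N_span (Suc d) (insert (app1 p e) (flat ` S)) \<longleftrightarrow>
    0 \<le> e * t \<and> y - (e * t) \<cdot>\<^sub>v p \<in> N_span d S"
  unfolding N_span_eq_gspan int_nonneg.gspan_apex[OF assms] by simp

lemma Z_span_apex:
  assumes "finite S" "S \<subseteq> carrier_vec d" "p \<in> carrier_vec d" "y \<in> carrier_vec d" "e * e = 1"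
  shows "app1 y t \<in> Z_span (Suc d) (insert (app1 p e) (flat ` S)) \<longleftrightarrow>
    y - (e * t) \<cdot>\<^sub>v p \<in> Z_span d S"
  unfolding Z_span_eq_gspan int_all.gspan_apex[OF assms] by simp

text \<open>Integer coefficients of either sign are allowed, so one apex suffices to bring every
  lattice vector down to height 0.\<close>

lemma Z_span_carrier_apex:
  assumes "finite S" "S \<subseteq> carrier_vec d" "p \<in> carrier_vec d" "e * e = 1" "Z_span d S = carrier_vec d"
  shows "Z_span (Suc d) (insert (app1 p e) (flat ` S)) = carrier_vec (Suc d)"
proof (intro equalityI subsetI)
  fix x assume "x \<in> Z_span (Suc d) (insert (app1 p e) (flat ` S))"
  then show "x \<in> carrier_vec (Suc d)"
    unfolding Z_span_eq_gspan by (rule gspan_carrier)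
next
  fix x :: "int vec" assume "x \<in> carrier_vec (Suc d)"
  then obtain y t where "y \<in> carrier_vec d" "x = app1 y t"
    by (rule app1_cases)
  then show "x \<in> Z_span (Suc d) (insert (app1 p e) (flat ` S))"
    using Z_span_apex[OF assms(1-3) _ assms(4)] assms(3,5) by auto
qed

text \<open>Membership in the semigroup and in the cone both amount to a sign condition on
  \<open>e * t\<close> and to membership of the same projected point. That point is integral because
  \<open>p\<close> and \<open>t\<close> are, so saturation of the base applies to it.\<close>

lemma N_span_saturated_apex:
  assumes "finite S" "S \<subseteq> carrier_vec d" "p \<in> carrier_vec d" "e * e = 1"
    and "N_span d S = {x \<in> carrier_vec d. rvec x \<in> icone d S}"
  shows "N_span (Suc d) (insert (app1 p e) (flat ` S)) =
    {x \<in> carrier_vec (Suc d). rvec x \<in> icone (Suc d) (insert (app1 p e) (flat ` S))}"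
proof (rule Set.set_eqI)
  fix x
  show "x \<in> N_span (Suc d) (insert (app1 p e) (flat ` S)) \<longleftrightarrow>
    x \<in> {x \<in> carrier_vec (Suc d). rvec x \<in> icone (Suc d) (insert (app1 p e) (flat ` S))}"
  proof (cases "x \<in> carrier_vec (Suc d)")
    case True
    then obtain y t where x: "y \<in> carrier_vec d" "x = app1 y t"
      by (rule app1_cases)
    have r: "rvec y \<in> carrier_vec d" using x(1) by simp
    have "x \<in> N_span (Suc d) (insert (app1 p e) (flat ` S)) \<longleftrightarrow>
        0 \<le> e * t \<and> rvec (y - (e * t) \<cdot>\<^sub>v p) \<in> icone d S"
      using x(1) assms(3)
      unfolding x(2) N_span_apex[OF assms(1-3) x(1) assms(4)] assms(5) by auto
    also have "\<dots> \<longleftrightarrow> rvec x \<in> icone (Suc d) (insert (app1 p e) (flat ` S))"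
      unfolding x(2) rvec_app1 icone_apex[OF assms(1-3) r assms(4)] rvec_minus_smult[OF x(1) assms(3)]
      by (metis of_int_0_le_iff of_int_mult)
    finally show ?thesis using True by simp
  next
    case False
    then show ?thesis
      using gspan_carrier unfolding N_span_eq_gspan by blast
  qed
qed

text \<open>The two apexes add up to \<open>2 p\<close>, a point of the base cone. Equal amounts of
  both can be traded for \<open>p\<close>, so a point at height \<open>t\<close> needs only
  \<open>\<bar>t\<bar>\<close> times one apex.\<close>

lemma icone_bipyramid:
  assumes "finite S" "S \<subseteq> carrier_vec d" "p \<in> carrier_vec d" "y \<in> carrier_vec d"
    and p: "rvec p \<in> icone d S"
  shows "app1 y t \<in> icone (Suc d) (insert (app1 p 1) (insert (app1 p (-1)) (flat ` S))) \<longleftrightarrow>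
    y - \<bar>t\<bar> \<cdot>\<^sub>v rvec p \<in> icone d S"
proof
  assume "app1 y t \<in> icone (Suc d) (insert (app1 p 1) (insert (app1 p (-1)) (flat ` S)))"
  moreover have im: "rvec ` insert (app1 p 1) (insert (app1 p (-1)) (flat ` S)) =
      insert (app1 (rvec p) 1) (rvec ` insert (app1 p (-1)) (flat ` S))"
    by (simp add: rvec_app1)
  moreover have "insert (app1 p (-1)) (flat ` S) \<subseteq> carrier_vec (Suc d)"
    using assms(2,3) by (auto simp: subset_iff)
  note real_nonneg.gspan_insert[OF _ rvec_image_carrier[OF this], of "app1 (rvec p) 1"]
  ultimately obtain a z where a: "0 \<le> a" and z: "z \<in> icone (Suc d) (insert (app1 p (-1)) (flat ` S))"
    and eq: "app1 y t = a \<cdot>\<^sub>v app1 (rvec p) 1 + z"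
    using assms(1,3) unfolding cone_eq_gspan by auto
  from z have "z \<in> carrier_vec (Suc d)" by (auto simp: cone_eq_gspan dest: gspan_carrier)
  then obtain w b where w: "w \<in> carrier_vec d" "z = app1 w b" by (rule app1_cases)
  with z have b: "b \<le> 0" "w - (- b) \<cdot>\<^sub>v rvec p \<in> icone d S"
    using icone_apex[OF assms(1-3) w(1), of "-1" b] by auto
  have "w - (- b) \<cdot>\<^sub>v rvec p = w + b \<cdot>\<^sub>v rvec p"
    using w(1) assms(3) by (intro eq_vecI) auto
  with b(2) have b': "w + b \<cdot>\<^sub>v rvec p \<in> icone d S" by simp
  have y: "y = a \<cdot>\<^sub>v rvec p + w" "t = a + b"
    using eq w assms(3) by (auto simp: app1_smult app1_add[of _ d])
  \<comment> \<open>The amounts \<open>a\<close> of the upper and \<open>- b\<close> of the lower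
    apex leave the surplus \<open>a - b - \<bar>t\<bar>\<close> of \<open>p\<close>, which is twice
    the smaller amount.\<close>
  have "y - \<bar>t\<bar> \<cdot>\<^sub>v rvec p = (a - b - \<bar>t\<bar>) \<cdot>\<^sub>v rvec p + (w + b \<cdot>\<^sub>v rvec p)"
    unfolding y using w assms(3) by (intro eq_vecI) (auto simp: algebra_simps)
  moreover have "0 \<le> a - b - \<bar>t\<bar>" using a b y by auto
  ultimately show "y - \<bar>t\<bar> \<cdot>\<^sub>v rvec p \<in> icone d S"
    using p b' unfolding cone_eq_gspan
    by (auto intro!: real_nonneg.gspan_add real_nonneg.gspan_smult)
next
  assume *: "y - \<bar>t\<bar> \<cdot>\<^sub>v rvec p \<in> icone d S"
  have "app1 y t \<in> icone (Suc d) (insert (app1 p 1) (flat ` S)) \<or>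
    app1 y t \<in> icone (Suc d) (insert (app1 p (-1)) (flat ` S))"
    using * icone_apex[OF assms(1-4), of 1 t] icone_apex[OF assms(1-4), of "-1" t]
    by (cases "0 \<le> t") auto
  then show "app1 y t \<in> icone (Suc d) (insert (app1 p 1) (insert (app1 p (-1)) (flat ` S)))"
    using icone_mono[of "insert (app1 p 1) (flat ` S)" "insert (app1 p 1) (insert (app1 p (-1)) (flat ` S))"]
      icone_mono[of "insert (app1 p (-1)) (flat ` S)" "insert (app1 p 1) (insert (app1 p (-1)) (flat ` S))"]
      assms(1) by blast
qed

lemma icone_bipyramid_Un:
  assumes "finite S" "S \<subseteq> carrier_vec d" "p \<in> carrier_vec d" "rvec p \<in> icone d S"
  shows "icone (Suc d) (insert (app1 p 1) (insert (app1 p (-1)) (flat ` S))) =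
    icone (Suc d) (insert (app1 p 1) (flat ` S)) \<union> icone (Suc d) (insert (app1 p (-1)) (flat ` S))"
    (is "?L = ?R")
proof (rule Set.set_eqI)
  fix x
  show "x \<in> ?L \<longleftrightarrow> x \<in> ?R"
  proof (cases "x \<in> carrier_vec (Suc d)")
    case True
    then obtain y t where x: "y \<in> carrier_vec d" "x = app1 y t"
      by (rule app1_cases)
    show ?thesis
      unfolding x(2) Un_iff icone_bipyramid[OF assms(1-3) x(1) assms(4)]
      using icone_apex[OF assms(1-3) x(1), of 1 t] icone_apex[OF assms(1-3) x(1), of "-1" t]
      by (cases "0 \<le> t") (auto simp: abs_if)
  next
    case False
    then show ?thesis
      using gspan_carrier unfolding cone_eq_gspan by blast
  qed
qed

lemma icone_carrier: "x \<in> icone d S \<Longrightarrow> x \<in> carrier_vec d"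
  by (auto simp: cone_eq_gspan dest: gspan_carrier)

lemma icone_add: "x \<in> icone d S \<Longrightarrow> y \<in> icone d S \<Longrightarrow> x + y \<in> icone d S"
  unfolding cone_eq_gspan by (rule real_nonneg.gspan_add)

lemma icone_smult: "x \<in> icone d S \<Longrightarrow> 0 \<le> t \<Longrightarrow> t \<cdot>\<^sub>v x \<in> icone d S"
  unfolding cone_eq_gspan by (rule real_nonneg.gspan_smult) auto

lemma icone_singleton: "a \<in> carrier_vec d \<Longrightarrow> x \<in> icone d {a} \<longleftrightarrow> (\<exists>t\<ge>0. x = t \<cdot>\<^sub>v rvec a)"
  using real_nonneg.gspan_singleton[of "rvec a" d x] by (auto simp: cone_eq_gspan)

lemma icone_smult_cancel:
  assumes "t \<cdot>\<^sub>v x \<in> icone d S" "0 < t"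
  shows "x \<in> icone d S"
proof -
  have "x = (1 / t) \<cdot>\<^sub>v (t \<cdot>\<^sub>v x)" using assms(2) by (intro eq_vecI) auto
  then show ?thesis using icone_smult[OF assms(1), of "1 / t"] assms(2) by simp
qed

text \<open>The invariant of the recursion. \<open>N_span_B\<close> is saturation of the semigroup.
  \<open>pointed\<close> keeps an apex from splitting off nonzero parts in the base.
  \<open>extreme\<close> certifies that extreme generators span the cone, with rays that avoid
  \<open>p\<close> so that they stay extreme in the bipyramid. \<open>inner\<close> splits
  \<open>p\<close> into two points of the cone that are not multiples of \<open>p\<close>, which is
  what a simplicial bipyramid would forbid.\<close>

locale apex_config =
  fixes d :: nat and B :: "int vec list" and p :: "int vec"
  assumes distinct_B: "distinct B" and carrier_B: "set B \<subseteq> carrier_vec d"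
    and p_carrier: "p \<in> carrier_vec d" and p_nonzero: "p \<noteq> 0\<^sub>v d"
    and Z_span_B: "Z_span d (set B) = carrier_vec d"
    and N_span_B: "N_span d (set B) = {x \<in> carrier_vec d. rvec x \<in> icone d (set B)}"
    and p_in_cone: "rvec p \<in> icone d (set B)"
    and pointed: "x \<in> icone d (set B) \<Longrightarrow> - x \<in> icone d (set B) \<Longrightarrow> x = 0\<^sub>v d"
    and extreme: "\<exists>G\<subseteq>extreme_generators d B.
      icone d G = icone d (set B) \<and> (\<forall>g\<in>G. rvec p \<notin> icone d {g})"
    and inner: "\<exists>q\<in>icone d (set B). \<exists>l>0.
      rvec p - l \<cdot>\<^sub>v q \<in> icone d (set B) \<and> (\<forall>s. q \<noteq> s \<cdot>\<^sub>v rvec p)"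
begin

definition bip :: "int vec list" where
  "bip = app1 p 1 # app1 p (-1) # map flat B"

lemma set_bip: "set bip = insert (app1 p 1) (insert (app1 p (-1)) (flat ` set B))"
  by (simp add: bip_def)

lemma bip_carrier: "set bip \<subseteq> carrier_vec (Suc d)"
  using carrier_B p_carrier by (auto simp: set_bip)

lemma flat_image_carrier: "S \<subseteq> carrier_vec d \<Longrightarrow> flat ` S \<subseteq> carrier_vec (Suc d)"
  by (auto simp: subset_iff)

lemma distinct_bip: "distinct bip"
  using distinct_B by (auto simp: bip_def distinct_map inj_on_def)

lemma icone_bip:
  "y \<in> carrier_vec d \<Longrightarrow>
    app1 y t \<in> icone (Suc d) (set bip) \<longleftrightarrow> y - \<bar>t\<bar> \<cdot>\<^sub>v rvec p \<in> icone d (set B)"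
  unfolding set_bip using carrier_B p_carrier p_in_cone by (intro icone_bipyramid) auto

lemma icone_bip_Un:
  "icone (Suc d) (set bip) =
    icone (Suc d) (insert (app1 p 1) (flat ` set B)) \<union> icone (Suc d) (insert (app1 p (-1)) (flat ` set B))"
  unfolding set_bip using carrier_B p_carrier p_in_cone by (intro icone_bipyramid_Un) auto

lemma rvec_p_nonzero: "rvec p \<noteq> 0\<^sub>v d"
proof
  assume *: "rvec p = 0\<^sub>v d"
  have "p = 0\<^sub>v d"
  proof (rule eq_vecI)
    fix i assume "i < dim_vec (0\<^sub>v d)"
    then have i: "i < d" by simp
    then show "p $ i = 0\<^sub>v d $ i"
      using arg_cong[OF *, of "\<lambda>x. x $ i"] p_carrier by simp
  qed (use p_carrier in simp)
  then show False using p_nonzero by simp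
qed

lemma smult_p_eq_zero:
  assumes "r \<cdot>\<^sub>v rvec p = 0\<^sub>v d"
  shows "r = 0"
proof (rule ccontr)
  assume "r \<noteq> 0"
  then have "rvec p = (1 / r) \<cdot>\<^sub>v (r \<cdot>\<^sub>v rvec p)" by (intro eq_vecI) auto
  also have "\<dots> = 0\<^sub>v d" unfolding assms by (intro eq_vecI) auto
  finally show False using rvec_p_nonzero by simp
qed

section \<open>Extreme rays of the bipyramid\<close>

lemma icone_bip_cases:
  assumes "x \<in> icone (Suc d) (set bip)"
  obtains c t where "c \<in> icone d (set B)" "x = app1 (\<bar>t\<bar> \<cdot>\<^sub>v rvec p + c) t"
proof -
  obtain y t where y: "y \<in> carrier_vec d" "x = app1 y t"
    using app1_cases[OF icone_carrier[OF assms]] by blast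
  show thesis
  proof
    show "y - \<bar>t\<bar> \<cdot>\<^sub>v rvec p \<in> icone d (set B)" using assms icone_bip[OF y(1)] y(2) by simp
    show "x = app1 (\<bar>t\<bar> \<cdot>\<^sub>v rvec p + (y - \<bar>t\<bar> \<cdot>\<^sub>v rvec p)) t"
      unfolding y(2) app1_inject using y(1) p_carrier by (auto intro!: eq_vecI)
  qed
qed

text \<open>In a decomposition of \<open>flat b\<close> the heights are \<open>t\<close> and
  \<open>- t\<close>, and both parts together contain \<open>2 * \<bar>t\<bar>\<close> times
  \<open>p\<close>. Extremality in the base pushes this multiple onto the ray of \<open>b\<close>,
  where \<open>p\<close> is not. Hence \<open>t = 0\<close>, and the decomposition takes place in
  the base.\<close>

lemma extreme_flat:
  assumes b: "b \<in> extreme_generators d B" and nb: "rvec p \<notin> icone d {b}"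
  shows "flat b \<in> extreme_generators (Suc d) bip"
proof -
  have bB: "b \<in> set B" "b \<noteq> 0\<^sub>v d" and bc: "b \<in> carrier_vec d"
    using b carrier_B by (auto simp: extreme_generators_def)
  have *: "x \<in> icone d {b}" if "x \<in> icone d (set B)" "y \<in> icone d (set B)" "x + y = rvec b" for x y
    using b that by (auto simp: extreme_generators_def)
  have key: "x \<in> icone (Suc d) {flat b}"
    if x: "x \<in> icone (Suc d) (set bip)" and y: "y \<in> icone (Suc d) (set bip)" and eq: "x + y = rvec (flat b)" for x y
  proof -
    obtain c t where c: "c \<in> icone d (set B)" "x = app1 (\<bar>t\<bar> \<cdot>\<^sub>v rvec p + c) t"
      using icone_bip_cases[OF x] by blast
    obtain c' s where c': "c' \<in> icone d (set B)" "y = app1 (\<bar>s\<bar> \<cdot>\<^sub>v rvec p + c') s"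
      using icone_bip_cases[OF y] by blast
    note car = icone_carrier[OF c(1)] icone_carrier[OF c'(1)] p_carrier
    have e: "\<bar>t\<bar> \<cdot>\<^sub>v rvec p + c + (\<bar>s\<bar> \<cdot>\<^sub>v rvec p + c') = rvec b" "t + s = 0"
      using eq car bc unfolding c(2) c'(2) by (auto simp: app1_add[of _ d] rvec_app1)
    from e(2) have s: "s = - t" by simp
    have "(2 * \<bar>t\<bar>) \<cdot>\<^sub>v rvec p + (c + c') = rvec b"
      unfolding e(1)[symmetric] s using car by (intro eq_vecI) (auto simp: algebra_simps)
    then have "(2 * \<bar>t\<bar>) \<cdot>\<^sub>v rvec p \<in> icone d {b}"
      by (rule *[rotated 2]) (use c c' p_in_cone in \<open>auto intro: icone_add icone_smult\<close>)
    then have t: "t = 0"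
      using icone_smult_cancel[of "2 * \<bar>t\<bar>" "rvec p" d "{b}"] nb by (cases "t = 0") auto
    have "0 \<cdot>\<^sub>v rvec p = 0\<^sub>v d" using car by (intro eq_vecI) auto
    then have "c + c' = rvec b"
      using e(1) car unfolding s t by auto
    then have "c \<in> icone d {b}" using * c c' by blast
    moreover have "x = flat c" using c(2) car t by auto
    ultimately show ?thesis
      using icone_flat[of "{b}" d] bc by auto
  qed
  have "x \<in> icone (Suc d) {flat b} \<and> y \<in> icone (Suc d) {flat b}"
    if x: "x \<in> icone (Suc d) (set bip)" and y: "y \<in> icone (Suc d) (set bip)" and eq: "x + y = rvec (flat b)" for x y
    using key[OF x y eq] key[OF y x] eq icone_carrier[OF x] icone_carrier[OF y]
    by (metis comm_add_vec)
  then show ?thesis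
    using bB by (auto simp: extreme_generators_def set_bip app1_zero)
qed

text \<open>The heights add up to 1 or -1, so \<open>r\<close> is nonnegative, and \<open>c\<close>,
  \<open>c'\<close> and \<open>r\<close> times \<open>p\<close> are points of the cone with sum
  zero. Pointedness makes all of them vanish; \<open>r = 0\<close> then says that no heights cancel,
  so \<open>x\<close> is a nonnegative multiple of the apex.\<close>

lemma extreme_apex:
  assumes e: "e = 1 \<or> e = -1"
  shows "app1 p e \<in> extreme_generators (Suc d) bip"
proof -
  have pc: "app1 p e \<in> carrier_vec (Suc d)" using p_carrier by simp
  have key: "x \<in> icone (Suc d) {app1 p e}"
    if x: "x \<in> icone (Suc d) (set bip)" and y: "y \<in> icone (Suc d) (set bip)" and eq: "x + y = rvec (app1 p e)" for x y
  proof -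
    obtain c t where c: "c \<in> icone d (set B)" "x = app1 (\<bar>t\<bar> \<cdot>\<^sub>v rvec p + c) t"
      using icone_bip_cases[OF x] by blast
    obtain c' s where c': "c' \<in> icone d (set B)" "y = app1 (\<bar>s\<bar> \<cdot>\<^sub>v rvec p + c') s"
      using icone_bip_cases[OF y] by blast
    note car = icone_carrier[OF c(1)] icone_carrier[OF c'(1)] p_carrier
    have ee: "\<bar>t\<bar> \<cdot>\<^sub>v rvec p + c + (\<bar>s\<bar> \<cdot>\<^sub>v rvec p + c') = rvec p" "t + s = real_of_int e"
      using eq car unfolding c(2) c'(2) by (auto simp: app1_add[of _ d] rvec_app1)
    define r where "r = \<bar>t\<bar> + \<bar>s\<bar> - 1"
    have r: "0 \<le> r" using ee(2) e unfolding r_def by auto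
    have idx: "\<bar>t\<bar> * rvec p $ i + c $ i + (\<bar>s\<bar> * rvec p $ i + c' $ i) = rvec p $ i" if "i < d" for i
      using arg_cong[OF ee(1), of "\<lambda>x. x $ i"] car that by simp
    have "- c = c' + r \<cdot>\<^sub>v rvec p"
      using car idx by (intro eq_vecI) (auto simp: r_def algebra_simps)
    then have "- c \<in> icone d (set B)"
      using c'(1) p_in_cone r by (auto intro: icone_add icone_smult)
    then have c0: "c = 0\<^sub>v d" using pointed c(1) by blast
    have "- c' = c + r \<cdot>\<^sub>v rvec p"
      using car idx by (intro eq_vecI) (auto simp: r_def algebra_simps)
    then have "- c' \<in> icone d (set B)"
      using c(1) p_in_cone r by (auto intro: icone_add icone_smult)
    then have c'0: "c' = 0\<^sub>v d" using pointed c'(1) by blast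
    have "r \<cdot>\<^sub>v rvec p = 0\<^sub>v d"
      using \<open>- c' = c + r \<cdot>\<^sub>v rvec p\<close> car unfolding c0 c'0 by auto
    then have "r = 0" by (rule smult_p_eq_zero)
    then have "t = \<bar>t\<bar> * real_of_int e" using ee(2) e unfolding r_def by auto
    then have "x = \<bar>t\<bar> \<cdot>\<^sub>v rvec (app1 p e)"
      unfolding c(2) c0 using car by (auto simp: rvec_app1 app1_smult)
    then show ?thesis unfolding icone_singleton[OF pc] by (intro exI[of _ "\<bar>t\<bar>"]) simp
  qed
  have "x \<in> icone (Suc d) {app1 p e} \<and> y \<in> icone (Suc d) {app1 p e}"
    if x: "x \<in> icone (Suc d) (set bip)" and y: "y \<in> icone (Suc d) (set bip)" and eq: "x + y = rvec (app1 p e)" for x y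
    using key[OF x y eq] key[OF y x] eq icone_carrier[OF x] icone_carrier[OF y]
    by (metis comm_add_vec)
  then show ?thesis
    using e p_nonzero by (auto simp: extreme_generators_def set_bip app1_zero)
qed

text \<open>\<open>flat p\<close> can take over the role of \<open>p\<close>: it has height 0,
  whereas the new rays belong to apexes of nonzero height. Saturation is inherited from the two
  halves, and the witnesses of \<open>extreme\<close> and \<open>inner\<close> are the flat copies
  of the old ones, with the apexes added to the generators.\<close>

lemma apex_config_bip: "apex_config (Suc d) bip (flat p)"
proof
  show "distinct bip" by (rule distinct_bip)
  show "set bip \<subseteq> carrier_vec (Suc d)" by (rule bip_carrier)
  show "flat p \<in> carrier_vec (Suc d)" using p_carrier by simp
  show "flat p \<noteq> 0\<^sub>v (Suc d)" using p_nonzero by (simp add: app1_zero)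
  have "Z_span (Suc d) (insert (app1 p 1) (flat ` set B)) \<subseteq> Z_span (Suc d) (set bip)"
    unfolding Z_span_eq_gspan set_bip by (rule int_all.gspan_mono) auto
  then show "Z_span (Suc d) (set bip) = carrier_vec (Suc d)"
    using Z_span_carrier_apex[OF _ carrier_B p_carrier _ Z_span_B, of 1] gspan_carrier
    unfolding Z_span_eq_gspan by fastforce
  have sub: "N_span (Suc d) (insert (app1 p e) (flat ` set B)) \<subseteq> N_span (Suc d) (set bip)"
    if "e = 1 \<or> e = -1" for e
    unfolding N_span_eq_gspan set_bip by (rule int_nonneg.gspan_mono) (use that in auto)
  have "x \<in> N_span (Suc d) (set bip)" if "x \<in> carrier_vec (Suc d)" "rvec x \<in> icone (Suc d) (set bip)" for x
    using that(2) sub[of 1] sub[of "-1"] that(1)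
      N_span_saturated_apex[OF _ carrier_B p_carrier _ N_span_B, of 1]
      N_span_saturated_apex[OF _ carrier_B p_carrier _ N_span_B, of "-1"]
    unfolding icone_bip_Un by auto
  moreover have "x \<in> carrier_vec (Suc d)" if "x \<in> N_span (Suc d) (set bip)" for x
    using that gspan_carrier unfolding N_span_eq_gspan by blast
  ultimately show "N_span (Suc d) (set bip) = {x \<in> carrier_vec (Suc d). rvec x \<in> icone (Suc d) (set bip)}"
    using rvec_N_span[OF _ bip_carrier] by blast
  have flat_mem: "flat x \<in> icone (Suc d) (set bip)" if "x \<in> icone d (set B)" for x
  proof -
    have "x - \<bar>0\<bar> \<cdot>\<^sub>v rvec p = x" using icone_carrier[OF that] p_carrier by (intro eq_vecI) auto
    then show ?thesis
      using icone_bip[of x 0] icone_carrier[OF that] that by simp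
  qed
  show "rvec (flat p) \<in> icone (Suc d) (set bip)"
    using flat_mem[OF p_in_cone] by (simp add: rvec_app1)
  show "x = 0\<^sub>v (Suc d)" if x: "x \<in> icone (Suc d) (set bip)" and y: "- x \<in> icone (Suc d) (set bip)" for x
  proof -
    obtain c t where c: "c \<in> icone d (set B)" "x = app1 (\<bar>t\<bar> \<cdot>\<^sub>v rvec p + c) t"
      using icone_bip_cases[OF x] by blast
    obtain c' s where c': "c' \<in> icone d (set B)" "- x = app1 (\<bar>s\<bar> \<cdot>\<^sub>v rvec p + c') s"
      using icone_bip_cases[OF y] by blast
    note car = icone_carrier[OF c(1)] icone_carrier[OF c'(1)] p_carrier
    have "x + - x = 0\<^sub>v (Suc d)" using icone_carrier[OF x] by simp
    then have e: "\<bar>t\<bar> \<cdot>\<^sub>v rvec p + c + (\<bar>s\<bar> \<cdot>\<^sub>v rvec p + c') = 0\<^sub>v d" "t + s = 0"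
      using car unfolding c(2)[symmetric] c'(2) unfolding c(2)
      by (auto simp: app1_add[of _ d] app1_zero)
    from e(2) have s: "s = - t" by simp
    have idx: "\<bar>t\<bar> * rvec p $ i + c $ i + (\<bar>t\<bar> * rvec p $ i + c' $ i) = 0" if "i < d" for i
      using arg_cong[OF e(1), of "\<lambda>x. x $ i"] car that unfolding s by simp
    \<comment> \<open>The heights of \<open>x\<close> and \<open>- x\<close> are opposite, so the
      cone elements \<open>c\<close>, \<open>c'\<close> and \<open>2 * \<bar>t\<bar>\<close> times
      \<open>p\<close> have sum zero, and pointedness of the base removes them.\<close>
    have "- c = c' + (2 * \<bar>t\<bar>) \<cdot>\<^sub>v rvec p"
    proof (rule eq_vecI)
      fix i assume "i < dim_vec (c' + (2 * \<bar>t\<bar>) \<cdot>\<^sub>v rvec p)"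
      then have "i < d" using car by simp
      then show "(- c) $ i = (c' + (2 * \<bar>t\<bar>) \<cdot>\<^sub>v rvec p) $ i"
        using idx[of i] car by simp
    qed (use car in simp)
    then have "- c \<in> icone d (set B)"
      using c'(1) p_in_cone by (simp add: icone_add icone_smult)
    then have c0: "c = 0\<^sub>v d" using pointed c(1) by blast
    have "- ((2 * \<bar>t\<bar>) \<cdot>\<^sub>v rvec p) = c'"
    proof (rule eq_vecI)
      fix i assume "i < dim_vec c'"
      then have "i < d" using car by simp
      then show "(- ((2 * \<bar>t\<bar>) \<cdot>\<^sub>v rvec p)) $ i = c' $ i"
        using idx[of i] car unfolding c0 by simp
    qed (use car in simp)
    then have "(2 * \<bar>t\<bar>) \<cdot>\<^sub>v rvec p = 0\<^sub>v d"
      using c'(1) p_in_cone by (intro pointed) (auto intro: icone_smult)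
    then have "t = 0" using smult_p_eq_zero[of "2 * \<bar>t\<bar>"] by simp
    then show ?thesis unfolding c(2) c0 app1_zero using car by auto
  qed
  obtain G where G: "G \<subseteq> extreme_generators d B" "icone d G = icone d (set B)"
    "\<And>g. g \<in> G \<Longrightarrow> rvec p \<notin> icone d {g}"
    using extreme by blast
  have GB: "G \<subseteq> set B" "G \<subseteq> carrier_vec d" "finite G"
    using G(1) carrier_B by (auto simp: extreme_generators_def intro: finite_subset)
  define G' where "G' = insert (app1 p 1) (insert (app1 p (-1)) (flat ` G))"
  show "\<exists>G\<subseteq>extreme_generators (Suc d) bip.
      icone (Suc d) G = icone (Suc d) (set bip) \<and> (\<forall>g\<in>G. rvec (flat p) \<notin> icone (Suc d) {g})"
  proof (intro exI[of _ G'] conjI ballI)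
    show "G' \<subseteq> extreme_generators (Suc d) bip"
      using G extreme_flat extreme_apex by (auto simp: G'_def)
    show "icone (Suc d) G' = icone (Suc d) (set bip)"
    proof (rule Set.set_eqI)
      fix x
      show "x \<in> icone (Suc d) G' \<longleftrightarrow> x \<in> icone (Suc d) (set bip)"
      proof (cases "x \<in> carrier_vec (Suc d)")
        case True
        then obtain y t where x: "y \<in> carrier_vec d" "x = app1 y t"
          by (rule app1_cases)
        show ?thesis
          unfolding x(2) icone_bip[OF x(1)] G'_def
          using icone_bipyramid[OF GB(3,2) p_carrier x(1)] p_in_cone G(2) by simp
      next
        case False
        then show ?thesis using icone_carrier by blast
      qed
    qed
    fix g assume "g \<in> G'"
    then consider e where "g = app1 p e" "e = 1 \<or> e = -1" | b where "b \<in> G" "g = flat b"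
      by (auto simp: G'_def)
    then show "rvec (flat p) \<notin> icone (Suc d) {g}"
    proof cases
      case 1
      \<comment> \<open>A multiple of an apex at height 0 is the zero vector, and \<open>p\<close>
        is nonzero.\<close>
      then have "g \<in> carrier_vec (Suc d)" using p_carrier by simp
      moreover have "0 \<cdot>\<^sub>v rvec p = 0\<^sub>v d" using p_carrier by (intro eq_vecI) auto
      then have "rvec p \<noteq> 0 \<cdot>\<^sub>v rvec p" using rvec_p_nonzero by metis
      ultimately show ?thesis
        using 1 icone_singleton[of g "Suc d"] by (auto simp: rvec_app1 app1_smult)
    next
      case 2
      then show ?thesis
        using icone_flat[of "{b}" d] subsetD[OF GB(2) 2(1)] G(3)[of b] by (auto simp: rvec_app1)
    qed
  qed
  obtain q l where q: "q \<in> icone d (set B)" "0 < l" "rvec p - l \<cdot>\<^sub>v q \<in> icone d (set B)"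
    "\<And>s. q \<noteq> s \<cdot>\<^sub>v rvec p"
    using inner by blast
  have "rvec (flat p) - l \<cdot>\<^sub>v flat q = flat (rvec p - l \<cdot>\<^sub>v q)"
    using icone_carrier[OF q(1)] p_carrier by (simp add: rvec_app1 app1_smult app1_minus[of _ d])
  then show "\<exists>q\<in>icone (Suc d) (set bip). \<exists>l>0.
      rvec (flat p) - l \<cdot>\<^sub>v q \<in> icone (Suc d) (set bip) \<and> (\<forall>s. q \<noteq> s \<cdot>\<^sub>v rvec (flat p))"
    using q(2,4) flat_mem[OF q(1)] flat_mem[OF q(3)]
    by (intro bexI[of _ "flat q"] exI[of _ l]) (auto simp: rvec_app1 app1_smult)
qed

end

section \<open>Unimodular triangulations of a bipyramid\<close>

lemma max_sets_superset:
  assumes "simplicial_complex n \<Delta>" "\<tau> \<in> \<Delta>"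
  obtains \<sigma> where "\<sigma> \<in> max_sets \<Delta>" "\<tau> \<subseteq> \<sigma>"
proof -
  have "finite \<Delta>"
    using assms(1) by (auto simp: simplicial_complex_def intro: finite_subset)
  then have "\<exists>\<sigma>\<in>\<Delta>. \<tau> \<subseteq> \<sigma> \<and> (\<forall>b\<in>\<Delta>. \<sigma> \<subseteq> b \<longrightarrow> \<sigma> = b)"
    using finite_has_maximal2[of \<Delta> \<tau>] assms(2) by auto
  then obtain \<sigma> where \<sigma>: "\<sigma> \<in> \<Delta>" "\<tau> \<subseteq> \<sigma>" "\<forall>b\<in>\<Delta>. \<sigma> \<subseteq> b \<longrightarrow> \<sigma> = b"
    by blast
  show thesis
    by (rule that[OF _ \<sigma>(2)]) (use \<sigma> in \<open>auto simp: max_sets_def\<close>)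
qed

text \<open>The coefficients that express the unit vectors form an integral right inverse
  \<open>N\<close> of the matrix \<open>M\<close> with columns \<open>S\<close>. So
  \<open>det M\<close> divides 1, and the columns are independent.\<close>

lemma Z_span_card_independent:
  assumes "finite S" "S \<subseteq> carrier_vec d" "card S = d" "Z_span d S = carrier_vec d"
    and c: "\<And>k. k < d \<Longrightarrow> (\<Sum>s\<in>S. c s * s $ k) = 0" and "s \<in> S"
  shows "c s = 0"
proof -
  obtain f where f: "bij_betw f {0..<d} S"
    using assms(1,3) ex_bij_betw_nat_finite by blast
  have reindex: "(\<Sum>s\<in>S. g s) = (\<Sum>j<d. g (f j))" for g :: "int vec \<Rightarrow> int"
    using sum.reindex_bij_betw[OF f, of g] by (simp add: atLeast0LessThan)
  have "\<exists>a. unit_vec d i = vec d (\<lambda>k. \<Sum>s\<in>S. a s * s $ k)" for i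
  proof -
    have "unit_vec d i \<in> Z_span d S" unfolding assms(4) by simp
    then show ?thesis unfolding Z_span_def by blast
  qed
  then obtain a where a: "\<And>i. unit_vec d i = vec d (\<lambda>k. \<Sum>s\<in>S. a i s * s $ k)"
    by metis
  define M where "M = mat d d (\<lambda>(k, j). f j $ k)"
  define N where "N = mat d d (\<lambda>(j, i). a i (f j))"
  have MN: "M \<in> carrier_mat d d" "N \<in> carrier_mat d d"
    by (simp_all add: M_def N_def)
  have "M * N = 1\<^sub>m d"
  proof (rule eq_matI)
    fix k i assume ki: "k < dim_row (1\<^sub>m d)" "i < dim_col (1\<^sub>m d)"
    then have "(M * N) $$ (k, i) = (\<Sum>j<d. f j $ k * a i (f j))"
      by (simp add: M_def N_def scalar_prod_def atLeast0LessThan)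
    also have "\<dots> = unit_vec d i $ k"
      using ki unfolding a[of i] by (simp add: reindex mult.commute)
    also have "\<dots> = 1\<^sub>m d $$ (k, i)" using ki by auto
    finally show "(M * N) $$ (k, i) = 1\<^sub>m d $$ (k, i)" .
  qed (use MN in auto)
  then have "det M * det N = 1"
    using det_mult[OF MN] by simp
  then have det: "det M \<noteq> 0" by auto
  define w where "w = vec d (\<lambda>j. c (f j))"
  have w: "w \<in> carrier_vec d" by (simp add: w_def)
  have "M *\<^sub>v w = 0\<^sub>v d"
  proof (rule eq_vecI)
    fix k assume "k < dim_vec (0\<^sub>v d)"
    then have k: "k < d" by simp
    then have "(M *\<^sub>v w) $ k = (\<Sum>j<d. c (f j) * f j $ k)"
      by (simp add: M_def w_def scalar_prod_def atLeast0LessThan mult.commute)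
    also have "\<dots> = 0" using c[OF k] by (simp add: reindex)
    finally show "(M *\<^sub>v w) $ k = 0\<^sub>v d $ k" using k by simp
  qed (use MN in simp)
  then have "w = 0\<^sub>v d"
    using det_0_iff_vec_prod_zero[OF MN(1)] det w by blast
  moreover obtain j where "j < d" "s = f j"
    using f \<open>s \<in> S\<close> by (auto simp: bij_betw_def)
  ultimately show ?thesis
    using index_vec[of j d "\<lambda>j. c (f j)"] by (simp add: w_def)
qed

context apex_config
begin

lemma bip_nth: "bip ! 0 = app1 p 1" "bip ! Suc 0 = app1 p (-1)"
  "i < length B \<Longrightarrow> bip ! Suc (Suc i) = flat (B ! i)"
  by (simp_all add: bip_def)

lemma sub_bip_shift:
  assumes "\<tau> \<subseteq> {..<length B}"
  shows "sub bip ((\<lambda>i. Suc (Suc i)) ` \<tau>) = flat ` sub B \<tau>"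
proof -
  have "bip ! Suc (Suc i) = flat (B ! i)" if "i \<in> \<tau>" for i
    using assms that bip_nth(3) by auto
  then show ?thesis by (auto simp: sub_def image_image)
qed

lemma sub_B:
  assumes "\<tau> \<subseteq> {..<length B}"
  shows "finite (sub B \<tau>)" "sub B \<tau> \<subseteq> carrier_vec d"
  using assms carrier_B finite_subset[OF assms] by (auto simp: sub_def subset_iff)

text \<open>A simplex of a unimodular triangulation cannot contain both apexes: their midpoint \<open>p\<close> is a
  lattice point, but its unique coordinates with respect to the simplex are halves.\<close>

lemma unimodular_cell:
  assumes "card \<sigma> = Suc d" "\<sigma> \<subseteq> {..<length bip}" "Z_span (Suc d) (sub bip \<sigma>) = carrier_vec (Suc d)"
  obtains i \<tau> where "i < 2" "\<tau> \<subseteq> {..<length B}" "\<sigma> = insert i ((\<lambda>i. Suc (Suc i)) ` \<tau>)"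
    "card \<tau> = d" "Z_span d (sub B \<tau>) = carrier_vec d"
proof -
  define \<tau> where "\<tau> = {i. Suc (Suc i) \<in> \<sigma>}"
  have \<tau>B: "\<tau> \<subseteq> {..<length B}"
    using assms(2) by (auto simp: \<tau>_def bip_def)
  have decomp: "\<sigma> = (\<sigma> \<inter> {0, 1}) \<union> (\<lambda>i. Suc (Suc i)) ` \<tau>"
  proof (rule Set.set_eqI)
    fix x show "x \<in> \<sigma> \<longleftrightarrow> x \<in> (\<sigma> \<inter> {0, 1}) \<union> (\<lambda>i. Suc (Suc i)) ` \<tau>"
      by (cases x; cases "x - 1") (auto simp: \<tau>_def image_iff)
  qed
  have inj: "inj_on ((!) bip) \<sigma>"
    using distinct_bip assms(2) by (auto simp: inj_on_def nth_eq_iff_index_eq subset_iff)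
  have fin: "finite (sub bip \<sigma>)" and car: "sub bip \<sigma> \<subseteq> carrier_vec (Suc d)"
    and card: "card (sub bip \<sigma>) = Suc d"
    using assms(1,2) bip_carrier finite_subset[OF assms(2)] inj
    by (auto simp: sub_def card_image subset_iff)
  have not_both: "\<not> (0 \<in> \<sigma> \<and> 1 \<in> \<sigma>)"
  proof
    assume both: "0 \<in> \<sigma> \<and> 1 \<in> \<sigma>"
    then have mem: "app1 p 1 \<in> sub bip \<sigma>" "app1 p (-1) \<in> sub bip \<sigma>"
      using both bip_nth imageI[of 0 \<sigma> "(!) bip"] imageI[of 1 \<sigma> "(!) bip"]
      by (simp_all add: sub_def)
    have "flat p \<in> Z_span (Suc d) (sub bip \<sigma>)"
      using assms(3) p_carrier by simp
    then obtain n where n: "flat p = vec (Suc d) (\<lambda>k. \<Sum>s\<in>sub bip \<sigma>. n s * s $ k)"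
      unfolding Z_span_def by blast
    \<comment> \<open>There are two expressions for \<open>2 p\<close>: twice the one of the lattice
      point \<open>p\<close>, and the sum of the apexes. Their difference is a relation among the
      vectors of the simplex.\<close>
    define c where "c s = 2 * n s - (if s = app1 p 1 then 1 else 0) - (if s = app1 p (-1) then 1 else 0)" for s
    have "(\<Sum>s\<in>sub bip \<sigma>. c s * s $ k) = 0" if k: "k < Suc d" for k
    proof -
      have "(\<Sum>s\<in>sub bip \<sigma>. c s * s $ k) = 2 * (\<Sum>s\<in>sub bip \<sigma>. n s * s $ k)
          - (\<Sum>s\<in>sub bip \<sigma>. if s = app1 p 1 then s $ k else 0)
          - (\<Sum>s\<in>sub bip \<sigma>. if s = app1 p (-1) then s $ k else 0)"
        unfolding c_def sum_distrib_left sum_subtractf[symmetric]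
        by (intro sum.cong refl) (auto simp: algebra_simps)
      also have "\<dots> = 2 * (flat p $ k) - app1 p 1 $ k - app1 p (-1) $ k"
        unfolding n using fin mem k by (simp add: sum.delta')
      also have "\<dots> = 0"
        using k p_carrier by (auto simp: index_app1[of _ d])
      finally show ?thesis .
    qed
    from Z_span_card_independent[OF fin car card assms(3) this mem(1)]
    have "c (app1 p 1) = 0" .
    \<comment> \<open>In this relation the upper apex has a coefficient of the form
      \<open>2 * n s - 1\<close>, which is odd.\<close>
    then show False unfolding c_def by (auto split: if_splits) presburger+
  qed
  \<comment> \<open>Without an apex all vectors of the cell have height 0, and the vector
    \<open>app1 p 1\<close> of height 1 is out of reach.\<close>
  have Znot: "\<not> \<sigma> \<subseteq> (\<lambda>i. Suc (Suc i)) ` \<tau>"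
  proof
    assume "\<sigma> \<subseteq> (\<lambda>i. Suc (Suc i)) ` \<tau>"
    then have eq: "\<sigma> = (\<lambda>i. Suc (Suc i)) ` \<tau>" using decomp by auto
    have "app1 p 1 \<in> Z_span (Suc d) (sub bip \<sigma>)"
      using assms(3) p_carrier by simp
    then have "app1 p 1 \<in> flat ` gspan UNIV d (sub B \<tau>)"
      using int_all.gspan_app1_zero[OF sub_B[OF \<tau>B]]
      unfolding eq sub_bip_shift[OF \<tau>B] Z_span_eq_gspan by simp
    then show False by auto
  qed
  then obtain i where "i \<in> \<sigma> \<inter> {0, 1}" using decomp by blast
  moreover have "\<sigma> \<inter> {0, 1} = {i}" using calculation not_both by auto
  ultimately have i: "i < 2" "\<sigma> = insert i ((\<lambda>i. Suc (Suc i)) ` \<tau>)"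
    using decomp by auto
  show thesis
  proof (rule that[OF i(1) \<tau>B i(2)])
    have "card \<sigma> = Suc (card ((\<lambda>i. Suc (Suc i)) ` \<tau>))"
      unfolding i(2) using i(1) finite_subset[OF \<tau>B] by (subst card_insert_disjoint) auto
    then show "card \<tau> = d"
      using assms(1) by (simp add: card_image inj_on_def)
    obtain e where e: "e * e = 1" "sub bip \<sigma> = insert (app1 p e) (flat ` sub B \<tau>)"
    proof -
      have "sub bip \<sigma> = insert (bip ! i) (flat ` sub B \<tau>)"
        using sub_bip_shift[OF \<tau>B] unfolding i(2) by (simp add: sub_def)
      then show thesis
        using i(1) bip_nth that[of 1] that[of "-1"] by (auto simp: less_2_cases_iff)
    qed
    have "y \<in> Z_span d (sub B \<tau>)" if y: "y \<in> carrier_vec d" for y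
    proof -
      have "flat y \<in> Z_span (Suc d) (sub bip \<sigma>)" using y assms(3) by simp
      moreover have "y - 0 \<cdot>\<^sub>v p = y" using y p_carrier by (intro eq_vecI) auto
      ultimately show ?thesis
        using Z_span_apex[OF sub_B[OF \<tau>B] p_carrier y e(1), of 0] unfolding e(2) by simp
    qed
    then show "Z_span d (sub B \<tau>) = carrier_vec d"
      using gspan_carrier unfolding Z_span_eq_gspan by blast
  qed
qed

text \<open>At height 0 the apex gets the coefficient 0, so the slice of a cell there is the cone
  over its base indices.\<close>

lemma flat_mem_icone_cell:
  assumes "i < 2" "\<tau> \<subseteq> {..<length B}" "\<sigma> = insert i ((\<lambda>i. Suc (Suc i)) ` \<tau>)"
  shows "flat y \<in> icone (Suc d) (sub bip \<sigma>) \<longleftrightarrow> y \<in> icone d (sub B \<tau>)"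
proof (cases "y \<in> carrier_vec d")
  case True
  obtain e where e: "e * e = 1" "sub bip \<sigma> = insert (app1 p e) (flat ` sub B \<tau>)"
  proof -
    have "sub bip \<sigma> = insert (bip ! i) (flat ` sub B \<tau>)"
      using sub_bip_shift[OF assms(2)] unfolding assms(3) by (simp add: sub_def)
    then show thesis
      using assms(1) bip_nth that[of 1] that[of "-1"] by (auto simp: less_2_cases_iff)
  qed
  have "y - 0 \<cdot>\<^sub>v rvec p = y" using True p_carrier by (intro eq_vecI) auto
  then show ?thesis
    using icone_apex[OF sub_B[OF assms(2)] p_carrier True e(1), of 0] unfolding e(2) by simp
next
  case False
  then show ?thesis using icone_carrier by (metis app1_carrier)
qed

lemma flat_mem_icone_shift:
  assumes "\<tau> \<subseteq> {..<length B}"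
  shows "flat y \<in> icone (Suc d) (sub bip ((\<lambda>i. Suc (Suc i)) ` \<tau>)) \<longleftrightarrow> y \<in> icone d (sub B \<tau>)"
  unfolding sub_bip_shift[OF assms] icone_flat[OF sub_B[OF assms]] by auto

lemma flat_mem_icone_bip: "flat y \<in> icone (Suc d) (set bip) \<longleftrightarrow> y \<in> icone d (set B)"
proof (cases "y \<in> carrier_vec d")
  case True
  have "y - \<bar>0\<bar> \<cdot>\<^sub>v rvec p = y" using True p_carrier by (intro eq_vecI) auto
  then show ?thesis using icone_bip[OF True, of 0] by simp
next
  case False
  then show ?thesis using icone_carrier by (metis app1_carrier)
qed

text \<open>Removing the apex from the cells of a unimodular triangulation of the bipyramid, on both sides of
  the base, leaves a unimodular triangulation of the base.\<close>

lemma no_unimodular_bip: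
  assumes none: "\<not> (\<exists>\<Delta>. unimodular_triangulation d B \<Delta>)"
  shows "\<not> (\<exists>\<Delta>. unimodular_triangulation (Suc d) bip \<Delta>)"
proof
  assume "\<exists>\<Delta>. unimodular_triangulation (Suc d) bip \<Delta>"
  then obtain \<Delta> where \<Delta>: "simplicial_complex (length bip) \<Delta>"
    "\<And>\<sigma>. \<sigma> \<in> max_sets \<Delta> \<Longrightarrow> card \<sigma> = Suc d"
    "subdivides (Suc d) bip (max_sets \<Delta>)"
    "\<And>\<sigma>. \<sigma> \<in> max_sets \<Delta> \<Longrightarrow> Z_span (Suc d) (sub bip \<sigma>) = Z_span (Suc d) (set bip)"
    unfolding unimodular_triangulation_def triangulation_def by blast
  interpret bip: apex_config "Suc d" bip "flat p" by (rule apex_config_bip)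
  let ?s = "\<lambda>\<tau>::nat set. (\<lambda>i. Suc (Suc i)) ` \<tau>"
  \<comment> \<open>The apexes occupy the indices 0 and 1, hence the shift by two.
    \<open>\<Delta>'\<close> collects the faces without apexes, as index sets of
    \<open>B\<close>.\<close>
  define \<Delta>' where "\<Delta>' = {\<tau>. ?s \<tau> \<in> \<Delta>}"
  have down: "\<tau> \<in> \<Delta>" if "\<sigma> \<in> \<Delta>" "\<tau> \<subseteq> \<sigma>" for \<sigma> \<tau>
    using \<Delta>(1) that by (simp add: simplicial_complex_def)
  have cell: "\<exists>i \<tau>. i < 2 \<and> \<tau> \<subseteq> {..<length B} \<and> \<sigma> = insert i (?s \<tau>) \<and>
      card \<tau> = d \<and> Z_span d (sub B \<tau>) = carrier_vec d" if "\<sigma> \<in> max_sets \<Delta>" for \<sigma>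
  proof -
    have "\<sigma> \<subseteq> {..<length bip}"
      using that \<Delta>(1) by (auto simp: max_sets_def simplicial_complex_def)
    from unimodular_cell[OF \<Delta>(2)[OF that] this] show ?thesis
      using \<Delta>(4)[OF that] bip.Z_span_B by metis
  qed
  have shift_subset: "\<tau> \<subseteq> \<tau>'" if "?s \<tau> \<subseteq> insert i (?s \<tau>')" "i < 2" for i \<tau> \<tau>'
    using that by (auto simp: subset_iff image_iff)
  \<comment> \<open>A face of \<open>\<Delta>'\<close> above \<open>\<tau>\<close> lies in the base
    part of some cell. That part has \<open>d\<close> elements as well, so it equals
    \<open>\<tau>\<close>.\<close>
  have max1: "\<tau> \<in> max_sets \<Delta>'"
    if "\<sigma> \<in> max_sets \<Delta>" "i < 2" "\<sigma> = insert i (?s \<tau>)" "card \<tau> = d" "\<tau> \<subseteq> {..<length B}" for \<sigma> i \<tau>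
  proof -
    have "\<sigma> \<in> \<Delta>" using that(1) by (simp add: max_sets_def)
    then have "\<tau> \<in> \<Delta>'"
      using down[of \<sigma> "?s \<tau>"] that(3) by (auto simp: \<Delta>'_def)
    moreover have "\<rho> = \<tau>" if \<rho>: "\<rho> \<in> \<Delta>'" "\<tau> \<subseteq> \<rho>" for \<rho>
    proof -
      obtain \<sigma>' where \<sigma>': "\<sigma>' \<in> max_sets \<Delta>" "?s \<rho> \<subseteq> \<sigma>'"
        using max_sets_superset[OF \<Delta>(1)] \<rho>(1) unfolding \<Delta>'_def by blast
      obtain j \<tau>' where \<tau>': "j < 2" "\<tau>' \<subseteq> {..<length B}" "\<sigma>' = insert j (?s \<tau>')" "card \<tau>' = d"
        using cell[OF \<sigma>'(1)] by blast
      have "\<rho> \<subseteq> \<tau>'" using shift_subset \<sigma>'(2) \<tau>'(1,3) by blast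
      moreover have "finite \<tau>'" using \<tau>'(2) finite_subset by blast
      ultimately have "\<tau> = \<tau>'" "\<rho> \<subseteq> \<tau>'"
        using \<rho>(2) \<open>card \<tau> = d\<close> \<tau>'(4) card_subset_eq[of \<tau>' \<tau>] by auto
      then show ?thesis using \<rho>(2) by blast
    qed
    ultimately show ?thesis by (auto simp: max_sets_def)
  qed
  have max2: "\<exists>\<sigma> i. \<sigma> \<in> max_sets \<Delta> \<and> i < 2 \<and> \<sigma> = insert i (?s \<tau>) \<and> card \<tau> = d \<and>
      \<tau> \<subseteq> {..<length B} \<and> Z_span d (sub B \<tau>) = carrier_vec d" if \<tau>: "\<tau> \<in> max_sets \<Delta>'" for \<tau>
  proof -
    have "?s \<tau> \<in> \<Delta>" using \<tau> by (simp add: max_sets_def \<Delta>'_def)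
    then obtain \<sigma> where \<sigma>: "\<sigma> \<in> max_sets \<Delta>" "?s \<tau> \<subseteq> \<sigma>"
      using max_sets_superset[OF \<Delta>(1)] by blast
    obtain j \<tau>' where \<tau>': "j < 2" "\<tau>' \<subseteq> {..<length B}" "\<sigma> = insert j (?s \<tau>')" "card \<tau>' = d"
      "Z_span d (sub B \<tau>') = carrier_vec d"
      using cell[OF \<sigma>(1)] by blast
    have "\<tau> \<subseteq> \<tau>'" using shift_subset \<sigma>(2) \<tau>'(1,3) by blast
    moreover have "\<tau>' \<in> max_sets \<Delta>'" using max1 \<sigma>(1) \<tau>' by blast
    ultimately have "\<tau> = \<tau>'" using \<tau> by (auto simp: max_sets_def)
    then show ?thesis using \<sigma>(1) \<tau>' by blast
  qed
  have "unimodular_triangulation d B \<Delta>'"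
    unfolding unimodular_triangulation_def triangulation_def
  proof (intro conjI ballI)
    show "simplicial_complex (length B) \<Delta>'"
      unfolding simplicial_complex_def
    proof (intro conjI ballI allI impI)
      show "\<Delta>' \<subseteq> Pow {..<length B}"
        using \<Delta>(1) by (auto simp: \<Delta>'_def simplicial_complex_def bip_def subset_iff)
      show "\<tau> \<in> \<Delta>'" if "\<sigma> \<in> \<Delta>'" "\<tau> \<subseteq> \<sigma>" for \<sigma> \<tau>
        using down[OF _ image_mono[OF that(2)]] that(1) by (simp add: \<Delta>'_def)
    qed
    show "card \<tau> = d" if "\<tau> \<in> max_sets \<Delta>'" for \<tau>
      using max2[OF that] by blast
    show "Z_span d (sub B \<tau>) = Z_span d (set B)" if "\<tau> \<in> max_sets \<Delta>'" for \<tau>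
      using max2[OF that] unfolding Z_span_B by blast
    show "subdivides d B (max_sets \<Delta>')"
      unfolding subdivides_def
    proof (intro conjI ballI)
      have "y \<in> icone d (set B) \<longleftrightarrow> (\<exists>\<tau>\<in>max_sets \<Delta>'. y \<in> icone d (sub B \<tau>))" for y
      proof -
        \<comment> \<open>The subdivision of the base is the slice of that of the bipyramid at
          height 0.\<close>
        have "y \<in> icone d (set B) \<longleftrightarrow> (\<exists>\<sigma>\<in>max_sets \<Delta>. flat y \<in> icone (Suc d) (sub bip \<sigma>))"
          using \<Delta>(3) unfolding flat_mem_icone_bip[symmetric] subdivides_def by blast
        also have "\<dots> \<longleftrightarrow> (\<exists>\<tau>\<in>max_sets \<Delta>'. y \<in> icone d (sub B \<tau>))"
          using max1 max2 cell flat_mem_icone_cell by metis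
        finally show ?thesis .
      qed
      then show "icone d (set B) = (\<Union>\<tau>\<in>max_sets \<Delta>'. icone d (sub B \<tau>))" by blast
      fix \<tau> \<tau>' assume \<tau>: "\<tau> \<in> max_sets \<Delta>'" and \<tau>': "\<tau>' \<in> max_sets \<Delta>'"
      obtain \<sigma> i where \<sigma>: "\<sigma> \<in> max_sets \<Delta>" "i < 2" "\<sigma> = insert i (?s \<tau>)" "\<tau> \<subseteq> {..<length B}"
        using max2[OF \<tau>] by blast
      obtain \<sigma>' i' where \<sigma>': "\<sigma>' \<in> max_sets \<Delta>" "i' < 2" "\<sigma>' = insert i' (?s \<tau>')" "\<tau>' \<subseteq> {..<length B}"
        using max2[OF \<tau>'] by blast
      have sB: "\<tau> \<inter> \<tau>' \<subseteq> {..<length B}" using \<sigma>(4) by blast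
      \<comment> \<open>Cells with the same apex share it, cells with different apexes share none.
        At height 0 both cases leave the same cone.\<close>
      have "\<sigma> \<inter> \<sigma>' = ?s (\<tau> \<inter> \<tau>') \<or> \<sigma> \<inter> \<sigma>' = insert i (?s (\<tau> \<inter> \<tau>'))"
        using \<sigma>(2,3) \<sigma>'(2,3) by (auto simp: less_2_cases_iff)
      then have inter: "flat y \<in> icone (Suc d) (sub bip (\<sigma> \<inter> \<sigma>')) \<longleftrightarrow> y \<in> icone d (sub B (\<tau> \<inter> \<tau>'))" for y
        using flat_mem_icone_shift[OF sB] flat_mem_icone_cell[OF \<sigma>(2) sB] by metis
      have "y \<in> icone d (sub B \<tau>) \<inter> icone d (sub B \<tau>') \<longleftrightarrow> y \<in> icone d (sub B (\<tau> \<inter> \<tau>'))" for y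
        using \<Delta>(3) \<sigma>(1) \<sigma>'(1) flat_mem_icone_cell[OF \<sigma>(2,4,3)] flat_mem_icone_cell[OF \<sigma>'(2,4,3)]
        unfolding inter[symmetric] subdivides_def by blast
      then show "icone d (sub B \<tau>) \<inter> icone d (sub B \<tau>') = icone d (sub B (\<tau> \<inter> \<tau>'))" by blast
    qed
  qed
  with none show False by blast
qed

end

section \<open>Bipyramids are not simplicial\<close>

lemma lin_indep_coefficients_zero:
  fixes G :: "real vec set"
  assumes "G \<subseteq> carrier_vec n" "finite G"
    and indep: "\<not> LinearCombinations.module.lin_dep class_ring (module_vec TYPE(real) n) G"
    and sum: "\<And>k. k < n \<Longrightarrow> (\<Sum>g\<in>G. c g * g $ k) = 0" and "g \<in> G"
  shows "c g = 0"
proof -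
  interpret vec_space "TYPE(real)" n .
  have "lincomb c G = 0\<^sub>v n"
  proof (rule eq_vecI)
    fix k assume "k < dim_vec (0\<^sub>v n)"
    then have "k < n" by simp
    then show "lincomb c G $ k = 0\<^sub>v n $ k"
      using lincomb_index[of k G c] assms(1) sum by simp
  qed (use lincomb_dim[OF assms(2,1)] in simp)
  then show ?thesis
    using indep assms(1,2,5) unfolding lin_dep_def by blast
qed

lemma cone_elem:
  "x \<in> cone n G \<longleftrightarrow> x \<in> carrier_vec n \<and> (\<exists>c. (\<forall>g\<in>G. 0 \<le> c g) \<and> (\<forall>k<n. x $ k = (\<Sum>g\<in>G. c g * g $ k)))"
    (is "_ \<longleftrightarrow> ?R")
proof
  assume "x \<in> cone n G"
  then show ?R by (auto simp: cone_def)
next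
  assume ?R
  then obtain c where c: "x \<in> carrier_vec n" "\<forall>g\<in>G. 0 \<le> c g" "\<forall>k<n. x $ k = (\<Sum>g\<in>G. c g * g $ k)"
    by blast
  then have "x = vec n (\<lambda>k. \<Sum>g\<in>G. c g * g $ k)" by (intro eq_vecI) auto
  then show "x \<in> cone n G" using c(2) unfolding cone_def by blast
qed

text \<open>In an expression of \<open>b\<close> by \<open>G\<close> some term is nonzero in a
  coordinate where \<open>b\<close> is. The other terms add up to a point of the cone, so
  extremality of \<open>b\<close> puts the chosen term on the ray of \<open>b\<close>. Thus every
  generating set meets the line of each extreme ray.\<close>

lemma extreme_generator_parallel:
  assumes b: "b \<in> extreme_generators n B" and B: "set B \<subseteq> carrier_vec n"
    and G: "finite G" "G \<subseteq> carrier_vec n" "cone n G = icone n (set B)"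
  obtains g \<alpha> where "g \<in> G" "\<alpha> \<noteq> 0" "rvec b = \<alpha> \<cdot>\<^sub>v g"
proof -
  have bB: "b \<in> set B" "b \<noteq> 0\<^sub>v n" "b \<in> carrier_vec n"
    and ext: "\<And>x y. x \<in> icone n (set B) \<Longrightarrow> y \<in> icone n (set B) \<Longrightarrow> x + y = rvec b \<Longrightarrow> x \<in> icone n {b}"
    using b B by (auto simp: extreme_generators_def)
  obtain k where k: "k < n" "b $ k \<noteq> 0"
  proof (rule ccontr)
    assume "\<not> thesis"
    then have "b = 0\<^sub>v n" using that bB(3) by (intro eq_vecI) auto
    then show False using bB(2) by simp
  qed
  have "rvec b \<in> cone n G"
    using icone_superset[of "set B" n b] B bB(1) G(3) by simp
  then obtain c where c: "\<forall>g\<in>G. 0 \<le> c g" "\<forall>k<n. rvec b $ k = (\<Sum>g\<in>G. c g * g $ k)"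
    unfolding cone_elem by blast
  have "(\<Sum>g\<in>G. c g * g $ k) \<noteq> 0" using c(2) k bB(3) by auto
  then obtain g where g: "g \<in> G" "c g * g $ k \<noteq> 0"
    by (meson sum.neutral)
  have g_carrier: "g \<in> carrier_vec n" using g(1) G(2) by blast
  define y where "y = vec n (\<lambda>k. \<Sum>h\<in>G - {g}. c h * h $ k)"
  have "y \<in> cone n (G - {g})"
    using c(1) unfolding y_def cone_def by blast
  then have y: "y \<in> icone n (set B)"
    using real_nonneg.gspan_mono[of "G - {g}" G n] G(1,3) unfolding cone_eq_gspan by blast
  have "g \<in> cone n G"
    using real_nonneg.gspan_superset[OF G(1,2)] g(1) unfolding cone_eq_gspan by blast
  then have "c g \<cdot>\<^sub>v g \<in> icone n (set B)"
    using c(1) g(1) G(3) by (auto intro!: icone_smult)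
  moreover have "c g \<cdot>\<^sub>v g + y = rvec b"
  proof (rule eq_vecI)
    fix i assume "i < dim_vec (rvec b)"
    then have "i < n" using bB(3) by simp
    then show "(c g \<cdot>\<^sub>v g + y) $ i = rvec b $ i"
      using c(2) G(1) g(1) g_carrier by (simp add: y_def sum.remove)
  qed (use bB(3) in \<open>simp add: y_def\<close>)
  ultimately have "c g \<cdot>\<^sub>v g \<in> icone n {b}" using ext y by blast
  then obtain t where t: "c g \<cdot>\<^sub>v g = t \<cdot>\<^sub>v rvec b"
    unfolding icone_singleton[OF bB(3)] by blast
  have tk: "c g * g $ k = t * rvec b $ k"
    using arg_cong[OF t, of "\<lambda>x. x $ k"] k(1) g_carrier bB(3) by simp
  then have nz: "t \<noteq> 0" "c g \<noteq> 0" using g(2) by auto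
  have eq: "rvec b = (c g / t) \<cdot>\<^sub>v g"
  proof (rule eq_vecI)
    fix i assume "i < dim_vec ((c g / t) \<cdot>\<^sub>v g)"
    then have "i < n" using g_carrier by simp
    then have "c g * g $ i = t * rvec b $ i"
      using arg_cong[OF t, of "\<lambda>x. x $ i"] g_carrier bB(3) by simp
    then show "rvec b $ i = ((c g / t) \<cdot>\<^sub>v g) $ i"
      using \<open>i < n\<close> g_carrier nz by (simp add: field_simps)
  qed (use g_carrier bB(3) in simp)
  show thesis by (rule that[OF g(1) _ eq]) (use nz in simp)
qed

context apex_config
begin

text \<open>If the bipyramid were simplicial, both apexes would be multiples of generators, so that their
  midpoint \<open>p\<close> would lie on a face of dimension two, which then contains the point of \<open>inner\<close>.\<close>

lemma not_simplicial_bip: "\<not> simplicial_config (Suc d) bip"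
proof
  assume "simplicial_config (Suc d) bip"
  then obtain G where G: "G \<subseteq> carrier_vec (Suc d)" "finite G"
    and indep: "\<not> LinearCombinations.module.lin_dep class_ring (module_vec TYPE(real) (Suc d)) G"
    and cone: "cone (Suc d) G = icone (Suc d) (set bip)"
    unfolding simplicial_config_def by blast
  interpret bip: apex_config "Suc d" bip "flat p" by (rule apex_config_bip)
  obtain g1 \<alpha>1 where g1: "g1 \<in> G" "\<alpha>1 \<noteq> 0" "rvec (app1 p 1) = \<alpha>1 \<cdot>\<^sub>v g1"
    using extreme_generator_parallel[OF extreme_apex bip_carrier G(2,1) cone] by blast
  obtain g2 \<alpha>2 where g2: "g2 \<in> G" "\<alpha>2 \<noteq> 0" "rvec (app1 p (-1)) = \<alpha>2 \<cdot>\<^sub>v g2"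
    using extreme_generator_parallel[OF extreme_apex bip_carrier G(2,1) cone] by blast
  obtain q l where q: "q \<in> icone d (set B)" "0 < l" "rvec p - l \<cdot>\<^sub>v q \<in> icone d (set B)"
    "\<And>s. q \<noteq> s \<cdot>\<^sub>v rvec p"
    using inner by blast
  have flat_mem: "flat x \<in> cone (Suc d) G" if "x \<in> icone d (set B)" for x
  proof -
    have "x - \<bar>0\<bar> \<cdot>\<^sub>v rvec p = x" using icone_carrier[OF that] p_carrier by (intro eq_vecI) auto
    then show ?thesis
      using icone_bip[of x 0] icone_carrier[OF that] that cone by simp
  qed
  obtain a where a: "\<forall>g\<in>G. 0 \<le> a g" "\<forall>k<Suc d. flat q $ k = (\<Sum>g\<in>G. a g * g $ k)"
    using flat_mem[OF q(1)] unfolding cone_elem by blast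
  obtain b where b: "\<forall>g\<in>G. 0 \<le> b g"
      "\<forall>k<Suc d. flat (rvec p - l \<cdot>\<^sub>v q) $ k = (\<Sum>g\<in>G. b g * g $ k)"
    using flat_mem[OF q(3)] unfolding cone_elem by blast
  note car = icone_carrier[OF q(1)] p_carrier
  have g1k: "\<alpha>1 * g1 $ k = app1 (rvec p) 1 $ k" if "k < Suc d" for k
    using arg_cong[OF g1(3), of "\<lambda>x. x $ k"] that subsetD[OF G(1) g1(1)] by (simp add: rvec_app1)
  have g2k: "\<alpha>2 * g2 $ k = app1 (rvec p) (-1) $ k" if "k < Suc d" for k
    using arg_cong[OF g2(3), of "\<lambda>x. x $ k"] that subsetD[OF G(1) g2(1)] by (simp add: rvec_app1)
  \<comment> \<open>The sum of the apexes is \<open>2 p\<close>, and so is twice the sum of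
    \<open>l q\<close> and \<open>p - l q\<close>. Here \<open>c\<close> is the difference of the
    two expressions in the generators \<open>G\<close>.\<close>
  define c where
    "c g = (if g = g1 then \<alpha>1 else 0) + (if g = g2 then \<alpha>2 else 0) - 2 * (l * a g + b g)" for g
  have "(\<Sum>g\<in>G. c g * g $ k) = 0" if k: "k < Suc d" for k
  proof -
    have "(\<Sum>g\<in>G. c g * g $ k) = (\<Sum>g\<in>G. if g = g1 then \<alpha>1 * g $ k else 0)
        + (\<Sum>g\<in>G. if g = g2 then \<alpha>2 * g $ k else 0)
        - 2 * (l * (\<Sum>g\<in>G. a g * g $ k) + (\<Sum>g\<in>G. b g * g $ k))"
      unfolding c_def sum_distrib_left sum.distrib[symmetric] sum_subtractf[symmetric]
      by (intro sum.cong refl) (auto simp: algebra_simps)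
    also have "\<dots> = app1 (rvec p) 1 $ k + app1 (rvec p) (-1) $ k
        - 2 * (l * flat q $ k + flat (rvec p - l \<cdot>\<^sub>v q) $ k)"
      using G(2) g1(1) g2(1) g1k[OF k] g2k[OF k] a(2) b(2) k by (simp add: sum.delta')
    also have "\<dots> = 0"
      using car k by (auto simp: index_app1[of _ d] algebra_simps)
    finally show ?thesis .
  qed
  from lin_indep_coefficients_zero[OF G indep this] have c0: "\<And>g. g \<in> G \<Longrightarrow> c g = 0" .
  \<comment> \<open>Away from \<open>g1\<close> and \<open>g2\<close> the relation contains only the
    nonnegative coefficients of \<open>l q\<close> and \<open>p - l q\<close>, with the common
    factor -2. They vanish, so \<open>q\<close> lies in the span of the two apexes.\<close>
  have a0: "a g = 0" if "g \<in> G - {g1, g2}" for g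
  proof -
    have "l * a g + b g = 0" using c0[of g] that unfolding c_def by auto
    moreover have "0 \<le> l * a g" "0 \<le> b g" using a(1) b(1) q(2) that by auto
    ultimately show ?thesis using q(2) by (auto simp: add_nonneg_eq_0_iff)
  qed
  \<comment> \<open>Forgetting the height turns both apexes into \<open>p\<close>, hence
    \<open>g1\<close> and \<open>g2\<close> into multiples of \<open>p\<close> with these factors,
    and \<open>q\<close> into a multiple of \<open>p\<close> too.\<close>
  define \<gamma> where "\<gamma> g = (if g = g1 then 1 / \<alpha>1 else 1 / \<alpha>2)" for g
  have \<gamma>: "g $ k = \<gamma> g * rvec p $ k" if "g \<in> {g1, g2}" "k < d" for g k
    using g1k[of k] g2k[of k] that car g1(2) g2(2) by (auto simp: \<gamma>_def field_simps)
  have "q = (\<Sum>g\<in>{g1, g2}. a g * \<gamma> g) \<cdot>\<^sub>v rvec p"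
  proof (rule eq_vecI)
    fix k assume "k < dim_vec ((\<Sum>g\<in>{g1, g2}. a g * \<gamma> g) \<cdot>\<^sub>v rvec p)"
    then have k: "k < d" using p_carrier by simp
    then have "q $ k = (\<Sum>g\<in>G. a g * g $ k)"
      using a(2)[rule_format, of k] car by simp
    also have "\<dots> = (\<Sum>g\<in>{g1, g2}. a g * g $ k)"
      by (rule sum.mono_neutral_right) (use G(2) g1(1) g2(1) a0 in auto)
    also have "\<dots> = (\<Sum>g\<in>{g1, g2}. a g * \<gamma> g) * rvec p $ k"
      unfolding sum_distrib_right by (intro sum.cong refl) (use \<gamma> k in auto)
    finally show "q $ k = ((\<Sum>g\<in>{g1, g2}. a g * \<gamma> g) \<cdot>\<^sub>v rvec p) $ k"
      using k p_carrier by simp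
  qed (use car in simp)
  then show False using q(4) by blast
qed

end

section \<open>The regular subdivision into two cells\<close>

lemma scalar_prod_icone_nonpos:
  assumes "c \<in> carrier_vec n" "finite S" "S \<subseteq> carrier_vec n"
    and "\<And>b. b \<in> S \<Longrightarrow> c \<bullet> rvec b \<le> 0" and x: "x \<in> icone n S"
  shows "c \<bullet> x \<le> 0"
proof -
  let ?H = "{x \<in> carrier_vec n. c \<bullet> x \<le> 0}"
  have "\<forall>x\<in>icone n S. x \<in> ?H"
    using assms(2,3,4)
  proof (induction S rule: finite_induct)
    case empty
    then show ?case using assms(1) by (simp add: cone_eq_gspan)
  next
    case (insert a S)
    show ?case
    proof
      fix x assume "x \<in> icone n (insert a S)"
      then obtain t y where ty: "0 \<le> t" "y \<in> icone n S" "x = t \<cdot>\<^sub>v rvec a + y"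
        using insert.prems real_nonneg.gspan_insert[of "rvec ` S" n "rvec a" x] insert.hyps(1) rvec_image_carrier[of S n]
        by (auto simp: cone_eq_gspan)
      have a: "rvec a \<in> carrier_vec n" using insert.prems(1) by simp
      have "c \<bullet> x = t * (c \<bullet> rvec a) + c \<bullet> y"
        using ty(3) assms(1) a icone_carrier[OF ty(2)] by (simp add: scalar_prod_add_distrib[of _ n])
      moreover have "t * (c \<bullet> rvec a) \<le> 0"
        using ty(1) insert.prems(2)[of a] by (simp add: mult_nonneg_nonpos)
      moreover have "c \<bullet> y \<le> 0"
        using insert.IH insert.prems ty(2) by auto
      ultimately show "x \<in> ?H" using ty(3) a icone_carrier[OF ty(2)] by simp
    qed
  qed
  then show ?thesis using x by blast
qed

lemma max_sets_two:
  assumes "\<sigma> \<in> W" "\<sigma>' \<in> W" "\<And>\<tau>. \<tau> \<in> W \<Longrightarrow> \<tau> \<subseteq> \<sigma> \<or> \<tau> \<subseteq> \<sigma>'"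
    and "\<not> \<sigma> \<subseteq> \<sigma>'" "\<not> \<sigma>' \<subseteq> \<sigma>"
  shows "max_sets W = {\<sigma>, \<sigma>'}"
proof
  show "max_sets W \<subseteq> {\<sigma>, \<sigma>'}"
  proof
    fix \<tau> assume "\<tau> \<in> max_sets W"
    then have "\<tau> \<in> W" and max: "\<And>\<rho>. \<rho> \<in> W \<Longrightarrow> \<tau> \<subseteq> \<rho> \<Longrightarrow> \<rho> = \<tau>"
      by (auto simp: max_sets_def)
    from assms(3)[OF this(1)] show "\<tau> \<in> {\<sigma>, \<sigma>'}"
      using max[OF assms(1)] max[OF assms(2)] by (elim disjE) simp_all
  qed
  have "\<tau> = \<sigma>" if "\<tau> \<in> W" "\<sigma> \<subseteq> \<tau>" for \<tau>
    using assms(3)[OF that(1)] that(2) assms(4) by (meson subset_antisym subset_trans)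
  moreover have "\<tau> = \<sigma>'" if "\<tau> \<in> W" "\<sigma>' \<subseteq> \<tau>" for \<tau>
    using assms(3)[OF that(1)] that(2) assms(5) by (meson subset_antisym subset_trans)
  ultimately show "{\<sigma>, \<sigma>'} \<subseteq> max_sets W"
    using assms(1,2) by (auto simp: max_sets_def)
qed

text \<open>\<open>E\<close> stands for \<open>conf_ext\<close>: \<open>A_ext v\<close> in dimension
  4, the extreme generators above. It enters the geometry through the cone that it spans, which
  makes the treatment of the cells uniform in the dimension.\<close>

locale bipyramid_cells = apex_config +
  fixes E :: "int vec set"
  assumes E_subset: "E \<subseteq> set B" and icone_E: "icone d E = icone d (set B)"
begin

definition base :: "nat set" where
  "base = {i. i < length bip \<and> bip ! i \<in> flat ` E}"

lemma E_carrier: "finite E" "E \<subseteq> carrier_vec d"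
  using E_subset carrier_B by (auto intro: finite_subset)

lemma bip_first: "bip ! 0 = app1 p 1" "bip ! Suc 0 = app1 p (-1)" "1 < length bip"
  by (simp_all add: bip_def)

lemma base_not_apex: "0 \<notin> base" "Suc 0 \<notin> base"
  by (auto simp: base_def bip_first)

lemma sub_base: "sub bip base = flat ` E"
proof
  show "sub bip base \<subseteq> flat ` E" by (auto simp: sub_def base_def)
  show "flat ` E \<subseteq> sub bip base"
  proof
    fix x assume x: "x \<in> flat ` E"
    then have "x \<in> set bip" using E_subset by (auto simp: set_bip)
    then obtain i where "i < length bip" "x = bip ! i" by (metis in_set_conv_nth)
    then show "x \<in> sub bip base" using x by (auto simp: sub_def base_def)
  qed
qed

lemma sub_cells:
  "sub bip (insert 0 base) = insert (app1 p 1) (flat ` E)"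
  "sub bip (insert 1 base) = insert (app1 p (-1)) (flat ` E)"
  using sub_base bip_first by (auto simp: sub_def)

lemma cells_Int: "insert 0 base \<inter> insert 1 base = base"
  using base_not_apex by auto

lemma icone_cell:
  assumes "e * e = 1"
  shows "icone (Suc d) (insert (app1 p e) (flat ` E)) = icone (Suc d) (insert (app1 p e) (flat ` set B))"
proof (rule Set.set_eqI)
  fix x
  show "x \<in> icone (Suc d) (insert (app1 p e) (flat ` E)) \<longleftrightarrow>
    x \<in> icone (Suc d) (insert (app1 p e) (flat ` set B))"
  proof (cases "x \<in> carrier_vec (Suc d)")
    case True
    then obtain y t where x: "y \<in> carrier_vec d" "x = app1 y t"
      by (rule app1_cases)
    show ?thesis
      unfolding x(2) using icone_apex[OF E_carrier p_carrier x(1) assms]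
        icone_apex[OF _ carrier_B p_carrier x(1) assms] icone_E by simp
  next
    case False
    then show ?thesis using icone_carrier by blast
  qed
qed

text \<open>One cell has nonnegative and the other nonpositive heights, so a common point has height
  0 and lies in the cone over \<open>E\<close>.\<close>

lemma icone_cells_Int:
  "icone (Suc d) (insert (app1 p 1) (flat ` E)) \<inter> icone (Suc d) (insert (app1 p (-1)) (flat ` E)) =
    icone (Suc d) (flat ` E)"
proof
  show "icone (Suc d) (insert (app1 p 1) (flat ` E)) \<inter> icone (Suc d) (insert (app1 p (-1)) (flat ` E))
    \<subseteq> icone (Suc d) (flat ` E)"
  proof
    fix x assume x: "x \<in> icone (Suc d) (insert (app1 p 1) (flat ` E)) \<inter>
      icone (Suc d) (insert (app1 p (-1)) (flat ` E))"
    then have "x \<in> carrier_vec (Suc d)" using icone_carrier by blast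
    then obtain y t where y: "y \<in> carrier_vec d" "x = app1 y t"
      by (rule app1_cases)
    have "0 \<le> t \<and> y - t \<cdot>\<^sub>v rvec p \<in> icone d E" "0 \<le> - t"
      using x icone_apex[OF E_carrier p_carrier y(1), of 1 t] icone_apex[OF E_carrier p_carrier y(1), of "-1" t]
      unfolding y(2) by auto
    then have t: "t = 0" and "y - t \<cdot>\<^sub>v rvec p \<in> icone d E" by auto
    moreover have "y - 0 \<cdot>\<^sub>v rvec p = y" using y(1) p_carrier by (intro eq_vecI) auto
    ultimately show "x \<in> icone (Suc d) (flat ` E)"
      unfolding icone_flat[OF E_carrier] y(2) by simp
  qed
  show "icone (Suc d) (flat ` E) \<subseteq> icone (Suc d) (insert (app1 p 1) (flat ` E)) \<inter>
    icone (Suc d) (insert (app1 p (-1)) (flat ` E))"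
    using icone_mono[of "flat ` E" "insert (app1 p 1) (flat ` E)"]
      icone_mono[of "flat ` E" "insert (app1 p (-1)) (flat ` E)"] E_carrier(1) by auto
qed

lemma subdivides_bip: "subdivides (Suc d) bip {insert 0 base, insert 1 base}"
  unfolding subdivides_def
proof (intro conjI ballI)
  show "icone (Suc d) (set bip) = (\<Union>\<sigma>\<in>{insert 0 base, insert 1 base}. icone (Suc d) (sub bip \<sigma>))"
    using icone_bip_Un icone_cell[of 1] icone_cell[of "-1"] by (simp add: sub_cells[simplified])
  fix \<sigma> \<sigma>' assume "\<sigma> \<in> {insert 0 base, insert 1 base}" "\<sigma>' \<in> {insert 0 base, insert 1 base}"
  then consider "\<sigma> = \<sigma>'" | "\<sigma> = insert 0 base" "\<sigma>' = insert 1 base"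
    | "\<sigma> = insert 1 base" "\<sigma>' = insert 0 base" by blast
  then show "icone (Suc d) (sub bip \<sigma>) \<inter> icone (Suc d) (sub bip \<sigma>') = icone (Suc d) (sub bip (\<sigma> \<inter> \<sigma>'))"
  proof cases
    case 1
    then show ?thesis by simp
  next
    case 2
    then show ?thesis by (simp only: sub_cells cells_Int sub_base icone_cells_Int)
  next
    case 3
    then show ?thesis
      by (simp only: sub_cells cells_Int sub_base icone_cells_Int Int_commute[of "insert 1 base"]
        Int_commute[of "icone _ (insert (app1 p (-1)) _)"])
  qed
qed

text \<open>The opposite apex has a height of the wrong sign, and everything flat lies in the base.
  Lattice generation and the Hilbert basis property of a cell thereby become statements about one
  apex over all of \<open>B\<close>.\<close>

lemma bip_cell_eq:
  assumes "e = 1 \<or> e = -1"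
  shows "{b \<in> set bip. rvec b \<in> icone (Suc d) (insert (app1 p e) (flat ` E))} =
    insert (app1 p e) (flat ` set B)"
proof
  have e: "e * e = 1" using assms by auto
  show "insert (app1 p e) (flat ` set B) \<subseteq>
    {b \<in> set bip. rvec b \<in> icone (Suc d) (insert (app1 p e) (flat ` E))}"
  proof
    fix b assume b: "b \<in> insert (app1 p e) (flat ` set B)"
    have "insert (app1 p e) (flat ` set B) \<subseteq> carrier_vec (Suc d)"
      using carrier_B p_carrier by (auto simp: subset_iff)
    then have "rvec b \<in> icone (Suc d) (insert (app1 p e) (flat ` set B))"
      using b by (intro icone_superset) auto
    moreover have "b \<in> set bip" using b assms by (auto simp: set_bip)
    ultimately show "b \<in> {b \<in> set bip. rvec b \<in> icone (Suc d) (insert (app1 p e) (flat ` E))}"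
      unfolding icone_cell[OF e] by blast
  qed
  have "rvec (app1 p (- e)) \<notin> icone (Suc d) (insert (app1 p e) (flat ` E))"
  proof -
    have "rvec p \<in> carrier_vec d" using p_carrier by simp
    from icone_apex[OF E_carrier p_carrier this e, of "- real_of_int e"] show ?thesis
      using assms unfolding rvec_app1 by auto
  qed
  then show "{b \<in> set bip. rvec b \<in> icone (Suc d) (insert (app1 p e) (flat ` E))} \<subseteq>
    insert (app1 p e) (flat ` set B)"
    using assms by (auto simp: set_bip)
qed

lemma Z_span_cell:
  assumes "e = 1 \<or> e = -1"
  shows "Z_span (Suc d) {b \<in> set bip. rvec b \<in> icone (Suc d) (insert (app1 p e) (flat ` E))} =
    carrier_vec (Suc d)"
  unfolding bip_cell_eq[OF assms]
  by (rule Z_span_carrier_apex) (use carrier_B p_carrier assms Z_span_B in auto)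

lemma hilbert_cells_bip: "hilbert_cells (Suc d) bip {insert 0 base, insert 1 base}"
proof -
  have "hilbert_basis (Suc d) {b \<in> set bip. rvec b \<in> icone (Suc d) (insert (app1 p e) (flat ` E))}
      {x \<in> Z_span (Suc d) (set bip). rvec x \<in> icone (Suc d) (insert (app1 p e) (flat ` E))}"
    if e: "e = 1 \<or> e = -1" for e
  proof -
    have ee: "e * e = 1" using e by auto
    interpret bip: apex_config "Suc d" bip "flat p" by (rule apex_config_bip)
    show ?thesis
      unfolding hilbert_basis_def bip_cell_eq[OF e] unfolding bip.Z_span_B icone_cell[OF ee]
    proof (intro conjI)
      show "insert (app1 p e) (flat ` set B) \<subseteq> carrier_vec (Suc d)"
        using flat_image_carrier[OF carrier_B] p_carrier by simp
      show "N_span (Suc d) (insert (app1 p e) (flat ` set B)) =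
          {x \<in> carrier_vec (Suc d). rvec x \<in> icone (Suc d) (insert (app1 p e) (flat ` set B))}"
        by (rule N_span_saturated_apex[OF _ carrier_B p_carrier ee N_span_B]) simp
    qed simp
  qed
  from this[of 1] this[of "-1"] show ?thesis
    unfolding hilbert_cells_def using sub_cells by simp
qed

text \<open>The last coordinate and its negative attain the weights exactly on the two cells.
  Conversely, an admissible functional is at most 0 on \<open>E\<close>, hence on the whole base
  cone, so it attains the weight 1 at no flat vector. It does not attain 1 at both apexes either,
  since its value at their sum \<open>2 p\<close> is at most 0.\<close>

lemma weight_cells_bip:
  "max_sets (weight_cells (Suc d) bip (\<lambda>i. if i \<in> base then 0 else 1)) = {insert 0 base, insert 1 base}"
    (is "max_sets (weight_cells _ _ ?\<omega>) = _")
proof (rule max_sets_two)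
  have cell: "insert j base \<in> weight_cells (Suc d) bip ?\<omega>"
    if e: "(j = 0 \<and> e = 1) \<or> (j = 1 \<and> e = -1)" for j and e :: real
  proof -
    \<comment> \<open>This is the height, with the sign that makes it 1 at the apex of index
      \<open>j\<close>. It is 0 on flat vectors, so it misses the weight 1 of those outside
      \<open>base\<close>.\<close>
    define c where "c = e \<cdot>\<^sub>v unit_vec (Suc d) d"
    have c: "c \<in> carrier_vec (Suc d)" by (simp add: c_def)
    have cb: "c \<bullet> rvec (app1 y t) = e * t" if "y \<in> carrier_vec d" for y t
    proof -
      have "rvec (app1 y t) \<in> carrier_vec (Suc d)" using that by simp
      then have "c \<bullet> rvec (app1 y t) = e * rvec (app1 y t) $ d" unfolding c_def by simp
      then show ?thesis using that by (simp add: rvec_app1)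
    qed
    have val: "(i = 0 \<and> c \<bullet> rvec (bip ! i) = e) \<or> (i = 1 \<and> c \<bullet> rvec (bip ! i) = - e) \<or>
        (2 \<le> i \<and> c \<bullet> rvec (bip ! i) = 0)" if "i < length bip" for i
    proof -
      consider "i = 0" | "i = 1" | k where "i = Suc (Suc k)"
        by (metis One_nat_def not0_implies_Suc)
      then show ?thesis
      proof cases
        case 3
        then have "k < length B" using that by (simp add: bip_def)
        then have "B ! k \<in> carrier_vec d" using carrier_B by (auto simp: subset_iff)
        then show ?thesis using 3 cb[of "B ! k" 0] \<open>k < length B\<close> by (simp add: bip_def)
      qed (use cb p_carrier bip_first in auto)
    qed
    have base2: "2 \<le> i" if "i \<in> base" for i
      using that base_not_apex by (metis One_nat_def less_2_cases not_le_imp_less)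
    have "\<forall>i<length bip. c \<bullet> rvec (bip ! i) \<le> ?\<omega> i"
      using val e base2 by fastforce
    moreover have "insert j base = {i. i < length bip \<and> c \<bullet> rvec (bip ! i) = ?\<omega> i}"
    proof (rule Set.set_eqI)
      fix i
      have "i < length bip" if "i \<in> insert j base"
        using that e bip_first(3) by (auto simp: base_def)
      then show "i \<in> insert j base \<longleftrightarrow> i \<in> {i. i < length bip \<and> c \<bullet> rvec (bip ! i) = ?\<omega> i}"
        using val[of i] base2[of i] e by auto
    qed
    ultimately show ?thesis unfolding weight_cells_def using c by blast
  qed
  show "insert 0 base \<in> weight_cells (Suc d) bip ?\<omega>" using cell[of 0 1] by simp
  show "insert 1 base \<in> weight_cells (Suc d) bip ?\<omega>" using cell[of 1 "-1"] by simp
  show "\<not> insert 0 base \<subseteq> insert 1 base" "\<not> insert 1 base \<subseteq> insert 0 base"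
    using base_not_apex by auto
  fix \<tau> assume "\<tau> \<in> weight_cells (Suc d) bip ?\<omega>"
  then obtain c where c: "c \<in> carrier_vec (Suc d)" "\<forall>i<length bip. c \<bullet> rvec (bip ! i) \<le> ?\<omega> i"
    and \<tau>: "\<tau> = {i. i < length bip \<and> c \<bullet> rvec (bip ! i) = ?\<omega> i}"
    unfolding weight_cells_def by blast
  have "c \<bullet> rvec b \<le> 0" if "b \<in> flat ` E" for b
  proof -
    have "b \<in> (!) bip ` base" using that sub_base by (simp add: sub_def)
    then obtain i where "i \<in> base" "b = bip ! i" by blast
    then show ?thesis using c(2) by (auto simp: base_def)
  qed
  note E_nonpos = this
  have nonpos: "c \<bullet> x \<le> 0" if "x \<in> icone (Suc d) (flat ` E)" for x
    by (rule scalar_prod_icone_nonpos[OF c(1) _ _ E_nonpos that])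
      (use E_carrier flat_image_carrier in auto)
  have nonpos': "c \<bullet> rvec (flat b) \<le> 0" if "rvec b \<in> icone d (set B)" for b
    using nonpos[of "rvec (flat b)"] that by (simp add: icone_flat[OF E_carrier] icone_E rvec_app1)
  have "\<not> (0 \<in> \<tau> \<and> 1 \<in> \<tau>)"
  proof
    assume "0 \<in> \<tau> \<and> 1 \<in> \<tau>"
    then have 1: "c \<bullet> rvec (app1 p 1) = 1" "c \<bullet> rvec (app1 p (-1)) = 1"
      using base_not_apex bip_first by (auto simp: \<tau>)
    have pc: "rvec (app1 p e) \<in> carrier_vec (Suc d)" for e using p_carrier by simp
    have "rvec (app1 p 1) + rvec (app1 p (-1)) = 2 \<cdot>\<^sub>v rvec (flat p)"
      using p_carrier by (auto simp: rvec_app1 app1_add[of _ d] app1_smult intro!: eq_vecI)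
    then have "c \<bullet> rvec (app1 p 1) + c \<bullet> rvec (app1 p (-1)) = 2 * (c \<bullet> rvec (flat p))"
      using scalar_prod_add_distrib[OF c(1) pc pc, of 1 "-1"] scalar_prod_smult_right[of c "rvec (flat p)" 2]
        c(1) carrier_vecD[OF pc[of 0]] by simp
    then show False using 1 nonpos'[OF p_in_cone] by simp
  qed
  then consider "0 \<notin> \<tau>" | "1 \<notin> \<tau>" by blast
  moreover have base: "i \<in> base" if i: "i \<in> \<tau>" "i \<noteq> 0" "i \<noteq> 1" for i
  proof (rule ccontr)
    assume "i \<notin> base"
    then have 1: "c \<bullet> rvec (bip ! i) = 1" "i < length bip" using i \<tau> by auto
    obtain k where "i = Suc (Suc k)" using i by (metis One_nat_def not0_implies_Suc)
    then have "k < length B" "bip ! i = flat (B ! k)" using 1(2) by (auto simp: bip_def)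
    then show False
      using 1(1) nonpos'[of "B ! k"] icone_superset[OF _ carrier_B, of "B ! k"] by simp
  qed
  ultimately show "\<tau> \<subseteq> insert 0 base \<or> \<tau> \<subseteq> insert 1 base"
  proof cases
    case 1
    then have "\<tau> \<subseteq> insert 1 base" using base by (metis insert_iff subsetI)
    then show ?thesis ..
  next
    case 2
    then have "\<tau> \<subseteq> insert 0 base" using base by (metis insert_iff subsetI)
    then show ?thesis ..
  qed
qed

lemma subdivision_normal_bip: "subdivision_normal (Suc d) bip {insert 0 base, insert 1 base}"
  unfolding subdivision_normal_def
  using subdivides_bip hilbert_cells_bip weight_cells_bip by metis

end

section \<open>Monomial ideals\<close>

lemma keys_add_nat:
  fixes u w :: "nat \<Rightarrow>\<^sub>0 nat"
  shows "Poly_Mapping.keys (u + w) = Poly_Mapping.keys u \<union> Poly_Mapping.keys w"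
  by (auto simp: in_keys_iff lookup_add)

lemma monomials_zero [simp]: "0 \<in> monomials n"
  by (simp add: monomials_def)

lemma monomials_add: "u + w \<in> monomials n \<longleftrightarrow> u \<in> monomials n \<and> w \<in> monomials n"
  by (auto simp: monomials_def keys_add_nat)

lemma poly_ring_simps:
  "f \<in> carrier (poly_ring n) \<longleftrightarrow> Poly_Mapping.keys f \<subseteq> monomials n"
  "f \<oplus>\<^bsub>poly_ring n\<^esub> g = f + g" "f \<otimes>\<^bsub>poly_ring n\<^esub> g = f * g"
  "\<zero>\<^bsub>poly_ring n\<^esub> = 0" "\<one>\<^bsub>poly_ring n\<^esub> = 1"
  by (simp_all add: poly_ring_def)

lemma carrier_add:
  "f \<in> carrier (poly_ring n) \<Longrightarrow> g \<in> carrier (poly_ring n) \<Longrightarrow> f + g \<in> carrier (poly_ring n)"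
  unfolding poly_ring_simps using keys_add[of f g] by blast

lemma carrier_mult:
  assumes "f \<in> carrier (poly_ring n)" "g \<in> carrier (poly_ring n)"
  shows "f * g \<in> carrier (poly_ring n)"
  unfolding poly_ring_simps
proof
  fix x assume "x \<in> Poly_Mapping.keys (f * g)"
  then obtain a b where "x = a + b" "a \<in> Poly_Mapping.keys f" "b \<in> Poly_Mapping.keys g"
    using keys_mult[of f g] by blast
  then show "x \<in> monomials n"
    using assms by (auto simp: poly_ring_simps monomials_add)
qed

lemma carrier_uminus: "f \<in> carrier (poly_ring n) \<Longrightarrow> - f \<in> carrier (poly_ring n)"
  by (auto simp: poly_ring_simps in_keys_iff)

lemma carrier_zero: "0 \<in> carrier (poly_ring n)"
  by (simp add: poly_ring_simps)

lemma carrier_single: "u \<in> monomials n \<Longrightarrow> Poly_Mapping.single u c \<in> carrier (poly_ring n)"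
  by (simp add: poly_ring_simps)

lemma carrier_one: "1 \<in> carrier (poly_ring n)"
  by (simp add: poly_ring_simps)

lemma carrier_power: "f \<in> carrier (poly_ring n) \<Longrightarrow> f ^ k \<in> carrier (poly_ring n)"
  by (induction k) (auto intro: carrier_one carrier_mult)

lemma ring_poly_ring: "ring (poly_ring n :: 'k::field mpol ring)"
proof (rule ringI)
  show "abelian_group (poly_ring n :: 'k mpol ring)"
  proof (rule abelian_groupI)
    fix x :: "'k mpol" assume "x \<in> carrier (poly_ring n)"
    then show "\<exists>y\<in>carrier (poly_ring n). y \<oplus>\<^bsub>poly_ring n\<^esub> x = \<zero>\<^bsub>poly_ring n\<^esub>"
      by (intro bexI[of _ "- x"] carrier_uminus) (auto simp: poly_ring_simps(2-5))
  qed (auto simp: poly_ring_simps(2-5) ac_simps intro: carrier_add carrier_zero)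
  show "monoid (poly_ring n :: 'k mpol ring)"
    by (rule monoidI) (auto simp: poly_ring_simps(2-5) ac_simps intro: carrier_mult carrier_one)
qed (auto simp: poly_ring_simps(2-5) algebra_simps)

text \<open>Ideals of the record \<open>poly_ring n\<close> are handled through the operations of
  the ambient polynomial type; closure under negation comes from multiplication by -1.\<close>

lemma ideal_poly_ringI:
  fixes I :: "'k::field mpol set"
  assumes "I \<subseteq> carrier (poly_ring n)" "0 \<in> I" "\<And>f g. f \<in> I \<Longrightarrow> g \<in> I \<Longrightarrow> f + g \<in> I"
    and mult: "\<And>f g. f \<in> I \<Longrightarrow> g \<in> carrier (poly_ring n) \<Longrightarrow> g * f \<in> I"
  shows "ideal I (poly_ring n)"
proof (rule idealI[OF ring_poly_ring])
  interpret ring "poly_ring n :: 'k mpol ring" by (rule ring_poly_ring)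
  show "subgroup I (add_monoid (poly_ring n))"
  proof (rule add.subgroupI)
    fix f assume f: "f \<in> I"
    then have fc: "f \<in> carrier (poly_ring n)" using assms(1) by blast
    have "\<ominus>\<^bsub>poly_ring n\<^esub> f = - f"
      by (rule minus_equality) (use fc carrier_uminus[OF fc] in \<open>auto simp: poly_ring_simps(2-5)\<close>)
    moreover have "(- 1) * f \<in> I"
      by (rule mult[OF f carrier_uminus[OF carrier_one]])
    ultimately show "\<ominus>\<^bsub>poly_ring n\<^esub> f \<in> I"
      by (simp only: mult_minus1)
  qed (use assms in \<open>auto simp: poly_ring_simps(2-5)\<close>)
  show "g \<otimes>\<^bsub>poly_ring n\<^esub> f \<in> I" if "f \<in> I" "g \<in> carrier (poly_ring n)" for f g
    using mult[OF that] by (simp add: poly_ring_simps(3))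
  show "f \<otimes>\<^bsub>poly_ring n\<^esub> g \<in> I" if "f \<in> I" "g \<in> carrier (poly_ring n)" for f g
    using mult[OF that] by (simp add: poly_ring_simps(3) mult.commute)
qed

lemma ideal_poly_ringD:
  fixes I :: "'k::field mpol set"
  assumes "ideal I (poly_ring n)"
  shows "I \<subseteq> carrier (poly_ring n)" "0 \<in> I" "f \<in> I \<Longrightarrow> g \<in> I \<Longrightarrow> f + g \<in> I"
    "f \<in> I \<Longrightarrow> g \<in> carrier (poly_ring n) \<Longrightarrow> g * f \<in> I"
proof -
  interpret ideal I "poly_ring n" by fact
  show "I \<subseteq> carrier (poly_ring n)" by (rule a_subset)
  show "0 \<in> I"
    using additive_subgroup.zero_closed[OF ideal.axioms(1)[OF assms]] by (simp add: poly_ring_simps(4))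
  show "f \<in> I \<Longrightarrow> g \<in> I \<Longrightarrow> f + g \<in> I"
    using additive_subgroup.a_closed[OF ideal.axioms(1)[OF assms], of f g] by (simp add: poly_ring_simps(2))
  show "f \<in> I \<Longrightarrow> g \<in> carrier (poly_ring n) \<Longrightarrow> g * f \<in> I"
    using I_l_closed by (simp add: poly_ring_simps(3))
qed

lemma ideal_sum:
  fixes I :: "'k::field mpol set"
  assumes "ideal I (poly_ring n)" "\<And>x. x \<in> X \<Longrightarrow> h x \<in> I"
  shows "sum h X \<in> I"
  using assms(2) by (induction X rule: infinite_finite_induct)
    (auto intro: ideal_poly_ringD[OF assms(1)])

lemma sum_single_lookup: "(\<Sum>u\<in>Poly_Mapping.keys f. Poly_Mapping.single u (Poly_Mapping.lookup f u)) = f"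
proof (rule poly_mapping_eqI)
  fix k
  show "Poly_Mapping.lookup (\<Sum>u\<in>Poly_Mapping.keys f. Poly_Mapping.single u (Poly_Mapping.lookup f u)) k =
    Poly_Mapping.lookup f k"
    by (simp add: lookup_sum lookup_single when_def in_keys_iff)
qed

text \<open>This is the prime ideal generated by the variables of the ring with index outside
  \<open>\<sigma>\<close>, described by the supports of monomials.\<close>

definition off_face :: "nat \<Rightarrow> nat set \<Rightarrow> 'k::field mpol set" where
  "off_face n \<sigma> = {f \<in> carrier (poly_ring n). \<forall>u\<in>Poly_Mapping.keys f. \<not> Poly_Mapping.keys u \<subseteq> \<sigma>}"

lemma ideal_off_face: "ideal (off_face n \<sigma> :: 'k::field mpol set) (poly_ring n)"
proof (rule ideal_poly_ringI)
  show "off_face n \<sigma> \<subseteq> carrier (poly_ring n)" "0 \<in> off_face n \<sigma>"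
    by (auto simp: off_face_def carrier_zero)
  show "f + g \<in> off_face n \<sigma>" if "f \<in> off_face n \<sigma>" "g \<in> off_face n \<sigma>" for f g :: "'k mpol"
    using that keys_add[of f g] by (auto simp: off_face_def intro: carrier_add)
  show "g * f \<in> off_face n \<sigma>" if "f \<in> off_face n \<sigma>" "g \<in> carrier (poly_ring n)" for f g :: "'k mpol"
    using that keys_mult[of g f] by (fastforce simp: off_face_def keys_add_nat intro: carrier_mult)
qed

text \<open>Modulo the monomials off a face, every polynomial is congruent to one in the variables of the
  face; so the quotient is a polynomial ring and \<open>off_face\<close> is a radical ideal.\<close>

lemma power_mem_off_face:
  fixes f :: "'k::field mpol"
  assumes f: "f \<in> carrier (poly_ring n)" and fk: "f ^ k \<in> off_face n \<sigma>"
  shows "f \<in> off_face n \<sigma>"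
proof -
  note I = ideal_poly_ringD[OF ideal_off_face[of n \<sigma>, where ?'k = 'k]]
  let ?K = "{u \<in> Poly_Mapping.keys f. Poly_Mapping.keys u \<subseteq> \<sigma>}"
  \<comment> \<open>The part of \<open>f\<close> in the variables of the face, a representative of
    \<open>f\<close> modulo \<open>off_face n \<sigma>\<close>.\<close>
  define g where "g = (\<Sum>u\<in>?K. Poly_Mapping.single u (Poly_Mapping.lookup f u))"
  have lg: "Poly_Mapping.lookup g u = (if Poly_Mapping.keys u \<subseteq> \<sigma> then Poly_Mapping.lookup f u else 0)" for u
    unfolding g_def by (auto simp: lookup_sum lookup_single when_def in_keys_iff)
  have g: "g \<in> carrier (poly_ring n)"
    using f by (auto simp: poly_ring_simps in_keys_iff lg split: if_splits)
  have g_keys: "Poly_Mapping.keys u \<subseteq> \<sigma>" if "u \<in> Poly_Mapping.keys (g ^ j)" for j u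
    using that
  proof (induction j arbitrary: u)
    case 0
    then show ?case by simp
  next
    case (Suc j)
    then obtain a b where "u = a + b" "a \<in> Poly_Mapping.keys g" "b \<in> Poly_Mapping.keys (g ^ j)"
      using keys_mult[of g "g ^ j"] by auto
    then show ?case
      using Suc.IH[of b] by (auto simp: keys_add_nat in_keys_iff lg split: if_splits)
  qed
  have h: "f - g \<in> off_face n \<sigma>"
    using carrier_add[OF f carrier_uminus[OF g]]
    by (auto simp: off_face_def in_keys_iff lookup_minus lg)
  have "f ^ j - g ^ j \<in> off_face n \<sigma>" for j
  proof (induction j)
    case 0
    then show ?case by (simp add: I(2))
  next
    case (Suc j)
    have "f ^ Suc j - g ^ Suc j = f * (f ^ j - g ^ j) + g ^ j * (f - g)"
      by (simp add: algebra_simps)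
    then show ?case
      using I(3)[OF I(4)[OF Suc f] I(4)[OF h carrier_power[OF g, of j]]] by simp
  qed
  from I(3)[OF fk I(4)[OF this[of k] carrier_uminus[OF carrier_one]]]
  have "g ^ k \<in> off_face n \<sigma>" by simp
  \<comment> \<open>Every monomial of \<open>g ^ k\<close> is supported on the face, while
    membership in \<open>off_face n \<sigma>\<close> forbids this for each of them. With no monomial
    left, \<open>g = 0\<close> follows from the absence of zero divisors.\<close>
  then have "Poly_Mapping.keys (g ^ k) = {}"
    using g_keys by (auto simp: off_face_def)
  then have "g ^ k = 0"
    by (metis empty_iff lookup_zero not_in_keys_iff_lookup_eq_zero poly_mapping_eqI)
  then have "g = 0" by auto
  then have "\<not> Poly_Mapping.keys u \<subseteq> \<sigma>" if "u \<in> Poly_Mapping.keys f" for u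
    using lg[of u] that by (auto simp: in_keys_iff)
  then show ?thesis using f by (auto simp: off_face_def)
qed

section \<open>Stanley-Reisner ideals and radicals\<close>

definition ind_mon :: "nat set \<Rightarrow> nat \<Rightarrow> nat \<Rightarrow>\<^sub>0 nat" where
  "ind_mon \<tau> k = (\<Sum>i\<in>\<tau>. Poly_Mapping.single i k)"

lemma lookup_ind_mon: "finite \<tau> \<Longrightarrow> Poly_Mapping.lookup (ind_mon \<tau> k) i = (if i \<in> \<tau> then k else 0)"
  by (auto simp: ind_mon_def lookup_sum lookup_single when_def)

lemma keys_ind_mon: "finite \<tau> \<Longrightarrow> k \<noteq> 0 \<Longrightarrow> Poly_Mapping.keys (ind_mon \<tau> k) = \<tau>"
  by (auto simp: in_keys_iff lookup_ind_mon split: if_splits)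

lemma xpow_mult: "xpow (u + w) = xpow u * xpow w"
  by (simp add: xpow_def mult_single)

lemma prod_xpow_eq: "(\<Prod>i\<in>\<tau>. xpow (Poly_Mapping.single i 1)) = xpow (ind_mon \<tau> 1)"
proof (induction \<tau> rule: infinite_finite_induct)
  case (insert i \<tau>)
  then show ?case by (simp add: ind_mon_def xpow_mult)
qed (simp_all add: ind_mon_def xpow_def)

lemma xpow_ind_mon_power: "finite \<tau> \<Longrightarrow> xpow (ind_mon \<tau> 1) ^ k = xpow (ind_mon \<tau> k)"
proof (induction k)
  case 0
  then show ?case by (simp add: ind_mon_def xpow_def)
next
  case (Suc k)
  have "ind_mon \<tau> 1 + ind_mon \<tau> k = ind_mon \<tau> (Suc k)"
    by (rule poly_mapping_eqI) (use Suc.prems in \<open>simp add: lookup_add lookup_ind_mon\<close>)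
  then show ?case using Suc by (simp flip: xpow_mult)
qed

lemma keys_xpow: "Poly_Mapping.keys (xpow u :: 'k::field mpol) = {u}"
  by (simp add: xpow_def)

lemma carrier_xpow: "u \<in> monomials n \<Longrightarrow> xpow u \<in> carrier (poly_ring n)"
  by (simp add: poly_ring_simps keys_xpow)

text \<open>The prime decomposition over the facets. A polynomial in the intersection has only
  monomials whose support is a non-face, and each of them is divisible by the squarefree monomial of
  its support. With \<open>M\<close> nonempty the intersection stays inside the polynomial
  ring.\<close>

lemma stanley_reisner_ideal_eq:
  assumes M: "\<And>\<sigma>. \<sigma> \<in> M \<Longrightarrow> \<sigma> \<subseteq> {..<n}" and \<Delta>: "\<Delta> = {\<tau>. \<exists>\<sigma>\<in>M. \<tau> \<subseteq> \<sigma>}" "M \<noteq> {}"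
  shows "(stanley_reisner_ideal n \<Delta> :: 'k::field mpol set) = (\<Inter>\<sigma>\<in>M. off_face n \<sigma>)"
proof -
  interpret ring "poly_ring n :: 'k mpol ring" by (rule ring_poly_ring)
  define G :: "'k mpol set" where "G = {xpow (ind_mon \<tau> 1) | \<tau>. \<tau> \<subseteq> {..<n} \<and> \<tau> \<notin> \<Delta>}"
  have SR: "stanley_reisner_ideal n \<Delta> = genideal (poly_ring n) G"
    by (simp only: stanley_reisner_ideal_def G_def prod_xpow_eq)
  have fin: "finite \<tau>" if "\<tau> \<subseteq> {..<n}" for \<tau> using that finite_subset by blast
  have mon: "ind_mon \<tau> k \<in> monomials n" if "\<tau> \<subseteq> {..<n}" for \<tau> k
    using that fin[OF that] by (auto simp: monomials_def in_keys_iff lookup_ind_mon split: if_splits)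
  have G_sub: "G \<subseteq> off_face n \<sigma>" if "\<sigma> \<in> M" for \<sigma>
    using that \<Delta>(1) mon fin by (auto simp: G_def off_face_def keys_xpow keys_ind_mon carrier_xpow)
  have G_car: "G \<subseteq> carrier (poly_ring n)"
    using mon by (auto simp: G_def carrier_xpow)
  note I = genideal_ideal[OF G_car]
  show ?thesis
    unfolding SR
  proof
    show "genideal (poly_ring n) G \<subseteq> (\<Inter>\<sigma>\<in>M. off_face n \<sigma>)"
      using genideal_minimal[OF ideal_off_face G_sub] by blast
    show "(\<Inter>\<sigma>\<in>M. off_face n \<sigma>) \<subseteq> genideal (poly_ring n) G"
    proof
      fix f :: "'k mpol" assume f: "f \<in> (\<Inter>\<sigma>\<in>M. off_face n \<sigma>)"
      have "Poly_Mapping.single u c \<in> genideal (poly_ring n) G"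
        if u: "u \<in> Poly_Mapping.keys f" for u c
      proof -
        have um: "u \<in> monomials n" using f u \<Delta>(2) by (fastforce simp: off_face_def poly_ring_simps)
        define \<tau> where "\<tau> = Poly_Mapping.keys u"
        have \<tau>: "\<tau> \<subseteq> {..<n}" "\<tau> \<notin> \<Delta>"
          using um f u by (auto simp: \<tau>_def monomials_def \<Delta>(1) off_face_def)
        have "u = (u - ind_mon \<tau> 1) + ind_mon \<tau> 1"
        proof (rule poly_mapping_eqI)
          fix k
          have "k \<in> \<tau> \<Longrightarrow> Poly_Mapping.lookup u k \<noteq> 0"
            by (simp add: \<tau>_def in_keys_iff)
          then show "Poly_Mapping.lookup u k = Poly_Mapping.lookup (u - ind_mon \<tau> 1 + ind_mon \<tau> 1) k"
            by (simp add: lookup_add lookup_minus lookup_ind_mon[OF fin[OF \<tau>(1)]])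
        qed
        then have eq: "Poly_Mapping.single u c = Poly_Mapping.single (u - ind_mon \<tau> 1) c * xpow (ind_mon \<tau> 1)"
          unfolding xpow_def mult_single by (metis mult.right_neutral)
        have "Poly_Mapping.keys (u - ind_mon \<tau> 1) \<subseteq> Poly_Mapping.keys u"
          by (auto simp: in_keys_iff lookup_minus)
        then have "u - ind_mon \<tau> 1 \<in> monomials n"
          using um by (auto simp: monomials_def)
        moreover have "xpow (ind_mon \<tau> 1) \<in> genideal (poly_ring n) G"
          using genideal_self[OF G_car] \<tau> by (auto simp: G_def)
        ultimately show ?thesis
          unfolding eq using ideal_poly_ringD(4)[OF I] carrier_single by blast
      qed
      then have "(\<Sum>u\<in>Poly_Mapping.keys f. Poly_Mapping.single u (Poly_Mapping.lookup f u)) \<in> genideal (poly_ring n) G"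
        by (intro ideal_sum[OF I]) auto
      then show "f \<in> genideal (poly_ring n) G" by (simp add: sum_single_lookup)
    qed
  qed
qed

lemma ideal_radical:
  fixes I :: "'k::field mpol set"
  assumes I: "ideal I (poly_ring n)"
  shows "ideal (radical n I) (poly_ring n)"
proof (rule ideal_poly_ringI)
  note I = I ideal_poly_ringD[OF I]
  show "radical n I \<subseteq> carrier (poly_ring n)" by (auto simp: radical_def)
  show "0 \<in> radical n I"
    using I(3) by (auto simp: radical_def carrier_zero intro!: exI[of _ 1])
  have up: "f ^ m \<in> I" if "f ^ k \<in> I" "f \<in> carrier (poly_ring n)" "k \<le> m" for f k m
  proof -
    have "f ^ m = f ^ (m - k) * f ^ k" using that(3) by (simp flip: power_add)
    then show ?thesis using I(5)[OF that(1) carrier_power[OF that(2)]] by simp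
  qed
  have of_nat_car: "(of_nat m :: 'k mpol) \<in> carrier (poly_ring n)" for m
    by (induction m) (auto intro: carrier_zero carrier_one carrier_add)
  fix f g assume fg: "f \<in> radical n I"
  then obtain k where k: "0 < k" "f ^ k \<in> I" and f: "f \<in> carrier (poly_ring n)"
    by (auto simp: radical_def)
  show "f + g \<in> radical n I" if g_rad: "g \<in> radical n I"
  proof -
    obtain l where l: "0 < l" "g ^ l \<in> I" and g: "g \<in> carrier (poly_ring n)"
      using g_rad by (auto simp: radical_def)
    have "of_nat ((k + l) choose j) * f ^ j * g ^ (k + l - j) \<in> I" if "j \<le> k + l" for j
    proof (cases "k \<le> j")
      case True
      have eq: "of_nat ((k + l) choose j) * f ^ j * g ^ (k + l - j) =
          (of_nat ((k + l) choose j) * g ^ (k + l - j)) * f ^ j" by (simp add: ac_simps)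
      show ?thesis
        unfolding eq by (rule I(5)[OF up[OF k(2) f True] carrier_mult[OF of_nat_car carrier_power[OF g]]])
    next
      case False
      then have "l \<le> k + l - j" by simp
      then show ?thesis
        by (rule I(5)[OF up[OF l(2) g] carrier_mult[OF of_nat_car carrier_power[OF f]]])
    qed
    then have "(f + g) ^ (k + l) \<in> I"
      unfolding binomial_ring by (intro ideal_sum[OF I(1)]) auto
    then show ?thesis
      using k(1) carrier_add[OF f g] by (auto simp: radical_def)
  qed
  show "g * f \<in> radical n I" if "g \<in> carrier (poly_ring n)"
    using I(5)[OF k(2) carrier_power[OF that, of k]] k(1) carrier_mult[OF that f]
    by (auto simp: radical_def power_mult_distrib)
qed

section \<open>Toric ideals and weight orders\<close>

text \<open>The multidegree of a monomial in the grading for which the toric ideal is homogeneous.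
  The default 0 from \<open>d\<close> on turns equality of degrees into equality of
  functions.\<close>

definition exp_degree :: "nat \<Rightarrow> int vec list \<Rightarrow> (nat \<Rightarrow>\<^sub>0 nat) \<Rightarrow> nat \<Rightarrow> int" where
  "exp_degree d B u k =
    (if k < d then \<Sum>i<length B. int (Poly_Mapping.lookup u i) * (B ! i) $ k else 0)"

lemma exp_degree_add: "exp_degree d B (u + w) = (\<lambda>k. exp_degree d B u k + exp_degree d B w k)"
  by (auto simp: exp_degree_def lookup_add sum.distrib algebra_simps)

text \<open>The homogeneous part of degree \<open>\<beta>\<close> evaluated at the all-ones point, a
  linear form that kills every binomial with terms of equal degree.\<close>

definition fiber_sum ::
  "nat \<Rightarrow> int vec list \<Rightarrow> (nat \<Rightarrow> int) \<Rightarrow> 'k::field mpol \<Rightarrow> 'k" where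
  "fiber_sum d B \<beta> f =
    (\<Sum>u\<in>Poly_Mapping.keys f. if exp_degree d B u = \<beta> then Poly_Mapping.lookup f u else 0)"

lemma fiber_sum_add: "fiber_sum d B \<beta> (f + g) = fiber_sum d B \<beta> f + fiber_sum d B \<beta> g"
  unfolding fiber_sum_def
  by (rule setsum_keys_plus_distrib[where f = "\<lambda>u c. if exp_degree d B u = \<beta> then c else 0"]) auto

lemma fiber_sum_zero [simp]: "fiber_sum d B \<beta> 0 = 0"
  by (simp add: fiber_sum_def)

lemma fiber_sum_sum: "fiber_sum d B \<beta> (sum h X) = (\<Sum>x\<in>X. fiber_sum d B \<beta> (h x))"
  by (induction X rule: infinite_finite_induct) (auto simp: fiber_sum_add)

lemma fiber_sum_single: "fiber_sum d B \<beta> (Poly_Mapping.single u c) = (if exp_degree d B u = \<beta> then c else 0)"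
  by (simp add: fiber_sum_def)

lemma fiber_sum_single_mult:
  "fiber_sum d B \<beta> (Poly_Mapping.single w c * f) =
    c * fiber_sum d B (\<lambda>k. \<beta> k - exp_degree d B w k) f"
proof -
  have "fiber_sum d B \<beta> (Poly_Mapping.single w c * f) = fiber_sum d B \<beta>
      (Poly_Mapping.single w c * (\<Sum>u\<in>Poly_Mapping.keys f. Poly_Mapping.single u (Poly_Mapping.lookup f u)))"
    by (simp add: sum_single_lookup)
  also have "\<dots> = (\<Sum>u\<in>Poly_Mapping.keys f.
      if exp_degree d B (w + u) = \<beta> then c * Poly_Mapping.lookup f u else 0)"
    by (simp add: sum_distrib_left mult_single fiber_sum_sum fiber_sum_single)
  also have "\<dots> = c * fiber_sum d B (\<lambda>k. \<beta> k - exp_degree d B w k) f"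
    unfolding fiber_sum_def sum_distrib_left
    by (intro sum.cong refl) (auto simp: exp_degree_add fun_eq_iff algebra_simps)
  finally show ?thesis .
qed

text \<open>Multiplication by a monomial shifts all degrees alike, so the polynomials with vanishing
  fiber sums form an ideal, and this ideal contains the generating binomials.\<close>

lemma toric_ideal_fiber_sum:
  fixes f :: "'k::field mpol"
  assumes "f \<in> toric_ideal d B"
  shows "fiber_sum d B \<beta> f = 0"
proof -
  define J :: "'k mpol set" where
    "J = {f \<in> carrier (poly_ring (length B)). \<forall>\<beta>. fiber_sum d B \<beta> f = 0}"
  have "ideal J (poly_ring (length B))"
  proof (rule ideal_poly_ringI)
    show "J \<subseteq> carrier (poly_ring (length B))" "0 \<in> J"
      by (auto simp: J_def carrier_zero)
    show "f + g \<in> J" if "f \<in> J" "g \<in> J" for f g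
      using that by (auto simp: J_def fiber_sum_add intro: carrier_add)
    show "g * f \<in> J" if "f \<in> J" "g \<in> carrier (poly_ring (length B))" for f g
    proof -
      have "fiber_sum d B \<beta> (g * f) = fiber_sum d B \<beta>
          ((\<Sum>w\<in>Poly_Mapping.keys g. Poly_Mapping.single w (Poly_Mapping.lookup g w)) * f)" for \<beta>
        by (simp add: sum_single_lookup)
      also have "\<dots> \<beta> = 0" for \<beta>
        using that(1) by (simp add: sum_distrib_right fiber_sum_sum fiber_sum_single_mult J_def)
      finally show ?thesis
        using that carrier_mult by (auto simp: J_def)
    qed
  qed
  moreover have "(xpow u - xpow v :: 'k mpol) \<in> J"
    if "u \<in> monomials (length B)" "v \<in> monomials (length B)"
      and eq: "\<forall>k<d. (\<Sum>i<length B. int (Poly_Mapping.lookup u i) * (B ! i) $ k) =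
        (\<Sum>i<length B. int (Poly_Mapping.lookup v i) * (B ! i) $ k)" for u v
  proof -
    have "exp_degree d B u = exp_degree d B v" using eq by (auto simp: exp_degree_def)
    then have "fiber_sum d B \<beta> (xpow u + Poly_Mapping.single v (- 1) :: 'k mpol) = 0" for \<beta>
      unfolding fiber_sum_add xpow_def fiber_sum_single by simp
    moreover have eq': "(xpow u - xpow v :: 'k mpol) = xpow u + Poly_Mapping.single v (- 1)"
      by (simp add: xpow_def single_uminus)
    ultimately show ?thesis
      using carrier_add[OF carrier_xpow[OF that(1)] carrier_single[OF that(2)]]
      unfolding eq' by (simp add: J_def)
  qed
  ultimately have "toric_ideal d B \<subseteq> J"
    unfolding toric_ideal_def by (intro ring.genideal_minimal[OF ring_poly_ring]) auto
  then show ?thesis using assms by (auto simp: J_def)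
qed

text \<open>The coefficients in the degree of \<open>u\<close> sum to zero, so the nonzero
  coefficient of \<open>u\<close> must have a companion. For a leading monomial this yields a
  smaller monomial of the same degree.\<close>

lemma toric_ideal_keys:
  fixes f :: "'k::field mpol"
  assumes "f \<in> toric_ideal d B" "u \<in> Poly_Mapping.keys f"
  obtains w where "w \<in> Poly_Mapping.keys f" "w \<noteq> u" "exp_degree d B w = exp_degree d B u"
proof (rule ccontr)
  assume no: "\<not> thesis"
  have "fiber_sum d B (exp_degree d B u) f =
      (\<Sum>w\<in>Poly_Mapping.keys f. if w = u then Poly_Mapping.lookup f w else 0)"
    unfolding fiber_sum_def by (intro sum.cong refl) (use no that in auto)
  also have "\<dots> = Poly_Mapping.lookup f u" using assms(2) by simp
  finally show False
    using toric_ideal_fiber_sum[OF assms(1), of "exp_degree d B u"] assms(2) by (simp add: in_keys_iff)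
qed

section \<open>Weight orders and a criterion for regularity\<close>

definition weight :: "nat \<Rightarrow> (nat \<Rightarrow> nat) \<Rightarrow> (nat \<Rightarrow>\<^sub>0 nat) \<Rightarrow> nat" where
  "weight n \<omega> u = (\<Sum>i<n. \<omega> i * Poly_Mapping.lookup u i)"

lemma weight_add: "weight n \<omega> (u + w) = weight n \<omega> u + weight n \<omega> w"
  by (simp add: weight_def lookup_add algebra_simps sum.distrib)

text \<open>Ties are broken by the lexicographic order, which is the order of the type \<open>nat \<Rightarrow>\<^sub>0 nat\<close>.\<close>

definition weight_order :: "nat \<Rightarrow> (nat \<Rightarrow> nat) \<Rightarrow> (nat \<Rightarrow>\<^sub>0 nat) rel" where
  "weight_order n \<omega> = {(u, v). u \<in> monomials n \<and> v \<in> monomials n \<and>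
     (weight n \<omega> u < weight n \<omega> v \<or> weight n \<omega> u = weight n \<omega> v \<and> u \<le> v)}"

lemma poly_mapping_nat_nonneg: "0 \<le> (u :: nat \<Rightarrow>\<^sub>0 nat)"
proof -
  have "\<not> u < 0" by (simp add: less_poly_mapping.rep_eq less_fun_def)
  then show ?thesis by simp
qed

lemma term_order_weight_order: "term_order n (weight_order n \<omega>)"
  unfolding term_order_def
proof (intro conjI ballI allI impI)
  show "linear_order_on (monomials n) (weight_order n \<omega>)"
    unfolding linear_order_on_def partial_order_on_def preorder_on_def
  proof (intro conjI)
    show "trans (weight_order n \<omega>)"
      by (rule transI) (auto simp: weight_order_def)
    show "antisym (weight_order n \<omega>)"
      by (rule antisymI) (auto simp: weight_order_def)
  qed (auto simp: refl_on_def total_on_def weight_order_def)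
  show "(0, u) \<in> weight_order n \<omega>" if "u \<in> monomials n" for u
  proof -
    have "weight n \<omega> 0 = 0" by (simp add: weight_def)
    then show ?thesis
      using that poly_mapping_nat_nonneg[of u] by (cases "weight n \<omega> u = 0") (auto simp: weight_order_def)
  qed
  show "(u + w, v + w) \<in> weight_order n \<omega>" if "w \<in> monomials n" "(u, v) \<in> weight_order n \<omega>" for u v w
    using that by (auto simp: weight_order_def weight_add monomials_add add_right_mono)
qed

text \<open>By \<open>face\<close> a monomial supported on a cell is the unique lightest one of its
  degree, so it never leads, and the initial ideal lies in every \<open>off_face\<close>; these
  ideals are radical, so the radical lies there too. By \<open>nonface\<close> each non-face
  supports the leading monomial of a binomial, which divides a power of the squarefree monomial of
  that non-face.\<close>

lemma regular_triangulation_weight: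
  fixes B :: "int vec list" and \<omega> :: "nat \<Rightarrow> nat"
  assumes tri: "triangulation d B \<Delta>"
    and \<Delta>: "\<Delta> = {\<tau>. \<exists>\<sigma>\<in>M. \<tau> \<subseteq> \<sigma>}" "M \<noteq> {}" "\<And>\<sigma>. \<sigma> \<in> M \<Longrightarrow> \<sigma> \<subseteq> {..<length B}"
    and face: "\<And>\<sigma> u w. \<sigma> \<in> M \<Longrightarrow> u \<in> monomials (length B) \<Longrightarrow> w \<in> monomials (length B) \<Longrightarrow>
      Poly_Mapping.keys u \<subseteq> \<sigma> \<Longrightarrow> exp_degree d B u = exp_degree d B w \<Longrightarrow> u \<noteq> w \<Longrightarrow>
      weight (length B) \<omega> u < weight (length B) \<omega> w"
    and nonface: "\<And>\<tau>. \<tau> \<subseteq> {..<length B} \<Longrightarrow> \<tau> \<notin> \<Delta> \<Longrightarrow> \<exists>u\<in>monomials (length B).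
      \<exists>v\<in>monomials (length B). Poly_Mapping.keys u \<subseteq> \<tau> \<and> exp_degree d B u = exp_degree d B v \<and>
      weight (length B) \<omega> v < weight (length B) \<omega> u"
  shows "regular_triangulation TYPE('k::field) d B \<Delta>"
proof -
  define n where "n = length B"
  define r where "r = weight_order n \<omega>"
  define I :: "'k mpol set" where "I = toric_ideal d B"
  interpret ring "poly_ring n :: 'k mpol ring" by (rule ring_poly_ring)
  define L :: "'k mpol set" where
    "L = {xpow u | u. \<exists>f\<in>I. u \<in> Poly_Mapping.keys f \<and> (\<forall>v\<in>Poly_Mapping.keys f. (v, u) \<in> r)}"
  have in_eq: "initial_ideal n r I = genideal (poly_ring n) L"
    by (simp add: initial_ideal_def L_def)
  have L_off: "L \<subseteq> off_face n \<sigma>" if \<sigma>: "\<sigma> \<in> M" for \<sigma>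
  proof
    fix x assume "x \<in> L"
    then obtain u f where u: "x = xpow u" "f \<in> I" "u \<in> Poly_Mapping.keys f"
      "\<forall>v\<in>Poly_Mapping.keys f. (v, u) \<in> r" by (auto simp: L_def)
    obtain w where w: "w \<in> Poly_Mapping.keys f" "w \<noteq> u" "exp_degree d B w = exp_degree d B u"
      using toric_ideal_keys u(2,3) unfolding I_def by metis
    have wu: "(w, u) \<in> r" using u(4) w(1) by blast
    then have mon: "w \<in> monomials n" "u \<in> monomials n" "weight n \<omega> w \<le> weight n \<omega> u"
      by (auto simp: r_def weight_order_def)
    have "\<not> Poly_Mapping.keys u \<subseteq> \<sigma>"
      using face[OF \<sigma>, of u w] mon w(2,3) unfolding n_def by auto
    then show "x \<in> off_face n \<sigma>"
      using mon(2) by (simp add: u(1) off_face_def carrier_xpow keys_xpow)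
  qed
  obtain \<sigma>0 where "\<sigma>0 \<in> M" using \<Delta>(2) by blast
  then have L_car: "L \<subseteq> carrier (poly_ring n)"
    using L_off by (auto simp: off_face_def)
  note in_ideal = genideal_ideal[OF L_car, folded in_eq]
  have in_off: "initial_ideal n r I \<subseteq> off_face n \<sigma>" if "\<sigma> \<in> M" for \<sigma>
    unfolding in_eq by (rule genideal_minimal[OF ideal_off_face L_off[OF that]])
  have SR: "(stanley_reisner_ideal n \<Delta> :: 'k mpol set) = (\<Inter>\<sigma>\<in>M. off_face n \<sigma>)"
    by (rule stanley_reisner_ideal_eq) (use \<Delta> n_def in auto)
  have "radical n (initial_ideal n r I) = stanley_reisner_ideal n \<Delta>"
  proof
    show "radical n (initial_ideal n r I) \<subseteq> stanley_reisner_ideal n \<Delta>"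
      unfolding SR using in_off by (auto simp: radical_def intro: power_mem_off_face)
    show "stanley_reisner_ideal n \<Delta> \<subseteq> radical n (initial_ideal n r I)"
      unfolding stanley_reisner_ideal_def
    proof (rule genideal_minimal[OF ideal_radical[OF in_ideal]], safe)
      fix \<tau> assume \<tau>: "\<tau> \<subseteq> {..<n}" "\<tau> \<notin> \<Delta>"
      then have fin: "finite \<tau>" using finite_subset by blast
      obtain u v where u: "u \<in> monomials n" "v \<in> monomials n" "Poly_Mapping.keys u \<subseteq> \<tau>"
        "exp_degree d B u = exp_degree d B v" "weight n \<omega> v < weight n \<omega> u"
        using nonface \<tau> unfolding n_def by blast
      have "xpow u - xpow v \<in> I"
      proof -
        have "(\<Sum>i<length B. int (Poly_Mapping.lookup u i) * (B ! i) $ k) =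
            (\<Sum>i<length B. int (Poly_Mapping.lookup v i) * (B ! i) $ k)" if "k < d" for k
          using fun_cong[OF u(4), of k] that by (simp add: exp_degree_def)
        then have mem: "xpow u - xpow v \<in> {xpow u - xpow v | u v.
            u \<in> monomials (length B) \<and> v \<in> monomials (length B) \<and>
            (\<forall>k<d. (\<Sum>i<length B. int (Poly_Mapping.lookup u i) * (B ! i) $ k) =
               (\<Sum>i<length B. int (Poly_Mapping.lookup v i) * (B ! i) $ k))}"
          using u(1,2) n_def by blast
        show ?thesis
          unfolding I_def toric_ideal_def genideal_def by (rule InterI) (use mem in blast)
      qed
      \<comment> \<open>The different weights keep \<open>u\<close> and \<open>v\<close> apart, so
        the two terms do not cancel.\<close>
      moreover have "Poly_Mapping.keys (xpow u - xpow v :: 'k mpol) = {u, v}"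
        using u(5) by (auto simp: in_keys_iff lookup_minus xpow_def lookup_single when_def split: if_splits)
      ultimately have "xpow u \<in> L"
        using u unfolding L_def r_def weight_order_def by fastforce
      then have xu: "xpow u \<in> initial_ideal n r I"
        using genideal_self[OF L_car] in_eq by blast
      \<comment> \<open>The sum bounds every exponent of \<open>u\<close>, so the monomial of
        \<open>u\<close> divides the \<open>k\<close>-th power. The successor makes \<open>k\<close>
        positive, as \<open>radical\<close> demands.\<close>
      define k where "k = Suc (\<Sum>i\<in>\<tau>. Poly_Mapping.lookup u i)"
      have "Poly_Mapping.lookup u i \<le> k" if "i \<in> \<tau>" for i
        using member_le_sum[OF that, of "Poly_Mapping.lookup u"] fin by (simp add: k_def)
      then have "ind_mon \<tau> k = (ind_mon \<tau> k - u) + u"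
        using u(3) by (intro poly_mapping_eqI)
          (auto simp: lookup_add lookup_minus lookup_ind_mon[OF fin] in_keys_iff subset_iff)
      then have eq: "xpow (ind_mon \<tau> k) = xpow (ind_mon \<tau> k - u) * (xpow u :: 'k mpol)"
        by (metis xpow_mult)
      have mon: "ind_mon \<tau> j \<in> monomials n" for j
        using \<tau>(1) by (auto simp: monomials_def in_keys_iff lookup_ind_mon[OF fin] split: if_splits)
      have "Poly_Mapping.keys (ind_mon \<tau> k - u) \<subseteq> Poly_Mapping.keys (ind_mon \<tau> k)"
        by (auto simp: in_keys_iff lookup_minus)
      then have "ind_mon \<tau> k - u \<in> monomials n"
        using mon[of k] by (auto simp: monomials_def)
      then have "xpow (ind_mon \<tau> k) \<in> initial_ideal n r I"
        unfolding eq by (intro ideal_poly_ringD(4)[OF in_ideal xu] carrier_xpow)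
      then show "(\<Prod>i\<in>\<tau>. xpow (Poly_Mapping.single i 1)) \<in> radical n (initial_ideal n r I)"
        unfolding prod_xpow_eq radical_def
      proof (intro CollectI conjI exI[of _ k])
        show "0 < k" by (simp add: k_def)
        show "xpow (ind_mon \<tau> 1) \<in> carrier (poly_ring n)" by (rule carrier_xpow[OF mon])
      qed (simp only: xpow_ind_mon_power[OF fin])
    qed
  qed
  then show ?thesis
    unfolding regular_triangulation_def
    using tri term_order_weight_order[of n \<omega>] by (auto simp: n_def r_def I_def)
qed

section \<open>Regularity of the triangulation into two cells\<close>

context apex_config
begin

lemma length_bip: "length bip = Suc (Suc (length B))"
  by (simp add: bip_def)

lemma exp_degree_bip:
  "exp_degree (Suc d) bip u k =
    (if k < d then (int (Poly_Mapping.lookup u 0) + int (Poly_Mapping.lookup u 1)) * p $ k +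
        (\<Sum>j<length B. int (Poly_Mapping.lookup u (Suc (Suc j))) * (B ! j) $ k)
     else if k = d then int (Poly_Mapping.lookup u 0) - int (Poly_Mapping.lookup u 1) else 0)"
proof -
  have Bc: "B ! j \<in> carrier_vec d" if "j < length B" for j
    using that carrier_B by (auto simp: subset_iff)
  have "(\<Sum>i<length bip. int (Poly_Mapping.lookup u i) * (bip ! i) $ k) =
    int (Poly_Mapping.lookup u 0) * app1 p 1 $ k + int (Poly_Mapping.lookup u 1) * app1 p (-1) $ k +
    (\<Sum>j<length B. int (Poly_Mapping.lookup u (Suc (Suc j))) * flat (B ! j) $ k)"
    unfolding length_bip sum.lessThan_Suc_shift by (simp add: bip_def)
  moreover have "(\<Sum>j<length B. int (Poly_Mapping.lookup u (Suc (Suc j))) * flat (B ! j) $ k) =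
      (\<Sum>j<length B. int (Poly_Mapping.lookup u (Suc (Suc j))) * (if k < d then (B ! j) $ k else 0))"
    if "k < Suc d"
    by (intro sum.cong refl) (use that Bc in \<open>auto simp: index_app1[of _ d]\<close>)
  ultimately show ?thesis
    using p_carrier by (auto simp: exp_degree_def index_app1[of _ d] algebra_simps)
qed

end

context bipyramid_cells
begin

text \<open>The weight of \<open>weight_cells_bip\<close> again, with natural values as
  \<open>weight_order\<close> takes them.\<close>

definition cell_weight :: "nat \<Rightarrow> nat" where
  "cell_weight i = (if i \<in> base then 0 else 1)"

lemma weight_bip:
  "weight (length bip) cell_weight u = Poly_Mapping.lookup u 0 + Poly_Mapping.lookup u 1 +
    (\<Sum>j<length B. if Suc (Suc j) \<in> base then 0 else Poly_Mapping.lookup u (Suc (Suc j)))"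
proof -
  have "(\<Sum>j<length B. cell_weight (Suc (Suc j)) * Poly_Mapping.lookup u (Suc (Suc j))) =
      (\<Sum>j<length B. if Suc (Suc j) \<in> base then 0 else Poly_Mapping.lookup u (Suc (Suc j)))"
    by (intro sum.cong refl) (simp add: cell_weight_def)
  then show ?thesis
    using base_not_apex unfolding weight_def length_bip sum.lessThan_Suc_shift
    by (simp add: cell_weight_def)
qed

definition E_index :: "nat set" where
  "E_index = {j. j < length B \<and> B ! j \<in> E}"

lemma base_iff: "Suc (Suc j) \<in> base \<longleftrightarrow> j \<in> E_index"
  by (auto simp: base_def E_index_def length_bip bip_nth)

lemma bij_E_index: "bij_betw ((!) B) E_index E"
  unfolding bij_betw_def
proof
  show "inj_on ((!) B) E_index"
    using distinct_B by (auto simp: E_index_def inj_on_def nth_eq_iff_index_eq)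
  show "(!) B ` E_index = E"
    using E_subset by (auto simp: E_index_def in_set_conv_nth subset_iff image_iff)
qed

lemma card_base: "card base = card E"
proof -
  have "base = (\<lambda>j. Suc (Suc j)) ` E_index"
  proof (rule Set.set_eqI)
    fix i show "i \<in> base \<longleftrightarrow> i \<in> (\<lambda>j. Suc (Suc j)) ` E_index"
    proof (cases "i = 0 \<or> i = 1")
      case True
      then show ?thesis using base_not_apex by auto
    next
      case False
      then obtain j where "i = Suc (Suc j)" by (metis One_nat_def not0_implies_Suc)
      then show ?thesis using base_iff by auto
    qed
  qed
  then have "card base = card E_index" by (simp add: card_image inj_on_def)
  then show ?thesis using bij_betw_same_card[OF bij_E_index] by simp
qed

lemma base_lessThan: "base \<subseteq> {..<length bip}"
  by (auto simp: base_def)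

lemma max_sets_bip:
  "max_sets {\<tau>. \<tau> \<subseteq> insert 0 base \<or> \<tau> \<subseteq> insert 1 base} = {insert 0 base, insert 1 base}"
  by (rule max_sets_two) (use base_not_apex in auto)

lemma triangulation_bip:
  assumes "card E = d"
  shows "triangulation (Suc d) bip {\<tau>. \<tau> \<subseteq> insert 0 base \<or> \<tau> \<subseteq> insert 1 base}"
  unfolding triangulation_def max_sets_bip
proof (intro conjI ballI)
  show "simplicial_complex (length bip) {\<tau>. \<tau> \<subseteq> insert 0 base \<or> \<tau> \<subseteq> insert 1 base}"
  proof -
    have "insert 0 base \<subseteq> {..<length bip}" "insert 1 base \<subseteq> {..<length bip}"
      using base_lessThan by (auto simp: length_bip)
    then show ?thesis
      unfolding simplicial_complex_def by (auto dest: subset_trans)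
  qed
  have "finite base" using base_lessThan finite_subset by blast
  then show "card \<sigma> = Suc d" if "\<sigma> \<in> {insert 0 base, insert 1 base}" for \<sigma>
    using that base_not_apex card_base assms by auto
qed (rule subdivides_bip)

text \<open>The coefficient of an apex is read off the last coordinate, the others are then determined
  by the independence of \<open>E\<close>.\<close>

lemma exp_degree_inj_on_cell:
  assumes indep: "\<And>c. (\<And>k. k < d \<Longrightarrow> (\<Sum>b\<in>E. c b * b $ k) = (0::int)) \<Longrightarrow> \<forall>b\<in>E. c b = 0"
    and i: "i = 0 \<or> i = 1"
    and u: "Poly_Mapping.keys u \<subseteq> insert i base" and w: "Poly_Mapping.keys w \<subseteq> insert i base"
    and eq: "exp_degree (Suc d) bip u = exp_degree (Suc d) bip w"
  shows "u = w"
proof -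
  define D where "D j = int (Poly_Mapping.lookup u (Suc (Suc j))) - int (Poly_Mapping.lookup w (Suc (Suc j)))" for j
  have off: "Poly_Mapping.lookup u x = 0" "Poly_Mapping.lookup w x = 0" if "x \<notin> insert i base" for x
    using that u w by (auto simp: not_in_keys_iff_lookup_eq_zero[symmetric])
  \<comment> \<open>\<open>1 - i\<close> is the index of the opposite apex, so the last coordinate
    of the degree is the exponent of the apex \<open>i\<close> up to sign.\<close>
  have other: "Poly_Mapping.lookup u (1 - i) = 0" "Poly_Mapping.lookup w (1 - i) = 0"
    using off[of "1 - i"] i base_not_apex by auto
  have apex: "Poly_Mapping.lookup u 0 = Poly_Mapping.lookup w 0 \<and>
      Poly_Mapping.lookup u 1 = Poly_Mapping.lookup w 1"
    using fun_cong[OF eq, of d] other i unfolding exp_degree_bip by auto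
  have D0: "D j = 0" if "j \<notin> E_index" for j
    using off[of "Suc (Suc j)"] that base_iff i by (auto simp: D_def)
  have sum0: "(\<Sum>b\<in>E. D (inv_into E_index ((!) B) b) * b $ k) = 0" if k: "k < d" for k
  proof -
    have "(\<Sum>b\<in>E. D (inv_into E_index ((!) B) b) * b $ k) =
        (\<Sum>j\<in>E_index. D (inv_into E_index ((!) B) (B ! j)) * (B ! j) $ k)"
      using sum.reindex_bij_betw[OF bij_E_index, of "\<lambda>b. D (inv_into E_index ((!) B) b) * b $ k"] by simp
    also have "\<dots> = (\<Sum>j\<in>E_index. D j * (B ! j) $ k)"
      using bij_E_index by (intro sum.cong refl) (simp add: bij_betw_def inv_into_f_f)
    also have "\<dots> = (\<Sum>j<length B. D j * (B ! j) $ k)"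
      by (rule sum.mono_neutral_left) (auto simp: E_index_def D0)
    also have "\<dots> = 0"
      using fun_cong[OF eq, of k] k apex
      by (simp add: exp_degree_bip D_def left_diff_distrib sum_subtractf)
    finally show ?thesis .
  qed
  have DE: "D j = 0" if "j \<in> E_index" for j
  proof -
    have "B ! j \<in> E" using that by (simp add: E_index_def)
    then have "D (inv_into E_index ((!) B) (B ! j)) = 0" using indep[OF sum0] by blast
    then show ?thesis using bij_E_index that by (simp add: bij_betw_def inv_into_f_f)
  qed
  show ?thesis
  proof (rule poly_mapping_eqI)
    fix x
    show "Poly_Mapping.lookup u x = Poly_Mapping.lookup w x"
    proof (cases "x = 0 \<or> x = 1")
      case True
      then show ?thesis using apex by auto
    next
      case False
      then obtain j where "x = Suc (Suc j)" by (metis One_nat_def not0_implies_Suc)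
      then show ?thesis using D0[of j] DE[of j] by (auto simp: D_def)
    qed
  qed
qed

text \<open>On a cell the weight is the exponent of its apex, that is, the absolute value of the
  height. Any \<open>w\<close> of the same height weighs at least as much, with equality only if it
  avoids the opposite apex and the base vectors outside \<open>E\<close>. Then \<open>w\<close>
  lives on the same cell, where the degree determines the monomial.\<close>

lemma weight_less_off_cell:
  assumes indep: "\<And>c. (\<And>k. k < d \<Longrightarrow> (\<Sum>b\<in>E. c b * b $ k) = (0::int)) \<Longrightarrow> \<forall>b\<in>E. c b = 0"
    and i: "i = 0 \<or> i = 1" and w: "w \<in> monomials (length bip)"
    and u: "Poly_Mapping.keys u \<subseteq> insert i base"
    and eq: "exp_degree (Suc d) bip u = exp_degree (Suc d) bip w" and "u \<noteq> w"
  shows "weight (length bip) cell_weight u < weight (length bip) cell_weight w"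
proof (rule ccontr)
  assume "\<not> weight (length bip) cell_weight u < weight (length bip) cell_weight w"
  then have le: "weight (length bip) cell_weight w \<le> weight (length bip) cell_weight u" by simp
  have off: "Poly_Mapping.lookup u x = 0" if "x \<notin> insert i base" for x
    using that u by (auto simp: not_in_keys_iff_lookup_eq_zero[symmetric])
  have "(\<Sum>j<length B. if Suc (Suc j) \<in> base then 0 else Poly_Mapping.lookup u (Suc (Suc j))) = 0"
    using off i by (intro sum.neutral) auto
  then have wu: "weight (length bip) cell_weight u = Poly_Mapping.lookup u 0 + Poly_Mapping.lookup u 1"
    unfolding weight_bip by simp
  have other: "Poly_Mapping.lookup u (1 - i) = 0"
    using off[of "1 - i"] i base_not_apex by auto
  have last: "int (Poly_Mapping.lookup u 0) - int (Poly_Mapping.lookup u 1) =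
      int (Poly_Mapping.lookup w 0) - int (Poly_Mapping.lookup w 1)"
    using fun_cong[OF eq, of d] by (simp add: exp_degree_bip)
  define rest where
    "rest = (\<Sum>j<length B. if Suc (Suc j) \<in> base then 0 else Poly_Mapping.lookup w (Suc (Suc j)))"
  have "Poly_Mapping.lookup w 0 + Poly_Mapping.lookup w 1 + rest \<le>
      Poly_Mapping.lookup u 0 + Poly_Mapping.lookup u 1"
    using le unfolding wu unfolding weight_bip rest_def .
  then have w1: "Poly_Mapping.lookup w (1 - i) = 0" and "rest = 0"
    using last other i by auto
  from \<open>rest = 0\<close> have "\<forall>j\<in>{..<length B}. (if Suc (Suc j) \<in> base then 0 else Poly_Mapping.lookup w (Suc (Suc j))) = 0"
    unfolding rest_def by (subst (asm) sum_eq_0_iff) simp_all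
  then have w2: "Poly_Mapping.lookup w (Suc (Suc j)) = 0" if "j < length B" "Suc (Suc j) \<notin> base" for j
    using that by (auto dest: bspec[of _ _ j])
  have "Poly_Mapping.keys w \<subseteq> insert i base"
  proof
    fix x assume x: "x \<in> Poly_Mapping.keys w"
    then have "x < length bip" using w by (auto simp: monomials_def)
    show "x \<in> insert i base"
    proof (cases "x = 0 \<or> x = 1")
      case True
      then show ?thesis using x w1 i by (auto simp: in_keys_iff)
    next
      case False
      then obtain j where j: "x = Suc (Suc j)" by (metis One_nat_def not0_implies_Suc)
      then show ?thesis using w2[of j] x \<open>x < length bip\<close> by (auto simp: in_keys_iff length_bip)
    qed
  qed
  then show False using exp_degree_inj_on_cell[OF indep i u _ eq] \<open>u \<noteq> w\<close> by blast
qed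

text \<open>The variables of \<open>E\<close> have weight 0, so points of the semigroup of
  \<open>E\<close> are degrees of weightless monomials. These are the lighter terms of the binomials
  for the non-faces.\<close>

lemma base_monomial:
  assumes a: "a \<in> N_span d E"
  obtains v where "v \<in> monomials (length bip)" "weight (length bip) cell_weight v = 0"
    "exp_degree (Suc d) bip v = (\<lambda>k. if k < d then a $ k else 0)"
proof -
  obtain c :: "int vec \<Rightarrow> nat" where c: "a = vec d (\<lambda>k. \<Sum>b\<in>E. int (c b) * b $ k)"
    using a unfolding N_span_def by blast
  define v where "v = (\<Sum>j\<in>E_index. Poly_Mapping.single (Suc (Suc j)) (c (B ! j)))"
  have fin: "finite E_index" by (simp add: E_index_def)
  have v: "Poly_Mapping.lookup v (Suc (Suc j)) = (if j \<in> E_index then c (B ! j) else 0)"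
    "Poly_Mapping.lookup v 0 = 0" "Poly_Mapping.lookup v 1 = 0" for j
    using fin by (simp_all add: v_def lookup_sum lookup_single when_def)
  show thesis
  proof
    show "v \<in> monomials (length bip)"
      unfolding monomials_def
    proof (intro CollectI subsetI)
      fix x assume x: "x \<in> Poly_Mapping.keys v"
      then have "x \<noteq> 0" "x \<noteq> 1" using v(2,3) by (metis in_keys_iff)+
      then obtain j where j: "x = Suc (Suc j)" by (metis One_nat_def not0_implies_Suc)
      then have "j \<in> E_index" using x v(1)[of j] by (auto simp: in_keys_iff split: if_splits)
      then show "x \<in> {..<length bip}" using j by (simp add: E_index_def length_bip)
    qed
    show "weight (length bip) cell_weight v = 0"
      unfolding weight_bip base_iff using v by (auto intro: sum.neutral)
    show "exp_degree (Suc d) bip v = (\<lambda>k. if k < d then a $ k else 0)"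
    proof
      fix k
      have "(\<Sum>j<length B. int (Poly_Mapping.lookup v (Suc (Suc j))) * (B ! j) $ k) =
          (\<Sum>j\<in>E_index. int (c (B ! j)) * (B ! j) $ k)"
        by (rule sum.mono_neutral_cong_right) (auto simp: v E_index_def)
      also have "\<dots> = (\<Sum>b\<in>E. int (c b) * b $ k)"
        by (rule sum.reindex_bij_betw[OF bij_E_index])
      finally show "exp_degree (Suc d) bip v k = (if k < d then a $ k else 0)"
        unfolding exp_degree_bip using v by (simp add: c)
    qed
  qed
qed

text \<open>A non-face contains a base vector outside \<open>E\<close> or both apexes. In the first
  case the \<open>m\<close>-th power of its variable is compared with a weightless monomial. In the
  second the \<open>m\<close>-th powers of both apex variables multiply to degree
  \<open>2 m p\<close>, which is also the degree of the square of a weightless monomial of degree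
  \<open>m p\<close>.\<close>

lemma nonface_binomial:
  fixes m :: nat
  assumes m: "0 < m" "\<And>a. a \<in> carrier_vec d \<Longrightarrow> rvec a \<in> icone d (set B) \<Longrightarrow> int m \<cdot>\<^sub>v a \<in> N_span d E"
    and \<tau>: "\<tau> \<subseteq> {..<length bip}" "\<not> (\<tau> \<subseteq> insert 0 base \<or> \<tau> \<subseteq> insert 1 base)"
  shows "\<exists>u\<in>monomials (length bip). \<exists>v\<in>monomials (length bip). Poly_Mapping.keys u \<subseteq> \<tau> \<and>
    exp_degree (Suc d) bip u = exp_degree (Suc d) bip v \<and>
    weight (length bip) cell_weight v < weight (length bip) cell_weight u"
proof -
  have "(\<exists>j. Suc (Suc j) \<in> \<tau> \<and> Suc (Suc j) \<notin> base) \<or> (0 \<in> \<tau> \<and> 1 \<in> \<tau>)"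
  proof -
    obtain x y where x: "x \<in> \<tau>" "x \<notin> base" "x \<noteq> 0" and y: "y \<in> \<tau>" "y \<notin> base" "y \<noteq> 1"
      using \<tau>(2) by blast
    show ?thesis
    proof (cases "x = 1 \<and> y = 0")
      case True
      then show ?thesis using x y by auto
    next
      case False
      then obtain z where "z \<in> \<tau>" "z \<notin> base" "z \<noteq> 0" "z \<noteq> 1" using x y by auto
      then show ?thesis by (metis One_nat_def not0_implies_Suc)
    qed
  qed
  then show ?thesis
  proof
    assume "\<exists>j. Suc (Suc j) \<in> \<tau> \<and> Suc (Suc j) \<notin> base"
    then obtain j where j: "Suc (Suc j) \<in> \<tau>" "Suc (Suc j) \<notin> base" by blast
    then have jB: "j < length B" using \<tau>(1) by (auto simp: length_bip)
    then have Bj: "B ! j \<in> carrier_vec d" "rvec (B ! j) \<in> icone d (set B)"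
      using carrier_B icone_superset[OF _ carrier_B, of "B ! j"] by (auto simp: subset_iff)
    obtain v where v: "v \<in> monomials (length bip)" "weight (length bip) cell_weight v = 0"
        "exp_degree (Suc d) bip v = (\<lambda>k. if k < d then (int m \<cdot>\<^sub>v (B ! j)) $ k else 0)"
      using base_monomial[OF m(2)[OF Bj]] by blast
    define u where "u = Poly_Mapping.single (Suc (Suc j)) m"
    have lu: "Poly_Mapping.lookup u (Suc (Suc i)) = (if i = j then m else 0)"
      "Poly_Mapping.lookup u 0 = 0" "Poly_Mapping.lookup u 1 = 0" for i
      by (simp_all add: u_def lookup_single when_def)
    have "exp_degree (Suc d) bip u = exp_degree (Suc d) bip v"
    proof
      fix k
      have "(\<Sum>i<length B. int (Poly_Mapping.lookup u (Suc (Suc i))) * (B ! i) $ k) =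
          (\<Sum>i<length B. if i = j then int m * (B ! j) $ k else 0)"
        by (intro sum.cong refl) (auto simp: lu)
      then show "exp_degree (Suc d) bip u k = exp_degree (Suc d) bip v k"
        unfolding v(3) exp_degree_bip using jB Bj(1) lu(2,3) by (simp add: sum.delta)
    qed
    moreover have "weight (length bip) cell_weight u = m"
    proof -
      have "(\<Sum>i<length B. if Suc (Suc i) \<in> base then 0 else Poly_Mapping.lookup u (Suc (Suc i))) =
          (\<Sum>i<length B. if i = j then m else 0)"
        by (intro sum.cong refl) (use j in \<open>auto simp: lu\<close>)
      then show ?thesis unfolding weight_bip using jB lu(2,3) by (simp add: sum.delta)
    qed
    moreover have "Poly_Mapping.keys u \<subseteq> \<tau>" "u \<in> monomials (length bip)"
      using j jB m(1) by (auto simp: u_def monomials_def length_bip)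
    ultimately show ?thesis using v(1,2) m(1) by (intro bexI[of _ u] bexI[of _ v]) auto
  next
    assume both: "0 \<in> \<tau> \<and> 1 \<in> \<tau>"
    obtain v where v: "v \<in> monomials (length bip)" "weight (length bip) cell_weight v = 0"
        "exp_degree (Suc d) bip v = (\<lambda>k. if k < d then (int m \<cdot>\<^sub>v p) $ k else 0)"
      using base_monomial[OF m(2)[OF p_carrier p_in_cone]] by blast
    define u where "u = Poly_Mapping.single 0 m + Poly_Mapping.single (1::nat) m"
    have lu: "Poly_Mapping.lookup u (Suc (Suc i)) = 0"
      "Poly_Mapping.lookup u 0 = m" "Poly_Mapping.lookup u 1 = m" for i
      by (simp_all add: u_def lookup_add lookup_single when_def)
    have "exp_degree (Suc d) bip u = exp_degree (Suc d) bip (v + v)"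
      unfolding exp_degree_add v(3) using p_carrier
      by (auto simp: exp_degree_bip lu lu(3)[simplified] fun_eq_iff)
    moreover have "weight (length bip) cell_weight u = m + m"
      unfolding weight_bip lu by simp
    moreover have "weight (length bip) cell_weight (v + v) = 0"
      unfolding weight_add v(2) by simp
    moreover have "Poly_Mapping.keys u \<subseteq> \<tau>"
      using both m(1) by (auto simp: u_def keys_add_nat)
    moreover have "u \<in> monomials (length bip)"
      using m(1) by (auto simp: u_def monomials_def keys_add_nat length_bip)
    moreover have "v + v \<in> monomials (length bip)" using v(1) by (simp add: monomials_add)
    ultimately show ?thesis using m(1) by (intro bexI[of _ u] bexI[of _ "v + v"]) auto
  qed
qed

lemma regular_triangulation_bip:
  fixes m :: nat
  assumes indep: "\<And>c. (\<And>k. k < d \<Longrightarrow> (\<Sum>b\<in>E. c b * b $ k) = (0::int)) \<Longrightarrow> \<forall>b\<in>E. c b = 0"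
    and m: "0 < m" "\<And>a. a \<in> carrier_vec d \<Longrightarrow> rvec a \<in> icone d (set B) \<Longrightarrow> int m \<cdot>\<^sub>v a \<in> N_span d E"
    and card: "card E = d"
  shows "regular_triangulation TYPE('k::field) (Suc d) bip {\<tau>. \<tau> \<subseteq> insert 0 base \<or> \<tau> \<subseteq> insert 1 base}"
proof (rule regular_triangulation_weight[OF triangulation_bip[OF card],
      where M = "{insert 0 base, insert 1 base}" and \<omega> = cell_weight])
  show "\<sigma> \<subseteq> {..<length bip}" if "\<sigma> \<in> {insert 0 base, insert 1 base}" for \<sigma>
    using that base_lessThan by (auto simp: length_bip)
  show "weight (length bip) cell_weight u < weight (length bip) cell_weight w"
    if "\<sigma> \<in> {insert 0 base, insert 1 base}" "u \<in> monomials (length bip)" "w \<in> monomials (length bip)"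
      "Poly_Mapping.keys u \<subseteq> \<sigma>" "exp_degree (Suc d) bip u = exp_degree (Suc d) bip w" "u \<noteq> w" for \<sigma> u w
    using weight_less_off_cell[OF indep _ that(3) _ that(5,6)] that(1,4) by blast
  show "\<exists>u\<in>monomials (length bip). \<exists>v\<in>monomials (length bip). Poly_Mapping.keys u \<subseteq> \<tau> \<and>
      exp_degree (Suc d) bip u = exp_degree (Suc d) bip v \<and>
      weight (length bip) cell_weight v < weight (length bip) cell_weight u"
    if "\<tau> \<subseteq> {..<length bip}" "\<tau> \<notin> {\<tau>. \<tau> \<subseteq> insert 0 base \<or> \<tau> \<subseteq> insert 1 base}" for \<tau>
    using nonface_binomial[OF m that(1)] that(2) by blast
qed auto

end

section \<open>Firla--Ziegler configurations\<close>

lemma less_3_cases: "i < (3::nat) \<longleftrightarrow> i = 0 \<or> i = 1 \<or> i = 2"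
  by auto

text \<open>The system is triangular: the last coordinate is due to \<open>z\<close> alone, and once
  the coefficient of \<open>z\<close> is chosen, those of the unit vectors are read off.\<close>

lemma (in coefficients) gspan_unit_vecs_insert:
  fixes z :: "'a vec"
  assumes z: "z \<in> carrier_vec 4"
  shows "x \<in> gspan P 4 {unit_vec 4 0, unit_vec 4 1, unit_vec 4 2, z} \<longleftrightarrow>
    x \<in> carrier_vec 4 \<and> (\<exists>w\<in>P. x $ 3 = w * z $ 3 \<and> (\<forall>i<3. x $ i - w * z $ i \<in> P))"
    (is "_ \<in> gspan P 4 ?S \<longleftrightarrow> ?R")
proof
  note ins = gspan_insert[of "{unit_vec 4 1, unit_vec 4 2, z}" 4 "unit_vec 4 0"]
    gspan_insert[of "{unit_vec 4 2, z}" 4 "unit_vec 4 1"] gspan_insert[of "{z}" 4 "unit_vec 4 2"]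
  assume "x \<in> gspan P 4 ?S"
  then obtain s y1 where 1: "s \<in> P" "y1 \<in> gspan P 4 {unit_vec 4 1, unit_vec 4 2, z}"
      "x = s \<cdot>\<^sub>v unit_vec 4 0 + y1"
    using ins(1)[of x] z by auto
  then obtain t y2 where 2: "t \<in> P" "y2 \<in> gspan P 4 {unit_vec 4 2, z}" "y1 = t \<cdot>\<^sub>v unit_vec 4 1 + y2"
    using ins(2)[of y1] z by auto
  then obtain u y3 where 3: "u \<in> P" "y3 \<in> gspan P 4 {z}" "y2 = u \<cdot>\<^sub>v unit_vec 4 2 + y3"
    using ins(3)[of y2] z by auto
  then obtain w where 4: "w \<in> P" "y3 = w \<cdot>\<^sub>v z"
    using gspan_singleton[OF z, of y3] by blast
  have x: "x = s \<cdot>\<^sub>v unit_vec 4 0 + (t \<cdot>\<^sub>v unit_vec 4 1 + (u \<cdot>\<^sub>v unit_vec 4 2 + w \<cdot>\<^sub>v z))"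
    using 1(3) 2(3) 3(3) 4(2) by simp
  have "x $ i - w * z $ i \<in> P" if "i < 3" for i
    using that 1(1) 2(1) 3(1) z unfolding x by (auto simp: less_3_cases)
  moreover have "x $ 3 = w * z $ 3" "x \<in> carrier_vec 4" using z unfolding x by simp_all
  ultimately show ?R using 4(1) by blast
next
  assume ?R
  then obtain w where x: "x \<in> carrier_vec 4" and w: "w \<in> P" "x $ 3 = w * z $ 3"
    "\<And>i. i < 3 \<Longrightarrow> x $ i - w * z $ i \<in> P" by blast
  let ?y = "(x $ 0 - w * z $ 0) \<cdot>\<^sub>v unit_vec 4 0 + ((x $ 1 - w * z $ 1) \<cdot>\<^sub>v unit_vec 4 1 +
      ((x $ 2 - w * z $ 2) \<cdot>\<^sub>v unit_vec 4 2 + w \<cdot>\<^sub>v z))"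
  have "x = ?y"
  proof (rule eq_vecI)
    fix i assume "i < dim_vec ?y"
    then have "i = 0 \<or> i = 1 \<or> i = 2 \<or> i = 3" using z by auto
    then show "x $ i = ?y $ i" using z w(2) by auto
  qed (use x z in simp)
  moreover have "?S \<subseteq> gspan P 4 ?S"
    by (rule gspan_superset) (use z in auto)
  then have "?y \<in> gspan P 4 ?S"
    using w(1) w(3)[of 0] w(3)[of 1] w(3)[of 2] by (intro gspan_add gspan_smult) auto
  ultimately show "x \<in> gspan P 4 ?S" by simp
qed

lemma rvec_unit_vec: "rvec (unit_vec n i) = unit_vec n i"
  by (intro eq_vecI) (auto simp: unit_vec_def)

locale firla_ziegler_config =
  fixes A :: "int vec list" and v :: "int vec"
  assumes fz: "firla_ziegler A v"
begin

lemma v: "v \<in> carrier_vec 4" "0 < v $ 0" "v $ 0 < v $ 1" "v $ 1 < v $ 2" "v $ 2 < v $ 3"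
  using fz by (auto simp: firla_ziegler_def)

lemma v_less: "i < 3 \<Longrightarrow> 0 < v $ i \<and> v $ i < v $ 3"
  using v by (auto simp: less_3_cases)

lemma A: "distinct A" "set A \<subseteq> carrier_vec 4" "A_ext v \<subseteq> set A"
  "N_span 4 (set A) = {x \<in> carrier_vec 4. rvec x \<in> icone 4 (A_ext v)}"
  using fz by (auto simp: firla_ziegler_def minimal_hilbert_basis_def hilbert_basis_def)

text \<open>The triangular system gives \<open>v\<close> the coefficient
  \<open>x $ 3 / v $ 3\<close>. With the denominator cleared, the sign conditions on the four
  coefficients are the facet inequalities of the simplicial cone.\<close>

lemma icone_A_ext:
  "x \<in> icone 4 (A_ext v) \<longleftrightarrow>
    x \<in> carrier_vec 4 \<and> 0 \<le> x $ 3 \<and> (\<forall>i<3. v $ i * x $ 3 \<le> v $ 3 * x $ i)"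
proof -
  have v3: "0 < real_of_int (v $ 3)" using v by simp
  have r: "rvec ` A_ext v = {unit_vec 4 0, unit_vec 4 1, unit_vec 4 2, rvec v}"
    by (simp add: A_ext_def rvec_unit_vec)
  have vi: "rvec v $ i = real_of_int (v $ i)" if "i < 4" for i
    using that v(1) by simp
  have "(\<exists>w\<in>{0..}. x $ 3 = w * rvec v $ 3 \<and> (\<forall>i<3. x $ i - w * rvec v $ i \<in> {0..})) \<longleftrightarrow>
      0 \<le> x $ 3 \<and> (\<forall>i<3. v $ i * x $ 3 \<le> v $ 3 * x $ i)" (is "?L \<longleftrightarrow> ?R")
  proof
    assume ?L
    then obtain w where w: "w \<in> {0..}" "x $ 3 = w * rvec v $ 3" "\<forall>i<3. x $ i - w * rvec v $ i \<in> {0..}"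
      by (elim bexE conjE)
    then have w: "0 \<le> w" "x $ 3 = w * v $ 3" "\<And>i. i < 3 \<Longrightarrow> w * v $ i \<le> x $ i"
      using vi by simp_all
    have "v $ i * x $ 3 \<le> v $ 3 * x $ i" if "i < 3" for i
      using mult_left_mono[OF w(3)[OF that], of "v $ 3"] v3 unfolding w(2) by (simp add: ac_simps)
    then show ?R using w(1,2) v3 by simp
  next
    assume R: ?R
    show ?L
    proof (intro bexI[of _ "x $ 3 / v $ 3"] conjI allI impI)
      fix i :: nat assume i: "i < 3"
      then show "x $ i - x $ 3 / v $ 3 * rvec v $ i \<in> {0..}"
        using R v3 vi[of i] by (auto simp: field_simps)
    qed (use R v3 vi in auto)
  qed
  then show ?thesis
    unfolding cone_eq_gspan r
    using real_nonneg.gspan_unit_vecs_insert[of "rvec v" x] v(1) by simp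
qed

lemma rvec_A_ext:
  assumes "a \<in> carrier_vec 4"
  shows "rvec a \<in> icone 4 (A_ext v) \<longleftrightarrow> 0 \<le> a $ 3 \<and> (\<forall>i<3. v $ i * a $ 3 \<le> v $ 3 * a $ i)"
proof -
  have "real_of_int (v $ i) * rvec a $ 3 \<le> real_of_int (v $ 3) * rvec a $ i \<longleftrightarrow>
      v $ i * a $ 3 \<le> v $ 3 * a $ i" if "i < 3" for i
    using assms that by (simp flip: of_int_mult)
  then show ?thesis unfolding icone_A_ext using assms by auto
qed

lemma A_ext_carrier: "finite (A_ext v)" "A_ext v \<subseteq> carrier_vec 4"
  using A(2,3) by (auto simp: A_ext_def)

lemma icone_A: "icone 4 (A_ext v) = icone 4 (set A)"
proof
  show "icone 4 (A_ext v) \<subseteq> icone 4 (set A)"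
    by (rule icone_mono[OF A(3)]) simp
  have "set A \<subseteq> N_span 4 (set A)"
    unfolding N_span_eq_gspan by (rule int_nonneg.gspan_superset[OF _ A(2)]) simp
  then show "icone 4 (set A) \<subseteq> icone 4 (A_ext v)"
    unfolding A(4) by (intro icone_least) auto
qed

text \<open>The coefficients of a lattice point with respect to \<open>A_ext v\<close> have
  denominator \<open>v $ 3\<close>. After multiplication by it, the coefficient of \<open>v\<close>
  is the integer \<open>a $ 3\<close>.\<close>

lemma mult_mem_N_span:
  assumes "a \<in> carrier_vec 4" "rvec a \<in> icone 4 (set A)"
  shows "int (nat (v $ 3)) \<cdot>\<^sub>v a \<in> N_span 4 (A_ext v)"
proof -
  have a: "0 \<le> a $ 3" "\<And>i. i < 3 \<Longrightarrow> v $ i * a $ 3 \<le> v $ 3 * a $ i"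
    using assms rvec_A_ext unfolding icone_A[symmetric] by auto
  have v3: "int (nat (v $ 3)) = v $ 3" using v by simp
  have "\<exists>w\<in>{0..}. (v $ 3 \<cdot>\<^sub>v a) $ 3 = w * v $ 3 \<and> (\<forall>i<3. (v $ 3 \<cdot>\<^sub>v a) $ i - w * v $ i \<in> {0..})"
    by (rule bexI[of _ "a $ 3"]) (use a assms(1) in \<open>auto simp: mult.commute\<close>)
  then show ?thesis
    using int_nonneg.gspan_unit_vecs_insert[OF v(1), of "v $ 3 \<cdot>\<^sub>v a"] assms(1)
    unfolding v3 N_span_eq_gspan A_ext_def by simp
qed

lemma A_ext_distinct:
  "unit_vec 4 0 \<noteq> (unit_vec 4 1 :: int vec)" "unit_vec 4 0 \<noteq> (unit_vec 4 2 :: int vec)"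
  "unit_vec 4 1 \<noteq> (unit_vec 4 2 :: int vec)" "i < 3 \<Longrightarrow> unit_vec 4 i \<noteq> v"
proof -
  show "unit_vec 4 i \<noteq> v" if "i < 3"
  proof
    assume "unit_vec 4 i = v"
    then have "v $ 3 = unit_vec 4 i $ 3" by simp
    then show False using v that by simp
  qed
  have "unit_vec 4 i \<noteq> (unit_vec 4 j :: int vec)" if "i < 4" "j < 4" "i \<noteq> j" for i j
  proof
    assume "unit_vec 4 i = (unit_vec 4 j :: int vec)"
    then have "unit_vec 4 i $ i = (unit_vec 4 j $ i :: int)" by simp
    then show False using that by simp
  qed
  then show "unit_vec 4 0 \<noteq> (unit_vec 4 1 :: int vec)" "unit_vec 4 0 \<noteq> (unit_vec 4 2 :: int vec)"
    "unit_vec 4 1 \<noteq> (unit_vec 4 2 :: int vec)" by simp_all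
qed

lemma card_A_ext: "card (A_ext v) = 4"
  using A_ext_distinct(1-3) A_ext_distinct(4)[of 0] A_ext_distinct(4)[of 1] A_ext_distinct(4)[of 2]
  by (simp add: A_ext_def)

lemma A_ext_independent:
  fixes c :: "int vec \<Rightarrow> int"
  assumes "\<And>k. k < 4 \<Longrightarrow> (\<Sum>b\<in>A_ext v. c b * b $ k) = 0"
  shows "\<forall>b\<in>A_ext v. c b = 0"
proof -
  have eq: "c (unit_vec 4 0) * unit_vec 4 0 $ k + (c (unit_vec 4 1) * unit_vec 4 1 $ k +
      (c (unit_vec 4 2) * unit_vec 4 2 $ k + c v * v $ k)) = 0" if "k < 4" for k
    using assms[OF that] A_ext_distinct(1-3) A_ext_distinct(4)[of 0] A_ext_distinct(4)[of 1]
      A_ext_distinct(4)[of 2] by (simp add: A_ext_def)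
  have "c v = 0" using eq[of 3] v by simp
  then show ?thesis
    using eq[of 0] eq[of 1] eq[of 2] by (simp add: A_ext_def)
qed

lemma vec4_eqI:
  assumes "x \<in> carrier_vec 4" "y \<in> carrier_vec 4" "x $ 3 = y $ 3" "\<And>i. i < 3 \<Longrightarrow> x $ i = y $ i"
  shows "x = y"
proof (rule eq_vecI)
  fix i assume "i < dim_vec y"
  then have "i < 3 \<or> i = 3" using assms(2) by auto
  then show "x $ i = y $ i" using assms(3,4) by auto
qed (use assms in simp)

text \<open>A facet inequality that is an equality at \<open>b\<close> is an equality at both
  summands. For a unit vector this makes all other entries of \<open>x\<close> vanish; for
  \<open>v\<close> it makes the entries of \<open>x\<close> proportional to those of
  \<open>v\<close>.\<close>

lemma A_ext_extreme:
  assumes b: "b \<in> A_ext v"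
  shows "b \<in> extreme_generators 4 A"
proof -
  have v3: "0 < real_of_int (v $ 3)" using v by simp
  have bc: "b \<in> carrier_vec 4" using b A_ext_carrier by blast
  have key: "x \<in> icone 4 {b}"
    if x: "x \<in> icone 4 (set A)" and y: "y \<in> icone 4 (set A)" and eq: "x + y = rvec b" for x y
  proof -
    have xc: "x \<in> carrier_vec 4" "0 \<le> x $ 3" "\<And>i. i < 3 \<Longrightarrow> v $ i * x $ 3 \<le> v $ 3 * x $ i"
      and yc: "y \<in> carrier_vec 4" "0 \<le> y $ 3" "\<And>i. i < 3 \<Longrightarrow> v $ i * y $ 3 \<le> v $ 3 * y $ i"
      using x y unfolding icone_A[symmetric] icone_A_ext by auto
    have idx: "x $ i + y $ i = b $ i" if "i < 4" for i
      using arg_cong[OF eq, of "\<lambda>x. x $ i"] that xc(1) yc(1) bc by simp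
    consider j where "j < 3" "b = unit_vec 4 j" | "b = v"
      using b by (auto simp: A_ext_def)
    then show ?thesis
    proof cases
      case 1
      have 0: "x $ 3 = 0" "y $ 3 = 0" using idx[of 3] 1 xc(2) yc(2) by auto
      have nn: "0 \<le> x $ i" "0 \<le> y $ i" if "i < 3" for i
        using xc(3)[OF that] yc(3)[OF that] v3 unfolding 0 by (simp_all add: zero_le_mult_iff)
      have "x = x $ j \<cdot>\<^sub>v rvec b"
      proof (rule vec4_eqI)
        show "x $ 3 = (x $ j \<cdot>\<^sub>v rvec b) $ 3" using 1 0 by simp
        show "x $ i = (x $ j \<cdot>\<^sub>v rvec b) $ i" if "i < 3" for i
          using idx[of i] nn[OF that] 1 that by (cases "i = j") auto
      qed (use xc bc in auto)
      then show ?thesis unfolding icone_singleton[OF bc] using nn(1)[OF 1(1)] by blast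
    next
      case 2
      have "x = (x $ 3 / v $ 3) \<cdot>\<^sub>v rvec b"
      proof (rule vec4_eqI)
        show "x $ 3 = ((x $ 3 / v $ 3) \<cdot>\<^sub>v rvec b) $ 3" using 2 v(1) v3 by simp
        show "x $ i = ((x $ 3 / v $ 3) \<cdot>\<^sub>v rvec b) $ i" if i: "i < 3" for i
        proof -
          have y: "y $ i = v $ i - x $ i" "y $ 3 = v $ 3 - x $ 3"
            using idx[of i] idx[of 3] i unfolding 2 by auto
          have "v $ 3 * x $ i = v $ i * x $ 3"
            using xc(3)[OF i] yc(3)[OF i] unfolding y by (simp add: algebra_simps)
          then show ?thesis using 2 v(1) v3 i by (simp add: field_simps)
        qed
      qed (use xc bc in auto)
      then show ?thesis unfolding icone_singleton[OF bc] using xc(2) v3 by (meson divide_nonneg_pos)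
    qed
  qed
  have "x \<in> icone 4 {b} \<and> y \<in> icone 4 {b}"
    if x: "x \<in> icone 4 (set A)" and y: "y \<in> icone 4 (set A)" and eq: "x + y = rvec b" for x y
    using key[OF x y eq] key[OF y x] eq icone_carrier[OF x] icone_carrier[OF y]
    by (metis comm_add_vec)
  moreover have "b \<noteq> 0\<^sub>v 4"
  proof
    assume "b = 0\<^sub>v 4"
    then have "b $ 0 = 0" "b $ 1 = 0" "b $ 2 = 0" by simp_all
    then show False using b v by (auto simp: A_ext_def)
  qed
  ultimately show ?thesis using b A(3) by (auto simp: extreme_generators_def)
qed

text \<open>The start of the induction. The point \<open>p\<close> is interior to the cone because
  \<open>v $ i < v $ 3\<close> makes the facet inequalities strict at it.\<close>

lemma apex_config_A: "apex_config 4 A (p_mid 4)"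
proof
  have pk: "p_mid 4 $ k = 1" if "k < 4" for k using that by (simp add: p_mid_index)
  have pc: "rvec (p_mid 4) \<in> icone 4 (A_ext v)"
    using rvec_A_ext[of "p_mid 4"] pk v_less by (auto simp: less_imp_le)
  show "distinct A" "set A \<subseteq> carrier_vec 4" by (fact A)+
  show "p_mid 4 \<in> carrier_vec 4" by simp
  show "p_mid 4 \<noteq> 0\<^sub>v 4" using pk[of 0] by (metis index_zero_vec(1) zero_less_numeral zero_neq_one)
  show "rvec (p_mid 4) \<in> icone 4 (set A)" using pc icone_A by simp
  show "N_span 4 (set A) = {x \<in> carrier_vec 4. rvec x \<in> icone 4 (set A)}"
    using A(4) icone_A by simp
  have memZ: "a \<in> Z_span 4 (set A)" if "a \<in> set A" for a
    using int_all.gspan_superset[OF _ A(2)] that unfolding Z_span_eq_gspan by auto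
  have "p_mid 4 \<in> N_span 4 (set A)" unfolding A(4) using pc by simp
  then obtain c :: "int vec \<Rightarrow> nat" where "p_mid 4 = vec 4 (\<lambda>k. \<Sum>s\<in>set A. int (c s) * s $ k)"
    unfolding N_span_def by blast
  then have pZ: "p_mid 4 \<in> Z_span 4 (set A)"
    unfolding Z_span_def by (intro CollectI exI[of _ "\<lambda>s. int (c s)"]) simp
  have "x \<in> Z_span 4 (set A)" if x: "x \<in> carrier_vec 4" for x
  proof -
    \<comment> \<open>The last entry of \<open>p\<close> is 1, so the three unit vectors and
      \<open>p\<close> form a basis of the lattice.\<close>
    have "x = (x $ 0 - x $ 3) \<cdot>\<^sub>v unit_vec 4 0 + ((x $ 1 - x $ 3) \<cdot>\<^sub>v unit_vec 4 1 +
        ((x $ 2 - x $ 3) \<cdot>\<^sub>v unit_vec 4 2 + x $ 3 \<cdot>\<^sub>v p_mid 4))"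
      by (rule vec4_eqI) (use x in \<open>auto simp: less_3_cases p_mid_index\<close>)
    moreover have "\<dots> \<in> Z_span 4 (set A)"
      using pZ memZ A(3) unfolding Z_span_eq_gspan A_ext_def
      by (intro int_all.gspan_add int_all.gspan_smult) auto
    ultimately show ?thesis by simp
  qed
  then show "Z_span 4 (set A) = carrier_vec 4"
    using gspan_carrier unfolding Z_span_eq_gspan by blast
  show "x = 0\<^sub>v 4" if "x \<in> icone 4 (set A)" "- x \<in> icone 4 (set A)" for x
  proof -
    have x: "x \<in> carrier_vec 4" "0 \<le> x $ 3" "\<And>i. i < 3 \<Longrightarrow> v $ i * x $ 3 \<le> v $ 3 * x $ i"
      and y: "0 \<le> - x $ 3" "\<And>i. i < 3 \<Longrightarrow> v $ i * - x $ 3 \<le> v $ 3 * - x $ i"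
      using that unfolding icone_A[symmetric] icone_A_ext by auto
    have 0: "x $ 3 = 0" using x(1,2) y(1) by simp
    have "x $ i = 0" if "i < 3" for i
      using x(3)[OF that] y(2)[OF that] v that x(1) unfolding 0
      by (simp add: zero_le_mult_iff mult_le_0_iff)
    then show ?thesis using x(1) 0 by (intro vec4_eqI) auto
  qed
  show "\<exists>G\<subseteq>extreme_generators 4 A.
      icone 4 G = icone 4 (set A) \<and> (\<forall>g\<in>G. rvec (p_mid 4) \<notin> icone 4 {g})"
  proof (intro exI[of _ "A_ext v"] conjI ballI)
    show "A_ext v \<subseteq> extreme_generators 4 A" using A_ext_extreme by blast
    show "icone 4 (A_ext v) = icone 4 (set A)" by (rule icone_A)
    fix g assume g: "g \<in> A_ext v"
    then have gc: "g \<in> carrier_vec 4" using A_ext_carrier by blast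
    show "rvec (p_mid 4) \<notin> icone 4 {g}"
    proof
      assume "rvec (p_mid 4) \<in> icone 4 {g}"
      then obtain t where t: "rvec (p_mid 4) = t \<cdot>\<^sub>v rvec g"
        unfolding icone_singleton[OF gc] by blast
      have "1 = t * g $ k" if "k < 4" for k
        using arg_cong[OF t, of "\<lambda>x. x $ k"] that pk[OF that] gc
          dim_p_mid[of 4] by simp
      \<comment> \<open>These entries tell \<open>p\<close> from all four rays: the entries 0 and 1
        differ for \<open>v\<close> and for the first two unit vectors, and the third unit vector
        vanishes in entry 3.\<close>
      from this[of 0] this[of 1] this[of 3]
      have e: "1 = t * g $ 0" "t * g $ 0 = t * g $ 1" "1 = t * g $ 3" by simp_all
      then have "t \<noteq> 0" by auto
      then have "g $ 0 = g $ 1" using e(2) by simp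
      then show False using e(3) g v by (auto simp: A_ext_def)
    qed
  qed
  show "\<exists>q\<in>icone 4 (set A). \<exists>l>0.
      rvec (p_mid 4) - l \<cdot>\<^sub>v q \<in> icone 4 (set A) \<and> (\<forall>s. q \<noteq> s \<cdot>\<^sub>v rvec (p_mid 4))"
  proof (intro bexI exI conjI allI)
    \<comment> \<open>The largest multiple of the first unit vector that can be taken off
      \<open>p\<close>: the facet inequality for \<open>i = 0\<close> becomes an equality.\<close>
    let ?l = "1 - v $ 0 / v $ 3 :: real"
    have v3: "0 < real_of_int (v $ 3)" using v by simp
    show "unit_vec 4 0 \<in> icone 4 (set A)"
      unfolding icone_A[symmetric] icone_A_ext using v3 by auto
    show "0 < ?l" using v by simp
    show "rvec (p_mid 4) - ?l \<cdot>\<^sub>v unit_vec 4 0 \<in> icone 4 (set A)"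
      unfolding icone_A[symmetric] icone_A_ext
    proof (intro conjI allI impI)
      fix i :: nat assume i: "i < 3"
      show "v $ i * (rvec (p_mid 4) - ?l \<cdot>\<^sub>v unit_vec 4 0) $ 3 \<le>
          v $ 3 * (rvec (p_mid 4) - ?l \<cdot>\<^sub>v unit_vec 4 0) $ i"
        using v3 v_less[OF i] i by (cases "i = 0") (simp_all add: p_mid_index)
    qed (simp_all add: p_mid_index)
    show "unit_vec 4 0 \<noteq> s \<cdot>\<^sub>v rvec (p_mid 4)" for s
    proof
      assume *: "unit_vec 4 0 = s \<cdot>\<^sub>v rvec (p_mid 4)"
      show False
        using arg_cong[OF *, of "\<lambda>x. x $ 0"] arg_cong[OF *, of "\<lambda>x. x $ 3"] pk
          dim_p_mid[of 4] by simp
    qed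
  qed
qed

section \<open>Induction on the dimension\<close>

lemma conf_4: "conf A 4 = A"
proof -
  have "conf A (Suc 3) = A" by (subst conf.simps(2)) simp
  moreover have "Suc 3 = 4" by simp
  ultimately show ?thesis by (simp only:)
qed

lemma conf_Suc_bip: "apex_config d (conf A d) (p_mid d) \<Longrightarrow> 4 \<le> d \<Longrightarrow>
    conf A (Suc d) = apex_config.bip (conf A d) (p_mid d)"
  by (simp only: apex_config.bip_def conf_Suc)

lemma apex_config_conf: "4 \<le> d \<Longrightarrow> apex_config d (conf A d) (p_mid d)"
proof (induction d rule: dec_induct)
  case base
  show ?case using apex_config_A by (simp only: conf_4)
next
  case (step d)
  then show ?case
    using apex_config.apex_config_bip[OF step.IH] conf_Suc_bip[OF step.IH] p_mid_Suc by simp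
qed

lemma no_unimodular_conf: "4 \<le> d \<Longrightarrow> \<not> (\<exists>\<Delta>. unimodular_triangulation d (conf A d) \<Delta>)"
proof (induction d rule: dec_induct)
  case base
  show ?case using fz unfolding conf_4 firla_ziegler_def by blast
next
  case (step d)
  then show ?case
    using apex_config.no_unimodular_bip[OF apex_config_conf[OF step(1)]]
      conf_Suc_bip[OF apex_config_conf[OF step(1)] step(1)] by simp
qed

lemma bipyramid_cells_conf:
  assumes "4 \<le> d"
  shows "bipyramid_cells d (conf A d) (p_mid d) (conf_ext A v d)"
proof -
  interpret apex_config d "conf A d" "p_mid d" by (rule apex_config_conf[OF assms])
  show ?thesis
  proof
    show "conf_ext A v d \<subseteq> set (conf A d)"
      using A(3) conf_4 by (auto simp: conf_ext_def extreme_generators_def dest!: le_antisym[OF _ assms])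
    show "icone d (conf_ext A v d) = icone d (set (conf A d))"
    proof (cases "d = 4")
      case True
      then show ?thesis using icone_A conf_4 by (simp add: conf_ext_def)
    next
      case False
      then have E: "conf_ext A v d = extreme_generators d (conf A d)"
        using assms by (simp add: conf_ext_def)
      \<comment> \<open>The cone over all extreme generators lies between the cones over
        \<open>G\<close> and over the configuration, and these two agree.\<close>
      obtain G where G: "G \<subseteq> extreme_generators d (conf A d)" "icone d G = icone d (set (conf A d))"
        using extreme by blast
      have sub: "extreme_generators d (conf A d) \<subseteq> set (conf A d)"
        by (auto simp: extreme_generators_def)
      then have "finite (extreme_generators d (conf A d))" by (rule finite_subset) simp
      then show ?thesis
        using icone_mono[OF G(1), of d] icone_mono[OF sub, of d] G(2) unfolding E by auto
    qed
  qed
qed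

end

theorem theorem5p4:
  fixes A :: "int vec list" and v :: "int vec" and d :: nat
  assumes "firla_ziegler A v" and "5 \<le> d"
  shows "Z_span d {a \<in> set (conf A d). rvec a \<in> K1 A v d} = carrier_vec d \<and>
         Z_span d {a \<in> set (conf A d). rvec a \<in> K2 A v d} = carrier_vec d \<and>
         \<not> simplicial_config d (conf A d) \<and>
         max_sets (Delta A v d) = {cell1 A v d, cell2 A v d} \<and>
         Delta_d_normal TYPE('k::field) A v d \<and>
         \<not> (\<exists>\<Delta>. unimodular_triangulation d (conf A d) \<Delta>)"
proof -
  interpret firla_ziegler_config A v by standard (rule assms(1))
  obtain n where d: "d = Suc n" and n: "4 \<le> n" using assms(2) by (cases d) auto
  interpret bipyramid_cells n "conf A n" "p_mid n" "conf_ext A v n"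
    by (rule bipyramid_cells_conf[OF n])
  have conf: "conf A d = bip" unfolding d by (rule conf_Suc_bip[OF apex_config_conf[OF n] n])
  have base: "base_cell A v d = base"
    unfolding base_cell_def base_def conf by (simp add: d lift_eq_app1)
  have cells: "cell1 A v d = insert 0 base" "cell2 A v d = insert 1 base"
    by (simp_all add: cell1_def cell2_def base)
  have Delta: "Delta A v d = {\<tau>. \<tau> \<subseteq> insert 0 base \<or> \<tau> \<subseteq> insert 1 base}"
    by (simp add: Delta_def cells)
  have max: "max_sets (Delta A v d) = {cell1 A v d, cell2 A v d}"
    unfolding Delta cells by (rule max_sets_bip)
  have K: "K1 A v d = icone (Suc n) (insert (app1 (p_mid n) 1) (flat ` conf_ext A v n))"
    "K2 A v d = icone (Suc n) (insert (app1 (p_mid n) (-1)) (flat ` conf_ext A v n))"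
    unfolding K1_def K2_def cells conf sub_cells by (simp_all only: d)
  have "delta_normal TYPE('k) d (conf A d) (Delta A v d)" if "d = 5"
  proof -
    \<comment> \<open>For \<open>d = 5\<close> the base is the original simplicial cone: its four
      generators are independent, each cell has \<open>d\<close> elements, and \<open>v $ 3\<close>
      serves as the multiplier.\<close>
    have n4: "n = 4" using that d by simp
    have E: "conf_ext A v 4 = A_ext v" by (simp add: conf_ext_def)
    have "regular_triangulation TYPE('k) (Suc n) bip {\<tau>. \<tau> \<subseteq> insert 0 base \<or> \<tau> \<subseteq> insert 1 base}"
    proof (rule regular_triangulation_bip)
      show "\<forall>b\<in>conf_ext A v n. c b = 0"
        if "\<And>k. k < n \<Longrightarrow> (\<Sum>b\<in>conf_ext A v n. c b * b $ k) = 0" for c :: "int vec \<Rightarrow> int"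
        using that unfolding n4 E by (rule A_ext_independent)
      show "0 < nat (v $ 3)" using v by simp
      show "int (nat (v $ 3)) \<cdot>\<^sub>v a \<in> N_span n (conf_ext A v n)"
        if "a \<in> carrier_vec n" "rvec a \<in> icone n (set (conf A n))" for a
        unfolding n4 E by (rule mult_mem_N_span) (use that in \<open>simp_all only: n4 conf_4\<close>)
      show "card (conf_ext A v n) = n" unfolding n4 E by (rule card_A_ext)
    qed
    then show ?thesis
      using hilbert_cells_bip unfolding delta_normal_def Delta conf max_sets_bip by (simp only: d)
  qed
  then have "Delta_d_normal TYPE('k) A v d"
    using subdivision_normal_bip unfolding Delta_d_normal_def max unfolding cells conf by (simp add: d)
  moreover have "\<not> simplicial_config d (conf A d)"
    unfolding conf unfolding d by (rule not_simplicial_bip)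
  moreover have "\<not> (\<exists>\<Delta>. unimodular_triangulation d (conf A d) \<Delta>)"
    using no_unimodular_conf[of d] assms(2) by simp
  ultimately show ?thesis
    using Z_span_cell[of 1] Z_span_cell[of "-1"] max unfolding K conf by (simp add: d)
qed

end
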